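(* Let $1<p<\infty$. There is a constant $c_0\in(0,1/2]$, depending only on $p$ and the space $X$, such that the following holds. Let $\Omega\subset X$ be an open set with $\Omega\ne X$ and let $\mathcal{W}_c(\Omega)$ be a Whitney cover of $\Omega$ with $0<c\le c_0$. Then $\Omega$ admits a $p$-Hardy inequality if and only if the capacity $\operatorname{cap}_p(\cdot,\Omega)$ is quasiadditive with respect to $\mathcal{W}_c(\Omega)$ and there exist constants $c_1,c_2>0$ such that $$c_1\operatorname{rad}(B)^{-p}\mu(B)\le\operatorname{cap}_p(B,\Omega)\le c_2\operatorname{rad}(B)^{-p}\mu(B)$$ for all $B\in\mathcal{W}_c(\Omega)$.
   Context: Space: $X=(X,d,\mu)$ is a complete metric measure space, where $\mu$ is a Borel measure supported on $X$ with $0<\mu(B)<\infty$ for every open ball $B$, and $\mu$ is doubling: there is $C>0$ with $\mu(B(x,2r))\le C\mu(B(x,r))$ for all $x\in X$, $r>0$. Each ball $B$ has a fixed center $x_B$ and radius $\operatorname{rad}(B)$, and $tB=B(x_B,t\operatorname{rad}(B))$ for $t>0$. Upper gradients and Newtonian spaces: a Borel function $g\ge 0$ is an upper gradient of a measurable $f:X\to[-\infty,\infty]$ if $|f(y)-f(x)|\le\int_\gamma g\,ds$ for every compact rectifiable curve $\gamma$ with endpoints $x,y$ (with $\int_\gamma g\,ds=\infty$ required if $|f(x)|$ or $|f(y)|$ is infinite). $N^{1,p}(X)$ is the space of functions with $\|f\|_{N^{1,p}(X)}=(\int_X|f|^p\,d\mu+\inf_g\int_Xg^p\,d\mu)^{1/p}<\infty$,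 the infimum being over upper gradients $g$ of $f$, modulo $u\sim v$ iff $\|u-v\|_{N^{1,p}(X)}=0$. Poincaré inequality: $X$ supports a $(1,p)$-Poincaré inequality, i.e. there are $C>0$, $\lambda\ge1$ such that $\frac1{\mu(B)}\int_B|f-f_B|\,d\mu\le Cr\big(\frac1{\mu(\lambda B)}\int_{\lambda B}g^p\,d\mu\big)^{1/p}$ for every ball $B=B(x,r)$, every measurable $f$ and every upper gradient $g$ of $f$, with $f_B=\frac1{\mu(B)}\int_Bf\,d\mu$. Relative capacity: for measurable $E\subset\Omega$, $\operatorname{cap}_p(E,\Omega)=\inf_u\inf_{g_u}\int_Xg_u^p\,d\mu$ over all $u\in N^{1,p}(X)$ with $u=0$ on $X\setminus\Omega$, $u=1$ on $E$, $0\le u\le1$, and all upper gradients $g_u$ of $u$; it is $\infty$ if no such $u$ exists. Sets $E\subset\Omega$ are understood to be measurable, as in this definition. Whitney covers: $d_\Omega(x)=\operatorname{dist}(x,X\setminus\Omega)$. For $0<c\le1/2$, a Whitney cover $\mathcal{W}_c(\Omega)=\{B_i\}_{i\in\mathbb{N}}$ is a countable cover of $\Omega$ by balls $B_i=B(x_i,c\,d_\Omega(x_i))$, $x_i\in\Omega$, with uniformly bounded overlap $\sum_i\chi_{B_i}\le C<\infty$ (some $B_i$ may be empty). Quasiadditivity: $\operatorname{cap}_p(\cdot,\Omega)$ is quasiadditive with respect to a cover $\mathcal{W}$ of $\Omega$ if there is $A>0$ such that $\sum_{Q\in\mathcal{W}}\operatorname{cap}_p(E\cap Q,\Omega)\le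 A\operatorname{cap}_p(E,\Omega)$ for every $E\subset\Omega$. Hardy inequality: $\Omega$ admits a $p$-Hardy inequality if there is $C>0$ such that $\int_\Omega|u(x)|^pd_\Omega(x)^{-p}\,d\mu(x)\le C\int_\Omega g_u^p\,d\mu$ for all $u\in N^{1,p}(X)$ with $u=0$ on $X\setminus\Omega$ and all upper gradients $g_u$ of $u$. *)

theory Defs
  imports "HOL-Analysis.Analysis"
begin

text \<open>
  The metric space is a type of class \<^class>\<open>complete_space\<close> and the measure \<open>M\<close> is a
  measure on its Borel sets. ``Measurable'' without further qualification means measurable with
  respect to the completion of \<open>M\<close>; functions are extended real valued and defined everywhere.
\<close>

text \<open>Powers on \<open>[0,\<infinity>]\<close>; only used for exponents \<open>p > 0\<close>.\<close>

definition epow :: "ennreal \<Rightarrow> real \<Rightarrow> ennreal"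
  where "epow x p = (if x = top then top else ennreal (enn2real x powr p))"


subsection \<open>Rectifiable curves and line integrals\<close>

definition curve_length :: "(real \<Rightarrow> 'a::metric_space) \<Rightarrow> real \<Rightarrow> real \<Rightarrow> ennreal"
  where "curve_length \<gamma> a b =
    (SUP (n, t) \<in> {(n::nat, t). (\<forall>i\<le>n. t i \<in> {a..b}) \<and> (\<forall>i<n. t i \<le> t (Suc i))}.
        ennreal (\<Sum>i<n. dist (\<gamma> (t i)) (\<gamma> (t (Suc i)))))"

text \<open>
  Compact curves are parametrised on \<open>[0,1]\<close>. Constant curves are excluded, as is customary: they
  are irrelevant for real-valued functions, but would forbid the values \<open>\<plusminus>\<infinity>\<close> altogether in the
  definition of upper gradients.
\<close>

definition rectifiable_curve :: "(real \<Rightarrow> 'a::metric_space) \<Rightarrow> bool"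
  where "rectifiable_curve \<gamma> \<longleftrightarrow> path \<gamma> \<and> 0 < curve_length \<gamma> 0 1 \<and> curve_length \<gamma> 0 1 < top"

text \<open>
  The parametrisation by arc length on \<open>[0, \<ell>(\<gamma>)]\<close>. The choice of \<open>t\<close> is immaterial, since \<open>\<gamma>\<close> is
  constant between two parameters with the same value of the length function.
\<close>

definition arclength_param :: "(real \<Rightarrow> 'a::metric_space) \<Rightarrow> real \<Rightarrow> 'a"
  where "arclength_param \<gamma> s = \<gamma> (SOME t. t \<in> {0..1} \<and> curve_length \<gamma> 0 t = ennreal s)"

definition line_integral :: "(real \<Rightarrow> 'a::metric_space) \<Rightarrow> ('a \<Rightarrow> ennreal) \<Rightarrow> ennreal"
  where "line_integral \<gamma> g =
    (\<integral>\<^sup>+ s \<in> {0..enn2real (curve_length \<gamma> 0 1)}. g (arclength_param \<gamma> s) \<partial>lborel)"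


subsection \<open>Upper gradients, Newtonian functions and the Poincare inequality\<close>

definition upper_gradient :: "('a::metric_space \<Rightarrow> ennreal) \<Rightarrow> ('a \<Rightarrow> ereal) \<Rightarrow> bool"
  where "upper_gradient g f \<longleftrightarrow> g \<in> borel_measurable borel \<and>
    (\<forall>\<gamma>. rectifiable_curve \<gamma> \<longrightarrow>
      (let x = pathstart \<gamma>; y = pathfinish \<gamma> in
        if \<bar>f x\<bar> = \<infinity> \<or> \<bar>f y\<bar> = \<infinity> then line_integral \<gamma> g = top
        else e2ennreal \<bar>f y - f x\<bar> \<le> line_integral \<gamma> g))"

definition newtonian_norm :: "'a::metric_space measure \<Rightarrow> real \<Rightarrow> ('a \<Rightarrow> ereal) \<Rightarrow> ennreal"
  where "newtonian_norm M p f =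
    epow ((\<integral>\<^sup>+ x. epow (e2ennreal \<bar>f x\<bar>) p \<partial>completion M) +
          (INF g \<in> {g. upper_gradient g f}. \<integral>\<^sup>+ x. epow (g x) p \<partial>completion M)) (1 / p)"

text \<open>
  \<open>N\<^sup>1\<^sup>,\<^sup>p(X)\<close> as a space of pointwise defined functions. No quotient is formed, because
  boundary conditions such as \<open>u = 0\<close> on \<open>X - \<Omega>\<close> below refer to representatives.
\<close>

definition newtonian :: "'a::metric_space measure \<Rightarrow> real \<Rightarrow> ('a \<Rightarrow> ereal) set"
  where "newtonian M p = {f \<in> borel_measurable (completion M). newtonian_norm M p f < top}"

definition doubling_measure :: "'a::metric_space measure \<Rightarrow> bool"
  where "doubling_measure M \<longleftrightarrow>
    (\<exists>C>0. \<forall>x r. 0 < r \<longrightarrow> emeasure M (ball x (2 * r)) \<le> ennreal C * emeasure M (ball x r))"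

text \<open>
  The mean value \<open>f\<^sub>B\<close> only makes sense for functions integrable over the ball \<open>B\<close>. Such functions
  are finite almost everywhere, so \<^const>\<open>real_of_ereal\<close> does not affect the mean value.
\<close>

definition mean_value :: "'a::metric_space measure \<Rightarrow> 'a set \<Rightarrow> ('a \<Rightarrow> ereal) \<Rightarrow> real"
  where "mean_value M B f =
    (1 / measure M B) * (LINT x:B|completion M. real_of_ereal (f x))"

definition poincare_inequality :: "'a::metric_space measure \<Rightarrow> real \<Rightarrow> bool"
  where "poincare_inequality M p \<longleftrightarrow>
    (\<exists>C>0. \<exists>L\<ge>1. \<forall>x r f g.
      0 < r \<longrightarrow> f \<in> borel_measurable (completion M) \<longrightarrow>
      (\<integral>\<^sup>+ y \<in> ball x r. e2ennreal \<bar>f y\<bar> \<partial>completion M) < top \<longrightarrow>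
      upper_gradient g f \<longrightarrow>
        (1 / emeasure M (ball x r)) *
          (\<integral>\<^sup>+ y \<in> ball x r. e2ennreal \<bar>f y - ereal (mean_value M (ball x r) f)\<bar> \<partial>completion M)
        \<le> ennreal (C * r) *
          epow ((1 / emeasure M (ball x (L * r))) *
            (\<integral>\<^sup>+ y \<in> ball x (L * r). epow (g y) p \<partial>completion M)) (1 / p))"


subsection \<open>Relative capacity, quasiadditivity and the Hardy inequality\<close>

definition capacity :: "'a::metric_space measure \<Rightarrow> real \<Rightarrow> 'a set \<Rightarrow> 'a set \<Rightarrow> ennreal"
  where "capacity M p E \<Omega> =
    (INF u \<in> {u \<in> newtonian M p. (\<forall>x. x \<notin> \<Omega> \<longrightarrow> u x = 0) \<and> (\<forall>x\<in>E. u x = 1) \<and>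
                (\<forall>x. 0 \<le> u x \<and> u x \<le> 1)}.
      INF g \<in> {g. upper_gradient g u}. \<integral>\<^sup>+ x. epow (g x) p \<partial>completion M)"

definition quasiadditive ::
    "'a::metric_space measure \<Rightarrow> real \<Rightarrow> 'a set \<Rightarrow> (nat \<Rightarrow> 'a set) \<Rightarrow> bool"
  where "quasiadditive M p \<Omega> Q \<longleftrightarrow>
    (\<exists>A>0. \<forall>E \<in> sets (completion M). E \<subseteq> \<Omega> \<longrightarrow>
      (\<Sum>i. capacity M p (E \<inter> Q i) \<Omega>) \<le> ennreal A * capacity M p E \<Omega>)"

definition dist_compl :: "'a::metric_space set \<Rightarrow> 'a \<Rightarrow> real"
  where "dist_compl \<Omega> x = infdist x (- \<Omega>)"

definition hardy_inequality :: "'a::metric_space measure \<Rightarrow> real \<Rightarrow> 'a set \<Rightarrow> bool"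
  where "hardy_inequality M p \<Omega> \<longleftrightarrow>
    (\<exists>C>0. \<forall>u \<in> newtonian M p. \<forall>g. (\<forall>x. x \<notin> \<Omega> \<longrightarrow> u x = 0) \<longrightarrow> upper_gradient g u \<longrightarrow>
      (\<integral>\<^sup>+ x \<in> \<Omega>. epow (e2ennreal \<bar>u x\<bar>) p * ennreal (dist_compl \<Omega> x powr (- p)) \<partial>completion M)
      \<le> ennreal C * (\<integral>\<^sup>+ x \<in> \<Omega>. epow (g x) p \<partial>completion M))"


subsection \<open>Whitney covers\<close>

text \<open>
  A Whitney cover is a sequence of sets, given by the set \<open>I\<close> of indices of the
  nonempty balls and by their centres \<open>x i\<close> for \<open>i \<in> I\<close>; the members with index outside
  \<open>I\<close> are empty.
\<close>

definition whitney_rad :: "real \<Rightarrow> 'a::metric_space set \<Rightarrow> (nat \<Rightarrow> 'a) \<Rightarrow> nat \<Rightarrow> real"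
  where "whitney_rad c \<Omega> x i = c * dist_compl \<Omega> (x i)"

definition whitney_ball ::
    "real \<Rightarrow> 'a::metric_space set \<Rightarrow> nat set \<Rightarrow> (nat \<Rightarrow> 'a) \<Rightarrow> nat \<Rightarrow> 'a set"
  where "whitney_ball c \<Omega> I x i = (if i \<in> I then ball (x i) (whitney_rad c \<Omega> x i) else {})"

definition whitney_cover ::
    "real \<Rightarrow> 'a::metric_space set \<Rightarrow> nat set \<Rightarrow> (nat \<Rightarrow> 'a) \<Rightarrow> bool"
  where "whitney_cover c \<Omega> I x \<longleftrightarrow>
    0 < c \<and> c \<le> 1 / 2 \<and> x ` I \<subseteq> \<Omega> \<and> \<Omega> \<subseteq> (\<Union>i. whitney_ball c \<Omega> I x i) \<and>
    (\<exists>C::real. \<forall>y. (\<Sum>i. indicator (whitney_ball c \<Omega> I x i) y :: ennreal) \<le> ennreal C)"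

end

theory Submission
  imports Defs
begin

text \<open>
  Both directions rest on testing capacities with truncations of a given function, glued together
  by maxima and minima with cutoff functions. The gradient of such a function has to be cut off
  where the function vanishes. An upper gradient need not survive this, because it has to work along
  every curve, also where the function is discontinuous; but it does along all curves on which some
  fixed \<open>p\<close>-integrable upper gradient has finite integral, and a small multiple of the latter takes
  care of the others. This calculus is \<open>ug_modulo\<close>; its key lemma is \<open>ug_modulo_restrict\<close>, and
  \<open>capacity_le\<close> brings it back to capacities. It presupposes that an upper gradient inequality
  passes to all parts of a curve with the right arc length parametrisation (\<open>subcurve\<close>).

  Suppose that the Hardy inequality holds, and let \<open>u\<close> test the capacity of \<open>E\<close>. Localising \<open>u\<close> to
  twice the Whitney ball \<open>Q i\<close> of radius \<open>r\<close> gives a test function for \<open>E \<inter> Q i\<close> whose energy is at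
  most a constant times the integral of \<open>g^p + (u / r)^p\<close> over the doubled ball
  (\<open>capacity_piece_le\<close>). As \<open>r\<close> is comparable to the distance \<open>d\<close> to the complement there, and as
  the doubled balls still have bounded overlap, the sum over \<open>i\<close> is controlled by the integrals of
  \<open>g^p\<close> and \<open>(u / d)^p\<close>, hence by that of \<open>g^p\<close>. The bounds for the capacity of a single ball follow
  from the Hardy inequality for its test functions and from a cutoff function, respectively.

  Conversely, quasiadditivity reduces the estimate of \<open>d powr (- p)\<close>, integrated over a set \<open>E\<close>, by the
  capacity of \<open>E\<close> to the case that \<open>E\<close> lies in one ball \<open>ball x r\<close> of the cover
  (\<open>weighted_measure_le_capacity\<close>). Let \<open>u\<close> test the capacity of such an \<open>E\<close>. If the mean value of \<open>u\<close>
  over the doubled ball exceeds \<open>1/2\<close>, then, unless \<open>u\<close> has a lot of energy anyway, a cheap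
  modification of \<open>u\<close> is at least \<open>1/4\<close> on the whole ball, so that its energy is bounded below by
  the assumed lower bound for the capacity of the ball (\<open>measure_le_capacity\<close>). Otherwise \<open>u = 1\<close> on
  \<open>E\<close> exceeds its mean value, and the measure of \<open>E\<close> is at most a constant times \<open>r^p\<close> times the energy
  (\<open>measure_level_set_le\<close>). The \<open>(1,p)\<close>-Poincare inequality on the ball itself would give this only for
  the \<open>p\<close>-th power of the density of \<open>E\<close>; the right power comes from using it on many small balls, where
  the mean value of \<open>u\<close> jumps, and a covering argument. The Hardy inequality follows by applying the
  estimate to the superlevel sets of \<open>u\<close> for the levels \<open>2^j\<close> and summing over the integers \<open>j\<close>, as
  the energies of the corresponding truncations add up (\<open>capacity_superlevel_le\<close>).
\<close>

section \<open>Length of curves and the arc length parametrisation\<close>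

lemma polygon_le_curve_length:
  assumes "\<And>i. i \<le> n \<Longrightarrow> t i \<in> {a..b}" "\<And>i. i < n \<Longrightarrow> t i \<le> t (Suc i)"
  shows "ennreal (\<Sum>i<n. dist (\<gamma> (t i)) (\<gamma> (t (Suc i)))) \<le> curve_length \<gamma> a b"
  unfolding curve_length_def
  by (rule SUP_upper2[where i = "(n, t)"]) (use assms in auto)

lemma curve_length_le:
  assumes "\<And>n t. (\<And>i. i \<le> n \<Longrightarrow> t i \<in> {a..b}) \<Longrightarrow> (\<And>i. i < n \<Longrightarrow> t i \<le> t (Suc i)) \<Longrightarrow>
      ennreal (\<Sum>i<n. dist (\<gamma> (t i)) (\<gamma> (t (Suc i)))) \<le> B"
  shows "curve_length \<gamma> a b \<le> B"
  unfolding curve_length_def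
  by (rule SUP_least) (use assms in auto)

lemma dist_le_curve_length:
  assumes "a \<le> b"
  shows "ennreal (dist (\<gamma> a) (\<gamma> b)) \<le> curve_length \<gamma> a b"
  using polygon_le_curve_length[of 1 "\<lambda>i. if i = 0 then a else b" a b \<gamma>] assms by auto

lemma curve_length_mono:
  assumes "a \<le> a'" "b' \<le> b"
  shows "curve_length \<gamma> a' b' \<le> curve_length \<gamma> a b"
proof (rule curve_length_le, rule polygon_le_curve_length)
  fix n t i assume "\<And>i. i \<le> n \<Longrightarrow> t i \<in> {a'..b'}" "i \<le> (n::nat)"
  then have "t i \<in> {a'..b'}" by blast
  then show "t i \<in> {a..b}" using assms by auto
qed auto

lemma curve_length_refl: "curve_length \<gamma> a a = 0"
proof -
  have "curve_length \<gamma> a a \<le> 0"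
  proof (rule curve_length_le)
    fix n and t :: "nat \<Rightarrow> real" assume t: "\<And>i. i \<le> n \<Longrightarrow> t i \<in> {a..a}"
    have "(\<Sum>i<n. dist (\<gamma> (t i)) (\<gamma> (t (Suc i)))) = 0"
    proof (rule sum.neutral, rule ballI)
      fix i assume "i \<in> {..<n}"
      then have "t i = a" "t (Suc i) = a" using t[of i] t[of "Suc i"] by auto
      then show "dist (\<gamma> (t i)) (\<gamma> (t (Suc i))) = 0" by simp
    qed
    then show "ennreal (\<Sum>i<n. dist (\<gamma> (t i)) (\<gamma> (t (Suc i)))) \<le> 0" by simp
  qed
  then show ?thesis by simp
qed

text \<open>
  Clamping the nodes of a polygon from above and from below at \<open>b\<close> cuts it at \<open>b\<close>; a
  side that straddles \<open>b\<close> is controlled by the triangle inequality.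
\<close>

lemma dist_le_clamped:
  assumes "s \<le> t"
  shows "dist (\<gamma> s) (\<gamma> t) \<le>
    dist (\<gamma> (min s b)) (\<gamma> (min t b)) + dist (\<gamma> (max s b)) (\<gamma> (max t b))"
  using assms dist_triangle[of "\<gamma> s" "\<gamma> t" "\<gamma> b"]
  by (cases "t \<le> b"; cases "s \<le> b") (auto simp: min_def max_def)

lemma polygon_le_clamped:
  assumes "\<And>i. i < n \<Longrightarrow> t i \<le> t (Suc i)"
  shows "(\<Sum>i<n. dist (\<gamma> (t i)) (\<gamma> (t (Suc i)))) \<le>
    (\<Sum>i<n. dist (\<gamma> (min (t i) b)) (\<gamma> (min (t (Suc i)) b))) +
    (\<Sum>i<n. dist (\<gamma> (max (t i) b)) (\<gamma> (max (t (Suc i)) b)))"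
  unfolding sum.distrib[symmetric]
  by (rule sum_mono, rule dist_le_clamped) (use assms in auto)

lemma polygon_min_le:
  assumes "\<And>i. i \<le> n \<Longrightarrow> t i \<in> {a..c}" "\<And>i. i < n \<Longrightarrow> t i \<le> t (Suc i)" "a \<le> b"
  shows "ennreal (\<Sum>i<n. dist (\<gamma> (min (t i) b)) (\<gamma> (min (t (Suc i)) b))) \<le> curve_length \<gamma> a b"
proof (rule polygon_le_curve_length[where t = "\<lambda>i. min (t i) b"])
  fix i assume "i \<le> n"
  then show "min (t i) b \<in> {a..b}" using assms(1)[of i] assms(3) by auto
next
  fix i assume "i < n"
  then show "min (t i) b \<le> min (t (Suc i)) b" using assms(2)[of i] by auto
qed

lemma polygon_max_le:
  assumes "\<And>i. i \<le> n \<Longrightarrow> t i \<in> {a..c}" "\<And>i. i < n \<Longrightarrow> t i \<le> t (Suc i)" "b \<le> c"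
  shows "ennreal (\<Sum>i<n. dist (\<gamma> (max (t i) b)) (\<gamma> (max (t (Suc i)) b))) \<le> curve_length \<gamma> b c"
proof (rule polygon_le_curve_length[where t = "\<lambda>i. max (t i) b"])
  fix i assume "i \<le> n"
  then show "max (t i) b \<in> {b..c}" using assms(1)[of i] assms(3) by auto
next
  fix i assume "i < n"
  then show "max (t i) b \<le> max (t (Suc i)) b" using assms(2)[of i] by auto
qed

lemma curve_length_superadditive:
  assumes "a \<le> b" "b \<le> c"
  shows "curve_length \<gamma> a b + curve_length \<gamma> b c \<le> curve_length \<gamma> a c"
proof -
  let ?S = "\<lambda>n t. ennreal (\<Sum>i<n. dist (\<gamma> (t i)) (\<gamma> (t (Suc i))))"
  have *: "?S n t + ?S m s \<le> curve_length \<gamma> a c"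
    if t: "\<And>i. i \<le> n \<Longrightarrow> t i \<in> {a..b}" "\<And>i. i < n \<Longrightarrow> t i \<le> t (Suc i)"
      and s: "\<And>i. i \<le> m \<Longrightarrow> s i \<in> {b..c}" "\<And>i. i < m \<Longrightarrow> s i \<le> s (Suc i)"
    for n t m s
  proof -
    \<comment> \<open>The step from \<open>t n\<close> to \<open>s 0\<close> is kept, so that the concatenation has one step more.\<close>
    define r where "r i = (if i \<le> n then t i else s (i - Suc n))" for i
    have "(\<Sum>i<n. dist (\<gamma> (t i)) (\<gamma> (t (Suc i)))) = (\<Sum>i<n. dist (\<gamma> (r i)) (\<gamma> (r (Suc i))))"
      by (rule sum.cong) (auto simp: r_def)
    moreover have "(\<Sum>i<m. dist (\<gamma> (s i)) (\<gamma> (s (Suc i)))) =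
        (\<Sum>i\<in>{Suc n..<Suc n + m}. dist (\<gamma> (r i)) (\<gamma> (r (Suc i))))"
      by (rule sum.reindex_bij_witness[where i = "\<lambda>i. i - Suc n" and j = "\<lambda>i. i + Suc n"])
        (auto simp: r_def Suc_diff_le)
    moreover have "(\<Sum>i<n. dist (\<gamma> (r i)) (\<gamma> (r (Suc i)))) +
        (\<Sum>i\<in>{Suc n..<Suc n + m}. dist (\<gamma> (r i)) (\<gamma> (r (Suc i))))
        \<le> (\<Sum>i<Suc n + m. dist (\<gamma> (r i)) (\<gamma> (r (Suc i))))"
      by (subst sum.union_disjoint[symmetric]) (auto intro!: sum_mono2 simp del: sum.lessThan_Suc)
    ultimately have "?S n t + ?S m s \<le> ?S (Suc n + m) r"
      by (subst ennreal_plus[symmetric])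
        (auto intro!: sum_nonneg ennreal_leI simp del: sum.lessThan_Suc sum.op_ivl_Suc)
    also have "\<dots> \<le> curve_length \<gamma> a c"
    proof (rule polygon_le_curve_length)
      fix i assume i: "i \<le> Suc n + m"
      then have "i - Suc n \<le> m" by simp
      then show "r i \<in> {a..c}"
        using t(1)[of i] s(1)[of "i - Suc n"] i assms by (cases "i \<le> n") (auto simp: r_def)
    next
      fix i assume i: "i < Suc n + m"
      consider "i < n" | "i = n" | "i > n" by linarith
      then show "r i \<le> r (Suc i)"
      proof cases
        case 1 then show ?thesis using t(2)[of i] by (auto simp: r_def)
      next
        case 2 then show ?thesis using t(1)[of n] s(1)[of 0] by (auto simp: r_def)
      next
        case 3
        then have "i - n = Suc (i - Suc n)" "i - Suc n < m" using i by auto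
        then show ?thesis using s(2)[of "i - Suc n"] 3 by (auto simp: r_def)
      qed
    qed
    finally show ?thesis .
  qed
  let ?part = "\<lambda>a b. {(n::nat, t). (\<forall>i\<le>n. t i \<in> {a..b}) \<and> (\<forall>i<n. t i \<le> t (Suc i))}"
  have "?part a b \<noteq> {}" "?part b c \<noteq> {}"
    using assms by (auto intro!: exI[of _ 0] exI[of _ "\<lambda>_. b"])
  note ne = this
  let ?F = "\<lambda>(n, t). ?S n t"
  have "curve_length \<gamma> a b + curve_length \<gamma> b c = (SUP y\<in>?part b c. SUP x\<in>?part a b. ?F x + ?F y)"
    unfolding curve_length_def[of \<gamma> a b] curve_length_def[of \<gamma> b c]
    by (simp only: ennreal_SUP_add_left[OF ne(1), symmetric] ennreal_SUP_add_right[OF ne(2)])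
  also have "\<dots> \<le> curve_length \<gamma> a c" by (intro SUP_least) (use * in auto)
  finally show ?thesis .
qed

lemma curve_length_additive:
  assumes "a \<le> b" "b \<le> c"
  shows "curve_length \<gamma> a c = curve_length \<gamma> a b + curve_length \<gamma> b c"
proof (rule antisym)
  show "curve_length \<gamma> a c \<le> curve_length \<gamma> a b + curve_length \<gamma> b c"
  proof (rule curve_length_le)
    fix n t assume t: "\<And>i. i \<le> n \<Longrightarrow> t i \<in> {a..c}" "\<And>i. i < n \<Longrightarrow> t i \<le> t (Suc i)"
    have "ennreal (\<Sum>i<n. dist (\<gamma> (t i)) (\<gamma> (t (Suc i)))) \<le>
        ennreal (\<Sum>i<n. dist (\<gamma> (min (t i) b)) (\<gamma> (min (t (Suc i)) b))) +
        ennreal (\<Sum>i<n. dist (\<gamma> (max (t i) b)) (\<gamma> (max (t (Suc i)) b)))"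
      by (subst ennreal_plus[symmetric])
        (auto intro!: sum_nonneg ennreal_leI polygon_le_clamped t)
    also have "\<dots> \<le> curve_length \<gamma> a b + curve_length \<gamma> b c"
      by (intro add_mono polygon_min_le[of n t a c b] polygon_max_le[of n t a c b])
        (use t assms in auto)
    finally show "ennreal (\<Sum>i<n. dist (\<gamma> (t i)) (\<gamma> (t (Suc i)))) \<le> \<dots>" .
  qed
qed (rule curve_length_superadditive[OF assms])

lemma curve_length_affine:
  assumes "0 < m"
  shows "curve_length (\<lambda>x. \<gamma> (m * x + k)) a b = curve_length \<gamma> (m * a + k) (m * b + k)"
proof (rule antisym; rule curve_length_le)
  fix n t assume t: "\<And>i. i \<le> n \<Longrightarrow> t i \<in> {a..b}" "\<And>i. i < n \<Longrightarrow> t i \<le> t (Suc i)"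
  show "ennreal (\<Sum>i<n. dist (\<gamma> (m * t i + k)) (\<gamma> (m * t (Suc i) + k)))
      \<le> curve_length \<gamma> (m * a + k) (m * b + k)"
    by (rule polygon_le_curve_length[where t = "\<lambda>i. m * t i + k"]) (use t assms in auto)
next
  fix n t assume t: "\<And>i. i \<le> n \<Longrightarrow> t i \<in> {m * a + k..m * b + k}"
    "\<And>i. i < n \<Longrightarrow> t i \<le> t (Suc i)"
  have eq: "m * ((t i - k) / m) + k = t i" for i using assms by simp
  have "ennreal (\<Sum>i<n. dist (\<gamma> (m * ((t i - k) / m) + k)) (\<gamma> (m * ((t (Suc i) - k) / m) + k)))
      \<le> curve_length (\<lambda>x. \<gamma> (m * x + k)) a b"
    by (rule polygon_le_curve_length[where t = "\<lambda>i. (t i - k) / m"])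
      (use t assms in \<open>auto simp: field_simps\<close>)
  then show "ennreal (\<Sum>i<n. dist (\<gamma> (t i)) (\<gamma> (t (Suc i)))) \<le>
      curve_length (\<lambda>x. \<gamma> (m * x + k)) a b"
    unfolding eq .
qed

definition total_length :: "(real \<Rightarrow> 'a::metric_space) \<Rightarrow> real"
  where "total_length \<gamma> = enn2real (curve_length \<gamma> 0 1)"

definition length_upto :: "(real \<Rightarrow> 'a::metric_space) \<Rightarrow> real \<Rightarrow> real"
  where "length_upto \<gamma> t = enn2real (curve_length \<gamma> 0 t)"

lemma length_upto_nonneg: "0 \<le> length_upto \<gamma> t"
  unfolding length_upto_def by simp

lemma curve_length_finite:
  assumes "rectifiable_curve \<gamma>" "0 \<le> a" "b \<le> 1"
  shows "curve_length \<gamma> a b < top"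
  using curve_length_mono[of 0 a b 1 \<gamma>] assms unfolding rectifiable_curve_def
  by (auto intro: le_less_trans)

lemma curve_length_eq_diff:
  assumes "rectifiable_curve \<gamma>" "0 \<le> a" "a \<le> b" "b \<le> 1"
  shows "curve_length \<gamma> a b = ennreal (length_upto \<gamma> b - length_upto \<gamma> a)"
proof -
  have "curve_length \<gamma> 0 b = curve_length \<gamma> 0 a + curve_length \<gamma> a b"
    using assms by (intro curve_length_additive) auto
  moreover have "curve_length \<gamma> 0 a < top" "curve_length \<gamma> a b < top"
    using curve_length_finite[OF assms(1)] assms by auto
  ultimately show ?thesis
    unfolding length_upto_def by (simp add: enn2real_plus)
qed

lemma curve_length_eq_length_upto:
  assumes "rectifiable_curve \<gamma>" "0 \<le> b" "b \<le> 1"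
  shows "curve_length \<gamma> 0 b = ennreal (length_upto \<gamma> b)"
  unfolding length_upto_def using curve_length_finite[OF assms(1), of 0 b] assms by simp

lemma dist_le_length_upto:
  assumes "rectifiable_curve \<gamma>" "0 \<le> a" "a \<le> b" "b \<le> 1"
  shows "dist (\<gamma> a) (\<gamma> b) \<le> length_upto \<gamma> b - length_upto \<gamma> a"
proof -
  have "ennreal (dist (\<gamma> a) (\<gamma> b)) \<le> ennreal (length_upto \<gamma> b - length_upto \<gamma> a)"
    using dist_le_curve_length[OF assms(3), of \<gamma>] curve_length_eq_diff[OF assms] by simp
  moreover have "length_upto \<gamma> a \<le> length_upto \<gamma> b"
    unfolding length_upto_def
    by (rule enn2real_mono) (use assms curve_length_finite[OF assms(1), of 0 b] in
        \<open>auto intro!: curve_length_mono\<close>)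
  ultimately show ?thesis by (subst (asm) ennreal_le_iff) auto
qed

lemma length_upto_endpoints:
  assumes "rectifiable_curve \<gamma>"
  shows "length_upto \<gamma> 0 = 0" "length_upto \<gamma> 1 = total_length \<gamma>" "0 < total_length \<gamma>"
    "curve_length \<gamma> 0 1 = ennreal (total_length \<gamma>)"
  using assms unfolding rectifiable_curve_def total_length_def length_upto_def
  by (auto simp: curve_length_refl enn2real_positive_iff)

text \<open>
  The length of a nearly optimal polygon, cut at \<open>t\<close>, depends continuously on \<open>t\<close> and
  approximates the length function uniformly: it falls short of it by at most the total defect
  of the polygon.
\<close>

lemma continuous_on_length_upto:
  assumes \<gamma>: "rectifiable_curve \<gamma>"
  shows "continuous_on {0..1} (length_upto \<gamma>)"
proof -
  have cont: "continuous_on {0..1} \<gamma>" using \<gamma> by (simp add: rectifiable_curve_def path_def)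
  have ex: "\<exists>F. continuous_on {0..1} F \<and> (\<forall>t\<in>{0..1}. \<bar>F t - length_upto \<gamma> t\<bar> \<le> e)"
    if "0 < e" for e
  proof -
    let ?L = "total_length \<gamma>"
    note L = length_upto_endpoints[OF \<gamma>]
    have "ennreal (?L - e) < curve_length \<gamma> 0 1"
      using L \<open>0 < e\<close> by (simp add: ennreal_less_iff ennreal_lessI)
    then obtain n t where t: "\<And>i. i \<le> n \<Longrightarrow> t i \<in> {0..1}" "\<And>i. i < n \<Longrightarrow> t i \<le> t (Suc i)"
      and gt: "ennreal (?L - e) < ennreal (\<Sum>i<n. dist (\<gamma> (t i)) (\<gamma> (t (Suc i))))"
      unfolding curve_length_def less_SUP_iff by auto
    have gt': "?L - e < (\<Sum>i<n. dist (\<gamma> (t i)) (\<gamma> (t (Suc i))))"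
      using gt by (metis ennreal_leI linorder_not_less)
    define F where "F q = (\<Sum>i<n. dist (\<gamma> (min (t i) q)) (\<gamma> (min (t (Suc i)) q)))" for q
    define H where "H q = (\<Sum>i<n. dist (\<gamma> (max (t i) q)) (\<gamma> (max (t (Suc i)) q)))" for q
    have "continuous_on {0..1} F"
      unfolding F_def
    proof (intro continuous_on_sum continuous_on_dist)
      fix i assume "i \<in> {..<n}"
      then have "t i \<in> {0..1}" "t (Suc i) \<in> {0..1}" using t by auto
      then show "continuous_on {0..1} (\<lambda>q. \<gamma> (min (t i) q))"
        "continuous_on {0..1} (\<lambda>q. \<gamma> (min (t (Suc i)) q))"
        by (auto intro!: continuous_on_compose2[OF cont] continuous_intros)
    qed
    moreover have "\<bar>F q - length_upto \<gamma> q\<bar> \<le> e" if q: "q \<in> {0..1}" for q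
    proof -
      have "ennreal (F q) \<le> curve_length \<gamma> 0 q"
        unfolding F_def using polygon_min_le[of n t 0 1 q \<gamma>] t q by auto
      then have 1: "F q \<le> length_upto \<gamma> q"
        using curve_length_eq_length_upto[OF \<gamma>, of q] q length_upto_nonneg[of \<gamma> q]
        by (simp add: ennreal_le_iff)
      have "ennreal (H q) \<le> curve_length \<gamma> q 1"
        unfolding H_def using polygon_max_le[of n t 0 1 q \<gamma>] t q by auto
      also have "\<dots> = ennreal (?L - length_upto \<gamma> q)"
        using curve_length_eq_diff[OF \<gamma>, of q 1] q L by simp
      finally have "H q \<le> ?L - length_upto \<gamma> q"
        using order_trans[OF zero_le_dist dist_le_length_upto[OF \<gamma>, of q 1]] L q
        by (subst (asm) ennreal_le_iff) auto
      moreover have "(\<Sum>i<n. dist (\<gamma> (t i)) (\<gamma> (t (Suc i)))) \<le> F q + H q"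
        unfolding F_def H_def by (rule polygon_le_clamped) (rule t)
      ultimately show ?thesis using 1 gt' by linarith
    qed
    ultimately show ?thesis by blast
  qed
  show ?thesis
  proof (rule continuous_on_iff[THEN iffD2], intro ballI allI impI)
    fix x e :: real assume x: "x \<in> {0..1}" and e: "0 < e"
    obtain F where F: "continuous_on {0..1} F" "\<forall>t\<in>{0..1}. \<bar>F t - length_upto \<gamma> t\<bar> \<le> e / 4"
      using ex[of "e / 4"] e by auto
    then obtain d where "d > 0" "\<forall>x'\<in>{0..1}. dist x' x < d \<longrightarrow> dist (F x') (F x) < e / 4"
      using x e unfolding continuous_on_iff by (metis zero_less_divide_iff zero_less_numeral)
    moreover have "dist (length_upto \<gamma> x') (length_upto \<gamma> x) < e"
      if "x' \<in> {0..1}" "dist (F x') (F x) < e / 4" for x'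
    proof -
      have "\<bar>F x' - length_upto \<gamma> x'\<bar> \<le> e / 4" "\<bar>F x - length_upto \<gamma> x\<bar> \<le> e / 4"
        using F(2) that(1) x by blast+
      then show ?thesis using that(2) e unfolding dist_real_def by linarith
    qed
    ultimately show "\<exists>d>0. \<forall>x'\<in>{0..1}. dist x' x < d \<longrightarrow>
        dist (length_upto \<gamma> x') (length_upto \<gamma> x) < e"
      by blast
  qed
qed

lemma arclength_param_unique:
  assumes \<gamma>: "rectifiable_curve \<gamma>" and t: "t \<in> {0..1}" "length_upto \<gamma> t = s"
  shows "arclength_param \<gamma> s = \<gamma> t"
proof -
  define t' where "t' = (SOME t. t \<in> {0..1} \<and> curve_length \<gamma> 0 t = ennreal s)"
  have "curve_length \<gamma> 0 t = ennreal s" using curve_length_eq_length_upto[OF \<gamma>, of t] t by simp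
  then have "t' \<in> {0..1} \<and> curve_length \<gamma> 0 t' = ennreal s"
    unfolding t'_def using t(1)
    by (intro someI[where P = "\<lambda>t. t \<in> {0..1} \<and> curve_length \<gamma> 0 t = ennreal s" and x = t]) blast
  then have t': "t' \<in> {0..1}" "length_upto \<gamma> t' = s"
    using t(2) by (auto simp: length_upto_def)
  have "dist (\<gamma> t) (\<gamma> t') \<le> 0"
  proof (cases "t \<le> t'")
    case True
    then show ?thesis using dist_le_length_upto[OF \<gamma>, of t t'] t t' by simp
  next
    case False
    then show ?thesis
      using dist_le_length_upto[OF \<gamma>, of t' t] t t' by (simp add: dist_commute[of "\<gamma> t"])
  qed
  then show ?thesis unfolding arclength_param_def t'_def[symmetric] by simp
qed

lemma length_upto_surj:
  assumes \<gamma>: "rectifiable_curve \<gamma>" and s: "s \<in> {0..total_length \<gamma>}"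
  obtains t where "t \<in> {0..1}" "length_upto \<gamma> t = s"
proof -
  have "\<exists>t. 0 \<le> t \<and> t \<le> 1 \<and> length_upto \<gamma> t = s"
    using continuous_on_length_upto[OF \<gamma>] length_upto_endpoints[OF \<gamma>] s
    by (intro IVT') auto
  then show ?thesis using that by auto
qed

lemma length_upto_mono:
  assumes "rectifiable_curve \<gamma>" "0 \<le> a" "a \<le> b" "b \<le> 1"
  shows "length_upto \<gamma> a \<le> length_upto \<gamma> b"
  using dist_le_length_upto[OF assms] zero_le_dist[of "\<gamma> a" "\<gamma> b"] by linarith

lemma dist_arclength_param:
  assumes \<gamma>: "rectifiable_curve \<gamma>" and "0 \<le> s" "s \<le> t" "t \<le> total_length \<gamma>"
  shows "dist (arclength_param \<gamma> s) (arclength_param \<gamma> t) \<le> t - s"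
proof -
  obtain a where a: "a \<in> {0..1}" "length_upto \<gamma> a = s" using length_upto_surj[OF \<gamma>, of s] assms by auto
  obtain b where b: "b \<in> {0..1}" "length_upto \<gamma> b = t" using length_upto_surj[OF \<gamma>, of t] assms by auto
  have "dist (\<gamma> a) (\<gamma> b) \<le> t - s"
  proof (cases "a \<le> b")
    case True
    then show ?thesis using dist_le_length_upto[OF \<gamma>, of a b] a b by auto
  next
    case False
    then have "dist (\<gamma> b) (\<gamma> a) \<le> s - t" using dist_le_length_upto[OF \<gamma>, of b a] a b by auto
    then show ?thesis using assms(3) by (simp add: dist_commute)
  qed
  then show ?thesis
    unfolding arclength_param_unique[OF \<gamma> a] arclength_param_unique[OF \<gamma> b] .
qed

lemma arclength_param_endpoints:
  assumes \<gamma>: "rectifiable_curve \<gamma>"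
  shows "arclength_param \<gamma> 0 = pathstart \<gamma>" "arclength_param \<gamma> (total_length \<gamma>) = pathfinish \<gamma>"
proof -
  show "arclength_param \<gamma> 0 = pathstart \<gamma>"
    using length_upto_endpoints(1)[OF \<gamma>] unfolding pathstart_def
    by (intro arclength_param_unique[OF \<gamma>]) auto
  show "arclength_param \<gamma> (total_length \<gamma>) = pathfinish \<gamma>"
    using length_upto_endpoints(2)[OF \<gamma>] unfolding pathfinish_def
    by (intro arclength_param_unique[OF \<gamma>]) auto
qed

lemma continuous_on_arclength_param:
  assumes \<gamma>: "rectifiable_curve \<gamma>"
  shows "continuous_on {0..total_length \<gamma>} (arclength_param \<gamma>)"
proof (rule continuous_on_iff[THEN iffD2], intro ballI allI impI)
  fix s e assume s: "s \<in> {0..total_length \<gamma>}" and e: "(0::real) < e"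
  have "dist (arclength_param \<gamma> t) (arclength_param \<gamma> s) \<le> dist t s"
    if "t \<in> {0..total_length \<gamma>}" for t
  proof (cases "s \<le> t")
    case True
    then show ?thesis
      using dist_arclength_param[OF \<gamma>, of s t] s that
      by (simp add: dist_commute[of "arclength_param \<gamma> t"] dist_real_def)
  next
    case False
    then show ?thesis
      using dist_arclength_param[OF \<gamma>, of t s] s that by (simp add: dist_real_def)
  qed
  then show "\<exists>d>0. \<forall>t\<in>{0..total_length \<gamma>}. dist t s < d \<longrightarrow>
      dist (arclength_param \<gamma> t) (arclength_param \<gamma> s) < e"
    using e by (intro exI[of _ e]) (metis le_less_trans)
qed

text \<open>
  This is why upper gradient inequalities pass to all parts of a curve. It holds because the length
  functions of the part and of the whole curve differ by a constant.
\<close>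

lemma subcurve:
  assumes \<gamma>: "rectifiable_curve \<gamma>" and st: "0 \<le> s" "s < t" "t \<le> total_length \<gamma>"
  obtains \<eta> where "rectifiable_curve \<eta>" "total_length \<eta> = t - s"
    "\<And>q. q \<in> {0..t - s} \<Longrightarrow> arclength_param \<eta> q = arclength_param \<gamma> (s + q)"
proof -
  obtain a where a: "a \<in> {0..1}" "length_upto \<gamma> a = s" using length_upto_surj[OF \<gamma>, of s] st by auto
  obtain b where b: "b \<in> {0..1}" "length_upto \<gamma> b = t" using length_upto_surj[OF \<gamma>, of t] st by auto
  have ab: "a < b"
  proof (rule ccontr)
    assume "\<not> a < b"
    then show False using length_upto_mono[OF \<gamma>, of b a] a b st by auto
  qed
  define \<eta> where \<eta>: "\<eta> = (\<lambda>x. \<gamma> ((b - a) * x + a))"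
  have len: "curve_length \<eta> 0 q = ennreal (length_upto \<gamma> ((b - a) * q + a) - s)"
    and in01: "(b - a) * q + a \<in> {a..b}" if q: "q \<in> {0..1}" for q
  proof -
    have "(b - a) * q \<le> b - a" "0 \<le> (b - a) * q" using ab q by (auto intro: mult_left_le)
    then show *: "(b - a) * q + a \<in> {a..b}" unfolding atLeastAtMost_iff by linarith
    have "curve_length \<eta> 0 q = curve_length \<gamma> a ((b - a) * q + a)"
      unfolding \<eta> using curve_length_affine[of "b - a" \<gamma> a 0 q] ab by simp
    then show "curve_length \<eta> 0 q = ennreal (length_upto \<gamma> ((b - a) * q + a) - s)"
      using curve_length_eq_diff[OF \<gamma>, of a "(b - a) * q + a"] a b * by auto
  qed
  have len1: "curve_length \<eta> 0 1 = ennreal (t - s)" using len[of 1] b by simp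
  have "continuous_on {0..1} \<gamma>" using \<gamma> by (simp add: rectifiable_curve_def path_def)
  then have "path \<eta>"
    unfolding \<eta> path_def
  proof (rule continuous_on_compose2)
    show "(\<lambda>x. (b - a) * x + a) ` {0..1} \<subseteq> {0..1}"
    proof (rule image_subsetI)
      fix x :: real assume "x \<in> {0..1}"
      from in01[OF this] show "(b - a) * x + a \<in> {0..1}" using a b by auto
    qed
  qed (auto intro!: continuous_intros)
  then have rect: "rectifiable_curve \<eta>" unfolding rectifiable_curve_def len1 using st by simp
  have tot: "total_length \<eta> = t - s" unfolding total_length_def len1 using st by simp
  have "arclength_param \<eta> q = arclength_param \<gamma> (s + q)" if q: "q \<in> {0..t - s}" for q
  proof -
    obtain x where x: "x \<in> {0..1}" "length_upto \<eta> x = q"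
      using length_upto_surj[OF rect, of q] q tot by auto
    have "length_upto \<eta> x = length_upto \<gamma> ((b - a) * x + a) - s"
      using length_upto_mono[OF \<gamma>, of a "(b - a) * x + a"] in01[OF x(1)] a b
      by (simp add: length_upto_def[of \<eta>] len[OF x(1)])
    then have "arclength_param \<gamma> (s + q) = \<gamma> ((b - a) * x + a)"
      using in01[OF x(1)] a b x by (intro arclength_param_unique[OF \<gamma>]) auto
    also have "\<dots> = \<eta> x" by (simp add: \<eta>)
    also have "\<dots> = arclength_param \<eta> q" using arclength_param_unique[OF rect x] by simp
    finally show ?thesis ..
  qed
  with rect tot show ?thesis by (rule that)
qed

section \<open>Upper gradients modulo a function\<close>

lemma epow_ennreal: "0 \<le> a \<Longrightarrow> epow (ennreal a) p = ennreal (a powr p)"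
  unfolding epow_def by simp

lemma epow_0 [simp]: "epow 0 p = 0"
  unfolding epow_def by simp

lemma epow_mono:
  assumes "x \<le> y" "0 \<le> p"
  shows "epow x p \<le> epow y p"
proof (cases "y = top")
  case False
  then have "x \<noteq> top" using assms by (auto simp: top_unique)
  then show ?thesis
    using assms False unfolding epow_def
    by (auto intro!: ennreal_leI powr_mono2 enn2real_mono simp: top.not_eq_extremum)
qed (simp add: epow_def)

lemma epow_mult:
  assumes "0 \<le> c" "0 < p"
  shows "epow (ennreal c * x) p = ennreal (c powr p) * epow x p"
proof (cases "x = top")
  case True
  then show ?thesis
    using assms by (cases "c = 0") (auto simp: epow_def ennreal_mult_top)
next
  case False
  then obtain r where "x = ennreal r" "0 \<le> r" by (metis ennreal_cases)
  then show ?thesis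
    using assms by (simp add: epow_ennreal powr_mult flip: ennreal_mult)
qed

lemma epow_add_le:
  assumes "0 < p"
  shows "epow (x + y) p \<le> ennreal (2 powr p) * (epow x p + epow y p)"
proof -
  have "epow (x + y) p \<le> epow (ennreal 2 * max x y) p"
    using assms by (intro epow_mono) (auto simp: mult_2 max_def intro!: add_mono)
  also have "\<dots> = ennreal (2 powr p) * epow (max x y) p"
    using assms by (intro epow_mult) auto
  also have "\<dots> \<le> ennreal (2 powr p) * (epow x p + epow y p)"
    by (intro mult_left_mono) (auto simp: max_def)
  finally show ?thesis .
qed

lemma epow_measurable [measurable]: "(\<lambda>x. epow x p) \<in> borel_measurable borel"
  unfolding epow_def by measurable

lemma epow_indicator:
  "epow (x * indicator A y) p = epow x p * indicator A y"
  by (auto simp: indicator_def)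

lemma epow_finite: "x < top \<Longrightarrow> epow x p < top"
  unfolding epow_def by auto

lemma epow_less_topD: "epow x p < top \<Longrightarrow> x < top"
  unfolding epow_def by (auto simp: top.not_eq_extremum split: if_splits)

abbreviation p_energy :: "'a measure \<Rightarrow> real \<Rightarrow> ('a \<Rightarrow> ennreal) \<Rightarrow> ennreal"
  where "p_energy M p g \<equiv> \<integral>\<^sup>+ x. epow (g x) p \<partial>completion M"

definition arc_integral :: "(real \<Rightarrow> 'a::metric_space) \<Rightarrow> ('a \<Rightarrow> ennreal) \<Rightarrow> real \<Rightarrow> real \<Rightarrow> ennreal"
  where "arc_integral \<gamma> g s t = (\<integral>\<^sup>+ q \<in> {s..t}. g (arclength_param \<gamma> q) \<partial>lborel)"

lemma line_integral_eq: "line_integral \<gamma> g = arc_integral \<gamma> g 0 (total_length \<gamma>)"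
  unfolding line_integral_def arc_integral_def total_length_def ..

lemma arc_integrand_measurable:
  fixes \<gamma> :: "real \<Rightarrow> 'a::metric_space" and g :: "'a \<Rightarrow> ennreal"
  assumes \<gamma>: "rectifiable_curve \<gamma>" and g: "g \<in> borel_measurable borel"
    and st: "0 \<le> s" "t \<le> total_length \<gamma>"
  shows "(\<lambda>q. g (arclength_param \<gamma> q) * indicator {s..t} q) \<in> borel_measurable borel"
proof -
  let ?L = "total_length \<gamma>"
  have "continuous_on UNIV (\<lambda>q. arclength_param \<gamma> (max 0 (min q ?L)))"
    using length_upto_endpoints(3)[OF \<gamma>]
    by (intro continuous_on_compose2[OF continuous_on_arclength_param[OF \<gamma>]] continuous_intros) auto
  then have "(\<lambda>q. arclength_param \<gamma> (max 0 (min q ?L))) \<in> borel_measurable borel"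
    by (rule borel_measurable_continuous_onI)
  then have "(\<lambda>q. g (arclength_param \<gamma> (max 0 (min q ?L)))) \<in> borel_measurable borel"
    using g by (rule measurable_compose)
  then have "(\<lambda>q. g (arclength_param \<gamma> (max 0 (min q ?L))) * indicator {s..t} q) \<in> borel_measurable borel"
    by measurable
  also have "(\<lambda>q. g (arclength_param \<gamma> (max 0 (min q ?L))) * indicator {s..t} q) =
      (\<lambda>q. g (arclength_param \<gamma> q) * indicator {s..t} q)"
    using st by (auto simp: indicator_def)
  finally show ?thesis .
qed

lemma subcurve_integral:
  assumes \<gamma>: "rectifiable_curve \<gamma>" and st: "0 \<le> s" "s < t" "t \<le> total_length \<gamma>"
  obtains \<eta> where "rectifiable_curve \<eta>" "pathstart \<eta> = arclength_param \<gamma> s"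
    "pathfinish \<eta> = arclength_param \<gamma> t"
    "\<And>g. g \<in> borel_measurable borel \<Longrightarrow> line_integral \<eta> g = arc_integral \<gamma> g s t"
proof -
  obtain \<eta> where \<eta>: "rectifiable_curve \<eta>" "total_length \<eta> = t - s"
    "\<And>q. q \<in> {0..t - s} \<Longrightarrow> arclength_param \<eta> q = arclength_param \<gamma> (s + q)"
    using subcurve[OF assms] by blast
  have "line_integral \<eta> g = arc_integral \<gamma> g s t" if g: "g \<in> borel_measurable borel" for g
  proof -
    have "arc_integral \<gamma> g s t =
        (\<integral>\<^sup>+ q. g (arclength_param \<gamma> (s + 1 * q)) * indicator {s..t} (s + 1 * q) \<partial>lborel)"
      unfolding arc_integral_def
      using nn_integral_real_affine[OF arc_integrand_measurable[OF \<gamma> g st(1,3)], of 1 s] by simp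
    also have "\<dots> = (\<integral>\<^sup>+ q. g (arclength_param \<eta> q) * indicator {0..t - s} q \<partial>lborel)"
      by (intro nn_integral_cong) (auto simp: indicator_def \<eta>(3))
    finally show ?thesis unfolding line_integral_eq arc_integral_def \<eta>(2) ..
  qed
  then show ?thesis
    using that[OF \<eta>(1)] arclength_param_endpoints[OF \<eta>(1)] \<eta>(2,3) st by auto
qed

lemma arc_integral_mono:
  assumes "s \<le> s'" "t' \<le> t" "\<And>q. s' \<le> q \<Longrightarrow> q \<le> t' \<Longrightarrow> g (arclength_param \<gamma> q) \<le> h (arclength_param \<gamma> q)"
  shows "arc_integral \<gamma> g s' t' \<le> arc_integral \<gamma> h s t"
  unfolding arc_integral_def using assms
  by (intro nn_integral_mono) (auto simp: indicator_def)

lemma arc_integral_split: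
  assumes \<gamma>: "rectifiable_curve \<gamma>" and g: "g \<in> borel_measurable borel"
    and "0 \<le> s" "s \<le> a" "a \<le> b" "b \<le> t" "t \<le> total_length \<gamma>"
  shows "arc_integral \<gamma> g s a + arc_integral \<gamma> g b t \<le> arc_integral \<gamma> g s t"
proof -
  have "arc_integral \<gamma> g s a + arc_integral \<gamma> g b t =
      (\<integral>\<^sup>+ q. g (arclength_param \<gamma> q) * indicator {s..a} q + g (arclength_param \<gamma> q) * indicator {b..t} q \<partial>lborel)"
    unfolding arc_integral_def
    by (subst nn_integral_add) (use arc_integrand_measurable[OF \<gamma> g] assms in auto)
  also have "\<dots> \<le> arc_integral \<gamma> g s t"
    unfolding arc_integral_def
  proof (rule nn_integral_mono_AE)
    show "AE q in lborel. g (arclength_param \<gamma> q) * indicator {s..a} q +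
        g (arclength_param \<gamma> q) * indicator {b..t} q \<le> g (arclength_param \<gamma> q) * indicator {s..t} q"
      using AE_lborel_singleton[of a] by eventually_elim (use assms in \<open>auto simp: indicator_def\<close>)
  qed
  finally show ?thesis .
qed

lemma arc_integral_add:
  assumes \<gamma>: "rectifiable_curve \<gamma>" and g: "g \<in> borel_measurable borel" "h \<in> borel_measurable borel"
    and "0 \<le> s" "t \<le> total_length \<gamma>"
  shows "arc_integral \<gamma> (\<lambda>x. ennreal a * g x + ennreal b * h x) s t =
    ennreal a * arc_integral \<gamma> g s t + ennreal b * arc_integral \<gamma> h s t"
proof -
  have m: "(\<lambda>q. g (arclength_param \<gamma> q) * indicator {s..t} q) \<in> borel_measurable lborel"
      "(\<lambda>q. h (arclength_param \<gamma> q) * indicator {s..t} q) \<in> borel_measurable lborel"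
    using arc_integrand_measurable[OF \<gamma>] assms by auto
  have "arc_integral \<gamma> (\<lambda>x. ennreal a * g x + ennreal b * h x) s t =
    (\<integral>\<^sup>+ q. ennreal a * (g (arclength_param \<gamma> q) * indicator {s..t} q) +
       ennreal b * (h (arclength_param \<gamma> q) * indicator {s..t} q) \<partial>lborel)"
    unfolding arc_integral_def by (intro nn_integral_cong) (auto simp: indicator_def)
  also have "\<dots> = ennreal a * arc_integral \<gamma> g s t + ennreal b * arc_integral \<gamma> h s t"
    unfolding arc_integral_def using m
    by (subst nn_integral_add) (auto simp: nn_integral_cmult)
  finally show ?thesis .
qed

lemma small_integral_near_point:
  fixes f :: "real \<Rightarrow> ennreal"
  assumes f: "f \<in> borel_measurable borel" and fin: "(\<integral>\<^sup>+ x. f x \<partial>lborel) < top" and e: "0 < e"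
  obtains d where "0 < d" "(\<integral>\<^sup>+ q\<in>{x - d..x + d}. f q \<partial>lborel) < e"
proof -
  define A where "A n = {x - 1 / Suc n..x + 1 / Suc n}" for n
  let ?\<nu> = "density lborel f"
  have eq: "emeasure ?\<nu> B = (\<integral>\<^sup>+ q\<in>B. f q \<partial>lborel)" if "B \<in> sets borel" for B
    using f that by (subst emeasure_density) auto
  have "(\<lambda>n. emeasure ?\<nu> (A n)) \<longlonglongrightarrow> emeasure ?\<nu> (\<Inter>n. A n)"
  proof (rule Lim_emeasure_decseq)
    show "decseq A"
      unfolding A_def decseq_def
    proof (intro allI impI)
      fix m n :: nat assume "m \<le> n"
      then have "1 / real (Suc n) \<le> 1 / real (Suc m)" by (intro divide_left_mono) auto
      then show "{x - 1 / Suc n..x + 1 / Suc n} \<subseteq> {x - 1 / Suc m..x + 1 / Suc m}"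
        unfolding atLeastatMost_subset_iff by linarith
    qed
    show "emeasure ?\<nu> (A n) \<noteq> \<infinity>" for n
    proof -
      have "emeasure ?\<nu> (A n) \<le> emeasure ?\<nu> UNIV" by (intro emeasure_mono) auto
      then show ?thesis using fin eq[of UNIV] by (auto simp: top_unique)
    qed
  qed (auto simp: A_def)
  also have "(\<Inter>n. A n) = {x}"
  proof -
    have "q = x" if "\<And>n. \<bar>q - x\<bar> \<le> 1 / Suc n" for q
    proof (rule ccontr)
      assume "q \<noteq> x"
      then obtain n where "1 / Suc n < \<bar>q - x\<bar>" using nat_approx_posE[of "\<bar>q - x\<bar>"] by auto
      then show False using that[of n] by simp
    qed
    then show ?thesis by (auto simp: A_def abs_le_iff algebra_simps)
  qed
  also have "emeasure ?\<nu> {x} = 0"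
    using eq[of "{x}"] by simp
  finally have "eventually (\<lambda>n. emeasure ?\<nu> (A n) < e) sequentially"
    using e by (rule order_tendstoD(2))
  then obtain n where "emeasure ?\<nu> (A n) < e" by (auto simp: eventually_sequentially)
  then show ?thesis using eq[of "A n"] by (intro that[of "1 / Suc n"]) (auto simp: A_def)
qed

text \<open>
  \<open>ug_modulo k h f\<close>: along curves of finite \<open>k\<close>-integral, \<open>f\<close> is continuous and has the upper
  gradient \<open>h\<close>. If \<open>k\<close> is \<open>p\<close>-integrable, then almost every curve qualifies, so \<open>h\<close> is what is
  known as a \<open>p\<close>-weak upper gradient. Unlike genuine upper gradients, these may be cut off where \<open>f\<close>
  vanishes, and an arbitrarily small multiple of \<open>k\<close> turns them into genuine ones.
\<close>

definition ug_modulo :: "('a::metric_space \<Rightarrow> ennreal) \<Rightarrow> ('a \<Rightarrow> ennreal) \<Rightarrow> ('a \<Rightarrow> real) \<Rightarrow> bool"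
  where "ug_modulo k h f \<longleftrightarrow> h \<in> borel_measurable borel \<and>
    (\<forall>\<gamma>. rectifiable_curve \<gamma> \<longrightarrow> line_integral \<gamma> k < top \<longrightarrow>
      continuous_on {0..total_length \<gamma>} (\<lambda>s. f (arclength_param \<gamma> s)) \<and>
      (\<forall>s t. 0 \<le> s \<longrightarrow> s \<le> t \<longrightarrow> t \<le> total_length \<gamma> \<longrightarrow>
        ennreal \<bar>f (arclength_param \<gamma> t) - f (arclength_param \<gamma> s)\<bar> \<le> arc_integral \<gamma> h s t))"

lemma ug_moduloI:
  assumes "h \<in> borel_measurable borel"
    and "\<And>\<gamma>. rectifiable_curve \<gamma> \<Longrightarrow> line_integral \<gamma> k < top \<Longrightarrow>
      continuous_on {0..total_length \<gamma>} (\<lambda>s. f (arclength_param \<gamma> s))"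
    and "\<And>\<gamma> s t. rectifiable_curve \<gamma> \<Longrightarrow> line_integral \<gamma> k < top \<Longrightarrow> 0 \<le> s \<Longrightarrow> s \<le> t \<Longrightarrow>
      t \<le> total_length \<gamma> \<Longrightarrow>
      ennreal \<bar>f (arclength_param \<gamma> t) - f (arclength_param \<gamma> s)\<bar> \<le> arc_integral \<gamma> h s t"
  shows "ug_modulo k h f"
  using assms unfolding ug_modulo_def by blast

lemma ug_moduloD:
  assumes "ug_modulo k h f"
  shows "h \<in> borel_measurable borel"
    and "\<And>\<gamma>. rectifiable_curve \<gamma> \<Longrightarrow> line_integral \<gamma> k < top \<Longrightarrow>
      continuous_on {0..total_length \<gamma>} (\<lambda>s. f (arclength_param \<gamma> s))"
    and "\<And>\<gamma> s t. rectifiable_curve \<gamma> \<Longrightarrow> line_integral \<gamma> k < top \<Longrightarrow> 0 \<le> s \<Longrightarrow> s \<le> t \<Longrightarrow>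
      t \<le> total_length \<gamma> \<Longrightarrow>
      ennreal \<bar>f (arclength_param \<gamma> t) - f (arclength_param \<gamma> s)\<bar> \<le> arc_integral \<gamma> h s t"
  using assms unfolding ug_modulo_def by blast+

lemma continuous_along_arc:
  fixes \<gamma> :: "real \<Rightarrow> 'a::metric_space" and f :: "'a \<Rightarrow> real"
  assumes \<gamma>: "rectifiable_curve \<gamma>" and k: "k \<in> borel_measurable borel" "line_integral \<gamma> k < top"
    and le: "\<And>s t. 0 \<le> s \<Longrightarrow> s < t \<Longrightarrow> t \<le> total_length \<gamma> \<Longrightarrow>
      ennreal \<bar>f (arclength_param \<gamma> t) - f (arclength_param \<gamma> s)\<bar> \<le> arc_integral \<gamma> k s t"
  shows "continuous_on {0..total_length \<gamma>} (\<lambda>s. f (arclength_param \<gamma> s))"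
proof (rule continuous_on_iff[THEN iffD2], intro ballI allI impI)
  fix x e assume x: "x \<in> {0..total_length \<gamma>}" and e: "(0::real) < e"
  let ?F = "\<lambda>q. k (arclength_param \<gamma> q) * indicator {0..total_length \<gamma>} q"
  obtain d where d: "0 < d" "(\<integral>\<^sup>+ q\<in>{x - d..x + d}. ?F q \<partial>lborel) < ennreal e"
    using small_integral_near_point[of ?F "ennreal e" x] e k
      arc_integrand_measurable[OF \<gamma> k(1), of 0 "total_length \<gamma>"]
    unfolding line_integral_eq arc_integral_def by auto
  have small: "\<bar>f (arclength_param \<gamma> t) - f (arclength_param \<gamma> s)\<bar> < e"
    if "0 \<le> s" "s < t" "t \<le> total_length \<gamma>" "{s..t} \<subseteq> {x - d..x + d}" for s t
  proof -
    have "arc_integral \<gamma> k s t \<le> (\<integral>\<^sup>+ q\<in>{x - d..x + d}. ?F q \<partial>lborel)"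
      unfolding arc_integral_def using that by (intro nn_integral_mono) (auto simp: indicator_def)
    also note d(2)
    finally have "ennreal \<bar>f (arclength_param \<gamma> t) - f (arclength_param \<gamma> s)\<bar> < ennreal e"
      using le[of s t] that by (auto intro: le_less_trans)
    then show ?thesis by (subst (asm) ennreal_less_iff) auto
  qed
  have "dist (f (arclength_param \<gamma> y)) (f (arclength_param \<gamma> x)) < e"
    if "y \<in> {0..total_length \<gamma>}" "dist y x < d" for y
    using small[of x y] small[of y x] x that e d(1)
    by (cases x y rule: linorder_cases) (auto simp: dist_real_def abs_minus_commute)
  then show "\<exists>d>0. \<forall>y\<in>{0..total_length \<gamma>}. dist y x < d \<longrightarrow>
      dist (f (arclength_param \<gamma> y)) (f (arclength_param \<gamma> x)) < e"
    using d(1) by blast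
qed

text \<open>
  Along curves of finite \<open>k\<close>-integral the values of \<open>u\<close> are finite, whence any other upper gradient
  \<open>g\<close> controls its oscillation too. The map \<open>T\<close> serves to truncate \<open>u\<close>.
\<close>

lemma ug_modulo_upper_gradient:
  fixes u :: "'a::metric_space \<Rightarrow> ereal"
  assumes k: "upper_gradient k u" and g: "upper_gradient g u"
    and T: "\<And>a b. \<bar>a\<bar> \<noteq> \<infinity> \<Longrightarrow> \<bar>b\<bar> \<noteq> \<infinity> \<Longrightarrow> ereal \<bar>T a - T b\<bar> \<le> \<bar>a - b\<bar>"
  shows "ug_modulo k g (\<lambda>x. T (u x))"
proof -
  have *: "ennreal \<bar>T (u (arclength_param \<gamma> t)) - T (u (arclength_param \<gamma> s))\<bar> \<le> arc_integral \<gamma> h s t"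
    if \<gamma>: "rectifiable_curve \<gamma>" "line_integral \<gamma> k < top" and st: "0 \<le> s" "s < t" "t \<le> total_length \<gamma>"
      and h: "upper_gradient h u" for \<gamma> s t h
  proof -
    obtain \<eta> where \<eta>: "rectifiable_curve \<eta>" "pathstart \<eta> = arclength_param \<gamma> s"
      "pathfinish \<eta> = arclength_param \<gamma> t"
      "\<And>g. g \<in> borel_measurable borel \<Longrightarrow> line_integral \<eta> g = arc_integral \<gamma> g s t"
      using subcurve_integral[OF \<gamma>(1) st] by blast
    let ?a = "u (arclength_param \<gamma> s)" and ?b = "u (arclength_param \<gamma> t)"
    have "line_integral \<eta> k \<le> line_integral \<gamma> k"
      using k st \<eta>(4)[of k] unfolding line_integral_eq[of \<gamma>]
      by (auto intro!: arc_integral_mono simp: upper_gradient_def)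
    then have "line_integral \<eta> k \<noteq> top" using \<gamma> by (auto simp: top_unique)
    then have fin: "\<bar>?a\<bar> \<noteq> \<infinity>" "\<bar>?b\<bar> \<noteq> \<infinity>"
      using k \<eta>(1-3) unfolding upper_gradient_def Let_def by metis+
    have "e2ennreal \<bar>?b - ?a\<bar> \<le> line_integral \<eta> h"
      using h \<eta>(1-3) fin unfolding upper_gradient_def Let_def by metis
    also have "\<dots> = arc_integral \<gamma> h s t" using h \<eta>(4) by (simp add: upper_gradient_def)
    finally have "e2ennreal \<bar>?b - ?a\<bar> \<le> arc_integral \<gamma> h s t" .
    moreover have "ennreal \<bar>T ?b - T ?a\<bar> \<le> e2ennreal \<bar>?b - ?a\<bar>"
      using e2ennreal_mono[OF T[OF fin(2,1)]] by simp
    ultimately show ?thesis by (rule order_trans[rotated])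
  qed
  show ?thesis
  proof (rule ug_moduloI)
    show "g \<in> borel_measurable borel" using g by (simp add: upper_gradient_def)
  next
    fix \<gamma> :: "real \<Rightarrow> 'a" assume \<gamma>: "rectifiable_curve \<gamma>" "line_integral \<gamma> k < top"
    show "continuous_on {0..total_length \<gamma>} (\<lambda>s. T (u (arclength_param \<gamma> s)))"
      using *[OF \<gamma> _ _ _ k] k \<gamma>
      by (intro continuous_along_arc[where k = k]) (auto simp: upper_gradient_def)
  next
    fix \<gamma> :: "real \<Rightarrow> 'a" and s t
    assume \<gamma>: "rectifiable_curve \<gamma>" "line_integral \<gamma> k < top" and st: "0 \<le> s" "s \<le> t" "t \<le> total_length \<gamma>"
    show "ennreal \<bar>T (u (arclength_param \<gamma> t)) - T (u (arclength_param \<gamma> s))\<bar> \<le> arc_integral \<gamma> g s t"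
      using *[OF \<gamma> st(1) _ st(3) g] st by (cases "s = t") auto
  qed
qed

lemma ug_modulo_combine:
  fixes f1 f2 F :: "'a::metric_space \<Rightarrow> real"
  assumes 1: "ug_modulo k h1 f1" and 2: "ug_modulo k h2 f2"
    and ab: "0 \<le> a" "0 \<le> b"
    and le: "\<And>x y. \<bar>F x - F y\<bar> \<le> a * \<bar>f1 x - f1 y\<bar> + b * \<bar>f2 x - f2 y\<bar>"
  shows "ug_modulo k (\<lambda>x. ennreal a * h1 x + ennreal b * h2 x) F"
proof (rule ug_moduloI)
  note [measurable] = ug_moduloD(1)[OF 1] ug_moduloD(1)[OF 2]
  show "(\<lambda>x. ennreal a * h1 x + ennreal b * h2 x) \<in> borel_measurable borel" by measurable
next
  fix \<gamma> :: "real \<Rightarrow> 'a" assume \<gamma>: "rectifiable_curve \<gamma>" "line_integral \<gamma> k < top"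
  show "continuous_on {0..total_length \<gamma>} (\<lambda>s. F (arclength_param \<gamma> s))"
    unfolding continuous_on
  proof
    fix s assume s: "s \<in> {0..total_length \<gamma>}"
    let ?W = "at s within {0..total_length \<gamma>}" and ?c = "arclength_param \<gamma>"
    have "((\<lambda>q. a * \<bar>f1 (?c q) - f1 (?c s)\<bar> + b * \<bar>f2 (?c q) - f2 (?c s)\<bar>) \<longlongrightarrow>
        a * \<bar>f1 (?c s) - f1 (?c s)\<bar> + b * \<bar>f2 (?c s) - f2 (?c s)\<bar>) ?W"
      using ug_moduloD(2)[OF 1 \<gamma>] ug_moduloD(2)[OF 2 \<gamma>] s unfolding continuous_on
      by (intro tendsto_intros) auto
    then have "((\<lambda>q. a * \<bar>f1 (?c q) - f1 (?c s)\<bar> + b * \<bar>f2 (?c q) - f2 (?c s)\<bar>) \<longlongrightarrow> 0) ?W" by simp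
    then have "((\<lambda>q. F (?c q) - F (?c s)) \<longlongrightarrow> 0) ?W"
      by (rule Lim_null_comparison[rotated]) (simp add: le)
    then show "((\<lambda>q. F (?c q)) \<longlongrightarrow> F (?c s)) ?W" by (rule Lim_null[THEN iffD2])
  qed
next
  fix \<gamma> :: "real \<Rightarrow> 'a" and s t
  assume \<gamma>: "rectifiable_curve \<gamma>" "line_integral \<gamma> k < top" and st: "0 \<le> s" "s \<le> t" "t \<le> total_length \<gamma>"
  let ?c = "arclength_param \<gamma>"
  have "ennreal \<bar>F (?c t) - F (?c s)\<bar> \<le>
      ennreal (a * \<bar>f1 (?c t) - f1 (?c s)\<bar> + b * \<bar>f2 (?c t) - f2 (?c s)\<bar>)"
    by (intro ennreal_leI le)
  also have "\<dots> = ennreal a * ennreal \<bar>f1 (?c t) - f1 (?c s)\<bar> + ennreal b * ennreal \<bar>f2 (?c t) - f2 (?c s)\<bar>"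
    using ab by (simp add: ennreal_mult)
  also have "\<dots> \<le> ennreal a * arc_integral \<gamma> h1 s t + ennreal b * arc_integral \<gamma> h2 s t"
    by (intro add_mono mult_left_mono ug_moduloD(3)[OF 1 \<gamma> st] ug_moduloD(3)[OF 2 \<gamma> st]) auto
  also have "\<dots> = arc_integral \<gamma> (\<lambda>x. ennreal a * h1 x + ennreal b * h2 x) s t"
    using ug_moduloD(1)[OF 1] ug_moduloD(1)[OF 2] st by (subst arc_integral_add[OF \<gamma>(1)]) auto
  finally show "ennreal \<bar>F (?c t) - F (?c s)\<bar> \<le> \<dots>" .
qed

lemma ug_modulo_lipschitz:
  fixes f :: "'a::metric_space \<Rightarrow> real"
  assumes "0 \<le> c" and le: "\<And>x y. \<bar>f x - f y\<bar> \<le> c * dist x y"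
  shows "ug_modulo k (\<lambda>_. ennreal c) f"
proof -
  have *: "ennreal \<bar>f (arclength_param \<gamma> t) - f (arclength_param \<gamma> s)\<bar> \<le> arc_integral \<gamma> (\<lambda>_. ennreal c) s t"
    if \<gamma>: "rectifiable_curve \<gamma>" and st: "0 \<le> s" "s \<le> t" "t \<le> total_length \<gamma>" for \<gamma> s t
  proof -
    have "\<bar>f (arclength_param \<gamma> t) - f (arclength_param \<gamma> s)\<bar> \<le>
        c * dist (arclength_param \<gamma> t) (arclength_param \<gamma> s)" by (rule le)
    also have "\<dots> \<le> c * (t - s)"
      using dist_arclength_param[OF \<gamma> st] \<open>0 \<le> c\<close> by (intro mult_left_mono) (auto simp: dist_commute)
    finally show ?thesis
      unfolding arc_integral_def using st \<open>0 \<le> c\<close>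
      by (simp add: nn_integral_cmult_indicator ennreal_leI flip: ennreal_mult)
  qed
  show ?thesis
  proof (rule ug_moduloI)
    fix \<gamma> :: "real \<Rightarrow> 'a" assume \<gamma>: "rectifiable_curve \<gamma>"
    have "line_integral \<gamma> (\<lambda>_. ennreal c) < top"
      unfolding line_integral_eq arc_integral_def using length_upto_endpoints(3)[OF \<gamma>] \<open>0 \<le> c\<close>
      by (simp add: nn_integral_cmult_indicator flip: ennreal_mult)
    then show "continuous_on {0..total_length \<gamma>} (\<lambda>s. f (arclength_param \<gamma> s))"
      using * \<gamma> by (intro continuous_along_arc[where k = "\<lambda>_. ennreal c"]) auto
  qed (use * in auto)
qed

text \<open>
  An arc whose ends are not in the zero set of \<open>f\<close> but which meets that set consists of a part before
  the first zero, a part after the last one, and a part in between that does not contribute to the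
  oscillation.
\<close>

lemma ug_modulo_restrict:
  fixes f :: "'a::metric_space \<Rightarrow> real"
  assumes ug: "ug_modulo k h f" and A: "A \<in> sets borel" and zero: "\<And>x. x \<notin> A \<Longrightarrow> f x = 0"
  shows "ug_modulo k (\<lambda>x. h x * indicator A x) f"
proof (rule ug_moduloI)
  note [measurable] = ug_moduloD(1)[OF ug] A
  show meas: "(\<lambda>x. h x * indicator A x) \<in> borel_measurable borel" by measurable
  fix \<gamma> :: "real \<Rightarrow> 'a" assume \<gamma>: "rectifiable_curve \<gamma>" "line_integral \<gamma> k < top"
  show cont: "continuous_on {0..total_length \<gamma>} (\<lambda>s. f (arclength_param \<gamma> s))"
    by (rule ug_moduloD(2)[OF ug \<gamma>])
  fix s t assume st: "0 \<le> s" "s \<le> t" "t \<le> total_length \<gamma>"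
  let ?c = "arclength_param \<gamma>" and ?h = "\<lambda>x. h x * indicator A x"
  define Z where "Z = {q \<in> {s..t}. f (?c q) = 0}"
  have eq: "arc_integral \<gamma> h a b = arc_integral \<gamma> ?h a b"
    if "0 \<le> a" "b \<le> total_length \<gamma>" "\<And>q. a < q \<Longrightarrow> q < b \<Longrightarrow> f (?c q) \<noteq> 0" for a b
    unfolding arc_integral_def
  proof (rule nn_integral_cong_AE)
    show "AE q in lborel. h (?c q) * indicator {a..b} q = ?h (?c q) * indicator {a..b} q"
      using AE_lborel_singleton[of a] AE_lborel_singleton[of b]
    proof eventually_elim
      case (elim q)
      show ?case
      proof (cases "a < q \<and> q < b")
        case True
        then have "?c q \<in> A" using that(3)[of q] zero[of "?c q"] by auto
        then show ?thesis by simp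
      next
        case False
        then show ?thesis using elim by (auto simp: indicator_def)
      qed
    qed
  qed
  show "ennreal \<bar>f (?c t) - f (?c s)\<bar> \<le> arc_integral \<gamma> ?h s t"
  proof (cases "Z = {}")
    case True
    then have "arc_integral \<gamma> h s t = arc_integral \<gamma> ?h s t"
      using st by (intro eq) (auto simp: Z_def)
    then show ?thesis using ug_moduloD(3)[OF ug \<gamma> st] by simp
  next
    case False
    have "closed Z"
      unfolding Z_def
      using continuous_on_subset[OF cont, of "{s..t}"] st
      by (intro continuous_closed_preimage_constant) auto
    moreover have bdd: "bdd_below Z" "bdd_above Z"
      by (auto simp: Z_def intro!: bdd_belowI[of _ s] bdd_aboveI[of _ t])
    ultimately have ab: "Inf Z \<in> Z" "Sup Z \<in> Z"
      using False closed_contains_Inf closed_contains_Sup by auto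
    define a b where "a = Inf Z" and "b = Sup Z"
    have a: "s \<le> a" "a \<le> t" "f (?c a) = 0" and b: "s \<le> b" "b \<le> t" "f (?c b) = 0"
      using ab by (auto simp: Z_def a_def b_def)
    have "a \<le> b" unfolding a_def b_def using ab bdd by (auto intro: cInf_lower)
    have na: "f (?c q) \<noteq> 0" if "s < q" "q < a" for q
      using that cInf_lower[of q Z] bdd a by (auto simp: Z_def a_def)
    have nb: "f (?c q) \<noteq> 0" if "b < q" "q < t" for q
      using that cSup_upper[of q Z] bdd b by (auto simp: Z_def b_def)
    have "ennreal \<bar>f (?c t) - f (?c s)\<bar> \<le> ennreal (\<bar>f (?c a) - f (?c s)\<bar> + \<bar>f (?c t) - f (?c b)\<bar>)"
      using a b by (intro ennreal_leI) auto
    also have "\<dots> = ennreal \<bar>f (?c a) - f (?c s)\<bar> + ennreal \<bar>f (?c t) - f (?c b)\<bar>"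
      by simp
    also have "\<dots> \<le> arc_integral \<gamma> h s a + arc_integral \<gamma> h b t"
      using st a b by (intro add_mono ug_moduloD(3)[OF ug \<gamma>]) auto
    also have "\<dots> = arc_integral \<gamma> ?h s a + arc_integral \<gamma> ?h b t"
      using st a b na nb by (intro arg_cong2[where f = "(+)"] eq) auto
    also have "\<dots> \<le> arc_integral \<gamma> ?h s t"
      using st a b \<open>a \<le> b\<close> by (intro arc_integral_split[OF \<gamma>(1) meas]) auto
    finally show ?thesis .
  qed
qed

lemma upper_gradient_ug_modulo:
  fixes f :: "'a::metric_space \<Rightarrow> real"
  assumes ug: "ug_modulo k h f" and k: "k \<in> borel_measurable borel" and e: "0 < e"
  shows "upper_gradient (\<lambda>x. h x + ennreal e * k x) (\<lambda>x. ereal (f x))"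
  unfolding upper_gradient_def Let_def
proof (intro conjI allI impI)
  note [measurable] = k ug_moduloD(1)[OF ug]
  show "(\<lambda>x. h x + ennreal e * k x) \<in> borel_measurable borel" by measurable
  fix \<gamma> :: "real \<Rightarrow> 'a" assume \<gamma>: "rectifiable_curve \<gamma>"
  have eq: "line_integral \<gamma> (\<lambda>x. h x + ennreal e * k x) =
      line_integral \<gamma> h + ennreal e * line_integral \<gamma> k"
    using arc_integral_add[OF \<gamma>, of h k 0 "total_length \<gamma>" 1 e] unfolding line_integral_eq by simp
  have "ennreal \<bar>f (pathfinish \<gamma>) - f (pathstart \<gamma>)\<bar> \<le> line_integral \<gamma> (\<lambda>x. h x + ennreal e * k x)"
  proof (cases "line_integral \<gamma> k = top")
    case True
    then show ?thesis using e unfolding eq by (simp add: ennreal_mult_top)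
  next
    case False
    then have "ennreal \<bar>f (arclength_param \<gamma> (total_length \<gamma>)) - f (arclength_param \<gamma> 0)\<bar> \<le> line_integral \<gamma> h"
      unfolding line_integral_eq[of _ h]
      using length_upto_endpoints(3)[OF \<gamma>]
      by (intro ug_moduloD(3)[OF ug \<gamma>]) (auto simp: top.not_eq_extremum)
    also have "\<dots> \<le> line_integral \<gamma> (\<lambda>x. h x + ennreal e * k x)" unfolding eq by simp
    finally show ?thesis by (simp add: arclength_param_endpoints[OF \<gamma>])
  qed
  then show "if \<bar>ereal (f (pathstart \<gamma>))\<bar> = \<infinity> \<or> \<bar>ereal (f (pathfinish \<gamma>))\<bar> = \<infinity>
      then line_integral \<gamma> (\<lambda>x. h x + ennreal e * k x) = top
      else e2ennreal \<bar>ereal (f (pathfinish \<gamma>)) - ereal (f (pathstart \<gamma>))\<bar>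
        \<le> line_integral \<gamma> (\<lambda>x. h x + ennreal e * k x)"
    by simp
qed

lemma newtonianI:
  assumes "u \<in> borel_measurable (completion M)"
    "(\<integral>\<^sup>+ x. epow (e2ennreal \<bar>u x\<bar>) p \<partial>completion M) < top"
    "upper_gradient g u" "p_energy M p g < top"
  shows "u \<in> newtonian M p"
proof -
  have "(INF g \<in> {g. upper_gradient g u}. p_energy M p g) \<le>
      p_energy M p g"
    using assms(3) by (intro INF_lower) auto
  then show ?thesis
    unfolding newtonian_def newtonian_norm_def using assms
    by (auto intro!: epow_finite intro: le_less_trans)
qed

lemma newtonianD:
  assumes "u \<in> newtonian M p"
  obtains k where "upper_gradient k u" "p_energy M p k < top"
    "u \<in> borel_measurable (completion M)"
    "(\<integral>\<^sup>+ x. epow (e2ennreal \<bar>u x\<bar>) p \<partial>completion M) < top"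
proof -
  have "(\<integral>\<^sup>+ x. epow (e2ennreal \<bar>u x\<bar>) p \<partial>completion M) +
      (INF g \<in> {g. upper_gradient g u}. p_energy M p g) < top"
    using assms unfolding newtonian_def newtonian_norm_def by (auto dest: epow_less_topD)
  then have *: "(\<integral>\<^sup>+ x. epow (e2ennreal \<bar>u x\<bar>) p \<partial>completion M) < top"
    "(INF g \<in> {g. upper_gradient g u}. p_energy M p g) < top"
    by auto
  from *(2) obtain k where "upper_gradient k u" "p_energy M p k < top"
    unfolding INF_less_iff by auto
  with *(1) that assms show ?thesis unfolding newtonian_def by auto
qed

lemma borel_measurable_completion:
  assumes "sets M = sets borel" "g \<in> borel_measurable borel"
  shows "g \<in> borel_measurable (completion M)"
  by (rule measurable_completion) (use assms measurable_cong_sets in blast)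

text \<open>
  The remainder of the gradient, a small multiple of \<open>k\<close>, disappears in the limit; the factor
  \<open>2 powr p\<close> comes from separating the two terms in the \<open>p\<close>-th power.
\<close>

lemma capacity_le:
  fixes f :: "'a::metric_space \<Rightarrow> real"
  assumes M: "sets M = sets borel" and p: "0 < p"
    and f: "f \<in> borel_measurable (completion M)" "\<And>x. 0 \<le> f x" "\<And>x. f x \<le> 1"
    and \<Omega>: "\<And>x. x \<notin> \<Omega> \<Longrightarrow> f x = 0" and E: "\<And>x. x \<in> E \<Longrightarrow> f x = 1"
    and fin: "(\<integral>\<^sup>+ x. ennreal (f x powr p) \<partial>completion M) < top"
    and ug: "ug_modulo k h f" and k: "k \<in> borel_measurable borel"
      "p_energy M p k < top"
  shows "capacity M p E \<Omega> \<le> ennreal (2 powr p) * p_energy M p h"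
    (is "_ \<le> ennreal (2 powr p) * ?H")
proof (cases "?H = top")
  case True
  then show ?thesis by (simp add: ennreal_mult_top)
next
  case False
  let ?K = "p_energy M p k"
  have [measurable]: "k \<in> borel_measurable (completion M)" "h \<in> borel_measurable (completion M)"
    using borel_measurable_completion[OF M] k(1) ug_moduloD(1)[OF ug] by auto
  have bound: "capacity M p E \<Omega> \<le> ennreal (2 powr p) * (?H + ennreal (e powr p) * ?K)" if e: "0 < e" for e
  proof -
    let ?g = "\<lambda>x. h x + ennreal e * k x"
    have g: "upper_gradient ?g (\<lambda>x. ereal (f x))"
      by (rule upper_gradient_ug_modulo[OF ug k(1) e])
    have "(\<integral>\<^sup>+ x. epow (?g x) p \<partial>completion M) \<le>
        (\<integral>\<^sup>+ x. ennreal (2 powr p) * (epow (h x) p + ennreal (e powr p) * epow (k x) p) \<partial>completion M)"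
      using epow_add_le[OF p] e p by (intro nn_integral_mono) (simp add: epow_mult[symmetric])
    also have "\<dots> = ennreal (2 powr p) * (?H + ennreal (e powr p) * ?K)"
      by (subst nn_integral_cmult, measurable, subst nn_integral_add, measurable, subst nn_integral_cmult, measurable)
    finally have le: "(\<integral>\<^sup>+ x. epow (?g x) p \<partial>completion M) \<le> \<dots>" .
    also have "\<dots> < top" using False k(2) by (auto simp: ennreal_mult_less_top top.not_eq_extremum)
    finally have fin': "(\<integral>\<^sup>+ x. epow (?g x) p \<partial>completion M) < top" .
    have "(\<lambda>x. ereal (f x)) \<in> newtonian M p"
      by (rule newtonianI[OF _ _ g fin']) (use f fin in \<open>auto simp: epow_ennreal\<close>)
    then have "capacity M p E \<Omega> \<le> (INF g\<in>{g. upper_gradient g (\<lambda>x. ereal (f x))}. p_energy M p g)"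
      unfolding capacity_def using f \<Omega> E by (intro INF_lower) (auto simp: zero_ereal_def one_ereal_def)
    also have "\<dots> \<le> (\<integral>\<^sup>+ x. epow (?g x) p \<partial>completion M)"
      using g by (intro INF_lower) auto
    finally show ?thesis using le by (rule order_trans)
  qed
  obtain K where K: "?K = ennreal K" "0 \<le> K" using k(2) by (cases ?K) auto
  show ?thesis
  proof (rule ennreal_le_epsilon)
    fix \<epsilon> :: real assume \<epsilon>: "0 < \<epsilon>"
    define d where "d = \<epsilon> / (2 powr p * (K + 1))"
    have d: "0 < d" using \<epsilon> K by (simp add: d_def)
    have "capacity M p E \<Omega> \<le> ennreal (2 powr p) * (?H + ennreal ((d powr (1 / p)) powr p) * ?K)"
      using d by (intro bound) simp
    also have "(d powr (1 / p)) powr p = d" using d p by (simp add: powr_powr)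
    also have "ennreal (2 powr p) * (?H + ennreal d * ?K) = ennreal (2 powr p) * ?H + ennreal (2 powr p * (d * K))"
      unfolding K(1) using d K(2) by (simp add: distrib_left ennreal_mult)
    also have "\<dots> \<le> ennreal (2 powr p) * ?H + ennreal \<epsilon>"
    proof (intro add_left_mono ennreal_leI)
      have "2 powr p * (d * K) = \<epsilon> * (K / (K + 1))" using K(2) by (simp add: d_def)
      also have "\<dots> \<le> \<epsilon> * 1" using \<epsilon> K(2) by (intro mult_left_mono) auto
      finally show "2 powr p * (d * K) \<le> \<epsilon>" by simp
    qed
    finally show "capacity M p E \<Omega> \<le> ennreal (2 powr p) * ?H + ennreal \<epsilon>" .
  qed
qed

section \<open>Doubling measures\<close>

lemma sum_indicator_eq_card:
  "finite F \<Longrightarrow> (\<Sum>i\<in>F. indicator (A i) y) = real (card {i \<in> F. y \<in> A i})"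
  by (simp add: indicator_def Collect_conj_eq Int_commute flip: sum.inter_filter)

lemma sum_measure_le_overlap:
  assumes "finite F" and A: "\<And>i. i \<in> F \<Longrightarrow> A i \<in> sets Q" "\<And>i. i \<in> F \<Longrightarrow> A i \<subseteq> B"
    and B: "B \<in> sets Q" "emeasure Q B < top"
    and N: "\<And>y. y \<in> B \<Longrightarrow> (\<Sum>i\<in>F. indicator (A i) y) \<le> (N::real)"
  shows "(\<Sum>i\<in>F. measure Q (A i)) \<le> N * measure Q B"
proof -
  have int: "integrable Q (indicator (A i) :: _ \<Rightarrow> real)" if "i \<in> F" for i
    using A[OF that] B by (intro integrable_real_indicator) (auto intro: le_less_trans emeasure_mono)
  have "(\<Sum>i\<in>F. measure Q (A i)) = (\<Sum>i\<in>F. integral\<^sup>L Q (indicator (A i)))"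
  proof (rule sum.cong)
    fix i assume "i \<in> F"
    then have "A i \<inter> space Q = A i" using A(1)[of i] sets.sets_into_space by blast
    then show "measure Q (A i) = integral\<^sup>L Q (indicator (A i))" by simp
  qed simp
  also have "\<dots> = integral\<^sup>L Q (\<lambda>y. \<Sum>i\<in>F. indicator (A i) y)"
    using int by (subst Bochner_Integration.integral_sum) auto
  also have "\<dots> \<le> integral\<^sup>L Q (\<lambda>y. N * indicator B y)"
  proof (rule integral_mono)
    show "integrable Q (\<lambda>y. \<Sum>i\<in>F. indicator (A i) y :: real)" using int by auto
    show "integrable Q (\<lambda>y. N * indicator B y)" using B by auto
    fix y
    show "(\<Sum>i\<in>F. indicator (A i) y) \<le> N * indicator B y"
    proof (cases "y \<in> B")
      case False
      then have "(\<Sum>i\<in>F. indicator (A i) y) = (0::real)"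
        using A(2) by (intro sum.neutral) (auto simp: indicator_def)
      then show ?thesis using False by simp
    qed (use N in auto)
  qed
  also have "\<dots> = N * measure Q B" using B sets.sets_into_space[OF B(1)] by (simp add: Int_absorb2)
  finally show ?thesis .
qed

text \<open>
  The largest ball is selected first. Its triple contains all the balls that it meets; these are
  discarded before the selection continues.
\<close>

lemma vitali_finite:
  fixes x :: "'i \<Rightarrow> 'a::metric_space" and R :: "'i \<Rightarrow> real"
  assumes "finite F"
  shows "\<exists>G\<subseteq>F. pairwise (\<lambda>i j. disjnt (ball (x i) (R i)) (ball (x j) (R j))) G \<and>
    (\<forall>i\<in>F. \<exists>j\<in>G. ball (x i) (R i) \<subseteq> ball (x j) (3 * R j))"
  using assms
proof (induction "card F" arbitrary: F rule: less_induct)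
  case less
  let ?B = "\<lambda>i. ball (x i) (R i)"
  show ?case
  proof (cases "F = {}")
    case False
    obtain i where i: "i \<in> F" "\<And>j. j \<in> F \<Longrightarrow> R j \<le> R i"
    proof -
      have "Max (R ` F) \<in> R ` F" using False less.prems by simp
      then obtain i where "i \<in> F" "R i = Max (R ` F)" by auto
      then show ?thesis using less.prems by (intro that[of i]) auto
    qed
    let ?F = "{j \<in> F. disjnt (?B i) (?B j)} - {i}"
    have "card ?F < card F"
      using i(1) less.prems by (intro psubset_card_mono) auto
    then obtain G where G: "G \<subseteq> ?F" "pairwise (\<lambda>i j. disjnt (?B i) (?B j)) G"
      "\<forall>j\<in>?F. \<exists>l\<in>G. ?B j \<subseteq> ball (x l) (3 * R l)"
      using less.hyps[of ?F] less.prems by auto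
    have "pairwise (\<lambda>i j. disjnt (?B i) (?B j)) (insert i G)"
      using G(1,2) by (auto simp: pairwise_insert disjnt_sym)
    moreover have "\<exists>l\<in>insert i G. ?B j \<subseteq> ball (x l) (3 * R l)" if j: "j \<in> F" for j
    proof (cases "j \<in> ?F")
      case True
      then show ?thesis using G(3) by auto
    next
      case nF: False
      have "?B j \<subseteq> ball (x i) (3 * R i)"
      proof (cases "j = i")
        case True
        show ?thesis
        proof
          fix y assume y: "y \<in> ?B j"
          then have "0 < R i" using True by (auto intro: le_less_trans[OF zero_le_dist])
          then show "y \<in> ball (x i) (3 * R i)" using y True by auto
        qed
      next
        case False
        then obtain z where z: "dist (x i) z < R i" "dist (x j) z < R j"
          using nF j by (auto simp: disjnt_iff)
        show ?thesis
        proof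
          fix y assume "y \<in> ?B j"
          then have "dist (x j) y < R j" by simp
          then show "y \<in> ball (x i) (3 * R i)"
            using z i(2)[OF j] dist_triangle[of "x i" y z] dist_triangle[of z y "x j"]
            by (simp add: dist_commute)
        qed
      qed
      then show ?thesis by blast
    qed
    ultimately show ?thesis using G(1) i(1) by (intro exI[of _ "insert i G"]) auto
  qed auto
qed

locale doubling_space =
  fixes M :: "'a::metric_space measure" and D :: real
  assumes sets_M: "sets M = sets borel"
    and ball_pos: "\<And>x r. 0 < r \<Longrightarrow> 0 < emeasure M (ball x r)"
    and ball_finite: "\<And>x r. emeasure M (ball x r) < top"
    and doubling: "\<And>x r. 0 < r \<Longrightarrow> emeasure M (ball x (2 * r)) \<le> ennreal D * emeasure M (ball x r)"
    and D_ge_1: "1 \<le> D"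
begin

abbreviation Mc :: "'a measure" where "Mc \<equiv> completion M"
abbreviation \<mu> :: "'a set \<Rightarrow> real" where "\<mu> \<equiv> measure (completion M)"

lemma space_M: "space M = UNIV" "space (completion M) = UNIV"
  using sets_eq_imp_space_eq[OF sets_M] by auto

lemma borel_sets [measurable (raw)]: "A \<in> sets borel \<Longrightarrow> A \<in> sets Mc"
  using sets_M by (intro sets_completionI_sets) auto

lemma emeasure_ball: "emeasure Mc (ball x r) = ennreal (\<mu> (ball x r))"
  "emeasure M (ball x r) = ennreal (\<mu> (ball x r))"
proof -
  have *: "emeasure Mc (ball x r) = emeasure M (ball x r)"
    using sets_M by simp
  then show "emeasure Mc (ball x r) = ennreal (\<mu> (ball x r))"
    using ball_finite[of x r] by (intro emeasure_eq_ennreal_measure) auto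
  with * show "emeasure M (ball x r) = ennreal (\<mu> (ball x r))" by simp
qed

lemma \<mu>_ball_pos: "0 < r \<Longrightarrow> 0 < \<mu> (ball x r)"
  using ball_pos[of r x] by (simp add: emeasure_ball)

lemma \<mu>_mono: "A \<in> sets Mc \<Longrightarrow> A \<subseteq> ball x r \<Longrightarrow> \<mu> A \<le> \<mu> (ball x r)"
  by (rule measure_mono_fmeasurable) (auto simp: fmeasurable_def emeasure_ball)

lemma \<mu>_doubling:
  assumes "0 < r"
  shows "\<mu> (ball x (2 ^ m * r)) \<le> D ^ m * \<mu> (ball x r)"
proof (induction m)
  case (Suc m)
  have "ennreal (\<mu> (ball x (2 * (2 ^ m * r)))) \<le> ennreal (D * \<mu> (ball x (2 ^ m * r)))"
    using doubling[of "2 ^ m * r" x] D_ge_1 assms unfolding emeasure_ball by (simp add: ennreal_mult)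
  then have "\<mu> (ball x (2 * (2 ^ m * r))) \<le> D * \<mu> (ball x (2 ^ m * r))"
    using D_ge_1 by (subst (asm) ennreal_le_iff) auto
  also have "\<dots> \<le> D * (D ^ m * \<mu> (ball x r))" using Suc D_ge_1 by (intro mult_left_mono) auto
  finally show ?case by (simp add: mult.assoc)
qed simp

lemma \<mu>_ball_le:
  assumes "0 < r" "R \<le> 2 ^ m * r"
  shows "\<mu> (ball x R) \<le> D ^ m * \<mu> (ball x r)"
  using \<mu>_doubling[OF assms(1), of x m] \<mu>_mono[of "ball x R" x "2 ^ m * r"] subset_ball[OF assms(2)]
  by (auto intro: order_trans)

text \<open>
  Balls of bounded overlap inside a ball, each of them comparable to it, are few: their total
  measure is bounded both from below and from above by that of the large ball.
\<close>

lemma card_comparable_balls_le: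
  fixes x :: "'i \<Rightarrow> 'a" and r :: "'i \<Rightarrow> real"
  assumes "finite F" and r: "\<And>i. i \<in> F \<Longrightarrow> 0 < r i"
    and N: "\<And>y. (\<Sum>i\<in>F. indicator (ball (x i) (r i)) y) \<le> (N::real)"
    and sub: "\<And>i. i \<in> F \<Longrightarrow> ball (x i) (r i) \<subseteq> ball y R"
      "\<And>i. i \<in> F \<Longrightarrow> ball y R \<subseteq> ball (x i) (2 ^ m * r i)"
  shows "real (card F) \<le> N * D ^ m"
proof (cases "F = {}")
  case True
  then show ?thesis using N[of undefined] D_ge_1 by simp
next
  case False
  then obtain i where i: "i \<in> F" by auto
  have "0 < \<mu> (ball (x i) (r i))" using r[OF i] by (rule \<mu>_ball_pos)
  also have "\<dots> \<le> \<mu> (ball y R)" using sub(1)[OF i] by (intro \<mu>_mono) auto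
  finally have pos: "0 < \<mu> (ball y R)" .
  have "real (card F) * \<mu> (ball y R) = (\<Sum>i\<in>F. \<mu> (ball y R))" by simp
  also have "\<dots> \<le> (\<Sum>i\<in>F. D ^ m * \<mu> (ball (x i) (r i)))"
  proof (rule sum_mono)
    fix i assume i: "i \<in> F"
    have "\<mu> (ball y R) \<le> \<mu> (ball (x i) (2 ^ m * r i))" using sub(2)[OF i] by (intro \<mu>_mono) auto
    also have "\<dots> \<le> D ^ m * \<mu> (ball (x i) (r i))" by (rule \<mu>_doubling[OF r[OF i]])
    finally show "\<mu> (ball y R) \<le> D ^ m * \<mu> (ball (x i) (r i))" .
  qed
  also have "\<dots> = D ^ m * (\<Sum>i\<in>F. \<mu> (ball (x i) (r i)))" by (simp add: sum_distrib_left)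
  also have "\<dots> \<le> D ^ m * (N * \<mu> (ball y R))"
    using D_ge_1 sub(1) N \<open>finite F\<close>
    by (intro mult_left_mono sum_measure_le_overlap) (auto simp: emeasure_ball)
  finally show ?thesis using pos by (simp add: mult.commute mult.left_commute)
qed

end

lemma separated_balls_overlap:
  fixes S :: "'a::metric_space set"
  assumes S: "finite S" and sep: "\<And>s t. s \<in> S \<Longrightarrow> t \<in> S \<Longrightarrow> s \<noteq> t \<Longrightarrow> \<rho> \<le> dist s t"
  shows "(\<Sum>s\<in>S. indicator (ball s (\<rho> / 2)) y) \<le> (1::real)"
proof -
  have "card {s \<in> S. y \<in> ball s (\<rho> / 2)} \<le> 1"
  proof (rule card_le_Suc0_iff_eq[THEN iffD2, unfolded One_nat_def[symmetric]])
    show "\<forall>s\<in>{s \<in> S. y \<in> ball s (\<rho> / 2)}. \<forall>t\<in>{s \<in> S. y \<in> ball s (\<rho> / 2)}. s = t"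
    proof (intro ballI)
      fix s t assume st: "s \<in> {s \<in> S. y \<in> ball s (\<rho> / 2)}" "t \<in> {s \<in> S. y \<in> ball s (\<rho> / 2)}"
      then have "dist s t < \<rho>" using dist_triangle[of s t y] by (auto simp: dist_commute)
      then show "s = t" using sep[of s t] st by force
    qed
  qed (use S in auto)
  moreover have "(\<Sum>s\<in>S. indicator (ball s (\<rho> / 2)) y) = real (card {s \<in> S. y \<in> ball s (\<rho> / 2)})"
      by (rule sum_indicator_eq_card[OF S])
  ultimately show ?thesis by simp
qed

context doubling_space
begin

text \<open>
  The cardinality of \<open>\<rho>\<close>-separated sets in a ball is bounded, so one of maximal cardinality exists,
  and maximality makes it a net.
\<close>

lemma finite_net:
  fixes x :: 'a
  assumes r: "0 < r" and \<rho>: "\<rho> = r / 2 ^ K"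
  obtains S where "finite S" "S \<subseteq> ball x r"
    "\<And>s t. s \<in> S \<Longrightarrow> t \<in> S \<Longrightarrow> s \<noteq> t \<Longrightarrow> \<rho> \<le> dist s t" "ball x r \<subseteq> (\<Union>s\<in>S. ball s \<rho>)"
proof -
  define P where "P S \<longleftrightarrow> finite S \<and> S \<subseteq> ball x r \<and> (\<forall>s\<in>S. \<forall>t\<in>S. s \<noteq> t \<longrightarrow> \<rho> \<le> dist s t)" for S
  have \<rho>': "0 < \<rho>" "\<rho> \<le> r" using r by (auto simp: \<rho> field_simps)
  have bound: "card S \<le> nat \<lceil>D ^ (K + 3)\<rceil>" if "P S" for S
  proof -
    have S: "finite S" "S \<subseteq> ball x r" "\<And>s t. s \<in> S \<Longrightarrow> t \<in> S \<Longrightarrow> s \<noteq> t \<Longrightarrow> \<rho> \<le> dist s t"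
      using that by (auto simp: P_def)
    have "real (card S) \<le> 1 * D ^ (K + 3)"
    proof (rule card_comparable_balls_le[OF S(1), where x = "\<lambda>s. s" and r = "\<lambda>_. \<rho> / 2" and y = x and R = "2 * r"])
      show "(\<Sum>s\<in>S. indicator (ball s (\<rho> / 2)) y) \<le> (1::real)" for y
        by (rule separated_balls_overlap[OF S(1,3)])
      fix s assume "s \<in> S"
      then have s: "dist x s < r" using S by auto
      show "ball s (\<rho> / 2) \<subseteq> ball x (2 * r)"
      proof
        fix y assume "y \<in> ball s (\<rho> / 2)"
        then show "y \<in> ball x (2 * r)" using s \<rho>' dist_triangle[of x y s] by auto
      qed
      show "ball x (2 * r) \<subseteq> ball s (2 ^ (K + 3) * (\<rho> / 2))"
      proof
        fix y assume "y \<in> ball x (2 * r)"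
        moreover have "2 ^ (K + 3) * (\<rho> / 2) = 4 * r" by (simp add: \<rho> power_add)
        ultimately show "y \<in> ball s (2 ^ (K + 3) * (\<rho> / 2))"
          using s r dist_triangle[of s y x] dist_commute[of s x] by auto
      qed
    qed (use \<rho>' in auto)
    then show ?thesis by linarith
  qed
  have "P {}" by (simp add: P_def)
  then have "\<exists>S. P S \<and> (\<forall>T. P T \<longrightarrow> card T \<le> card S)"
    using bound
    by (intro ex_has_greatest_nat[where b = "Suc (nat \<lceil>D ^ (K + 3)\<rceil>)"]) (auto simp: less_Suc_eq_le)
  then obtain S where S: "P S" "\<And>T. P T \<Longrightarrow> card T \<le> card S" by auto
  have "ball x r \<subseteq> (\<Union>s\<in>S. ball s \<rho>)"
  proof (rule ccontr)
    assume "\<not> ?thesis"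
    then obtain y where y: "y \<in> ball x r" "y \<notin> (\<Union>s\<in>S. ball s \<rho>)" by blast
    then have y2: "\<And>s. s \<in> S \<Longrightarrow> \<rho> \<le> dist s y" by (auto simp: not_less)
    note y = y(1) y2
    then have "y \<notin> S" using \<rho>'(1) by force
    moreover have "P (insert y S)" using S(1) y by (auto simp: P_def dist_commute)
    ultimately show False using S(2)[of "insert y S"] S(1) by (auto simp: P_def)
  qed
  then show ?thesis using S(1) unfolding P_def by (intro that[of S]) auto
qed

end

section \<open>Consequences of the Poincare inequality\<close>

locale poincare_space = doubling_space M D
  for M :: "'a::metric_space measure" and D :: real +
  fixes p P L :: real
  assumes p_gt_1: "1 < p" and P_pos: "0 < P" and L_ge_1: "1 \<le> L"
    and poincare: "\<And>x r f g. 0 < r \<Longrightarrow> f \<in> borel_measurable (completion M) \<Longrightarrow>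
      (\<integral>\<^sup>+ y \<in> ball x r. e2ennreal \<bar>f y\<bar> \<partial>completion M) < top \<Longrightarrow>
      upper_gradient g f \<Longrightarrow>
        (1 / emeasure M (ball x r)) *
          (\<integral>\<^sup>+ y \<in> ball x r. e2ennreal \<bar>f y - ereal (mean_value M (ball x r) f)\<bar> \<partial>completion M)
        \<le> ennreal (P * r) *
          epow ((1 / emeasure M (ball x (L * r))) *
            (\<integral>\<^sup>+ y \<in> ball x (L * r). epow (g y) p \<partial>completion M)) (1 / p)"

context doubling_space
begin

definition avg :: "('a \<Rightarrow> real) \<Rightarrow> 'a \<Rightarrow> real \<Rightarrow> real"
  where "avg f x r = (1 / \<mu> (ball x r)) * (LINT y:ball x r|Mc. f y)"

definition osc :: "('a \<Rightarrow> real) \<Rightarrow> 'a \<Rightarrow> real \<Rightarrow> real"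
  where "osc f x r = (LINT y:ball x r|Mc. \<bar>f y - avg f x r\<bar>)"

definition energy :: "real \<Rightarrow> ('a \<Rightarrow> ennreal) \<Rightarrow> 'a set \<Rightarrow> real"
  where "energy p g A = measure (density Mc (\<lambda>y. epow (g y) p)) A"

lemma set_integrable_ball:
  fixes h :: "'a \<Rightarrow> real"
  assumes "h \<in> borel_measurable Mc" "\<And>y. \<bar>h y\<bar> \<le> C"
    "A \<in> sets Mc" "A \<subseteq> ball x r"
  shows "set_integrable Mc A h"
  unfolding set_integrable_def
proof (rule integrableI_bounded_set_indicator)
  show "emeasure Mc A < \<infinity>"
    using emeasure_mono[of A "ball x r" "Mc"] assms(4) borel_sets[of "ball x r"]
    by (auto simp: emeasure_ball intro: le_less_trans)
qed (use assms in auto)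

lemma set_integral_subset_le:
  fixes h :: "'a \<Rightarrow> real"
  assumes h: "h \<in> borel_measurable Mc" "\<And>y. \<bar>h y\<bar> \<le> C" "\<And>y. 0 \<le> h y"
    and A: "A \<in> sets Mc" "A \<subseteq> ball x r"
  shows "(LINT y:A|Mc. h y) \<le> (LINT y:ball x r|Mc. h y)"
  using set_integrable_ball[OF h(1,2) A] set_integrable_ball[OF h(1,2) borel_sets[of "ball x r"]] A(2) h(3)
  unfolding set_lebesgue_integral_def set_integrable_def
  by (intro integral_mono) (auto simp: indicator_def)

lemma energy_eq:
  assumes g: "g \<in> borel_measurable borel" and fin: "p_energy M p g < top"
    and A: "A \<in> sets borel"
  shows "(\<integral>\<^sup>+ y \<in> A. epow (g y) p \<partial>Mc) = ennreal (energy p g A)"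
proof -
  have [measurable]: "g \<in> borel_measurable Mc" by (rule borel_measurable_completion[OF sets_M g])
  have "(\<integral>\<^sup>+ y \<in> A. epow (g y) p \<partial>Mc) = emeasure (density Mc (\<lambda>y. epow (g y) p)) A"
    using A by (subst emeasure_density) auto
  moreover have "(\<integral>\<^sup>+ y \<in> A. epow (g y) p \<partial>Mc) \<le> p_energy M p g"
    by (intro nn_integral_mono) (auto simp: indicator_def)
  ultimately show ?thesis
    using fin unfolding energy_def by (subst emeasure_eq_ennreal_measure[symmetric]) (auto simp: top_unique)
qed

lemma energy_nonneg: "0 \<le> energy p g A" unfolding energy_def by simp

lemma energy_mono:
  assumes g: "g \<in> borel_measurable borel" and fin: "p_energy M p g < top"
    and A: "A \<in> sets borel"
  shows "energy p g A \<le> energy p g UNIV"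
proof -
  have [measurable]: "g \<in> borel_measurable Mc" by (rule borel_measurable_completion[OF sets_M g])
  have "emeasure (density Mc (\<lambda>y. epow (g y) p)) UNIV < top"
    using fin borel_sets[of UNIV] by (subst emeasure_density) auto
  then show ?thesis
    unfolding energy_def using borel_sets[OF A] borel_sets[of UNIV]
    by (intro measure_mono_fmeasurable) (auto simp: fmeasurable_def)
qed

lemma sum_energy_le_overlap:
  assumes g: "g \<in> borel_measurable borel" and fin: "p_energy M p g < top"
    and F: "finite F" "\<And>i. i \<in> F \<Longrightarrow> A i \<in> sets borel"
    and N: "\<And>y. (\<Sum>i\<in>F. indicator (A i) y) \<le> (N::real)"
  shows "(\<Sum>i\<in>F. energy p g (A i)) \<le> N * energy p g UNIV"
  unfolding energy_def
proof (rule sum_measure_le_overlap[OF F(1)])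
  have [measurable]: "g \<in> borel_measurable Mc" by (rule borel_measurable_completion[OF sets_M g])
  show "emeasure (density Mc (\<lambda>y. epow (g y) p)) UNIV < top"
    using fin borel_sets[of UNIV] by (subst emeasure_density) auto
qed (use F N borel_sets in auto)

text \<open>Chebyshev's inequality; \<open>1/4\<close> is the only deviation that occurs below.\<close>

lemma measure_le_osc:
  assumes f: "f \<in> borel_measurable Mc" "\<And>y. 0 \<le> f y" "\<And>y. f y \<le> (1::real)"
    and A: "A \<in> sets Mc" "A \<subseteq> ball x r" and c: "\<And>y. y \<in> A \<Longrightarrow> 1 / 4 \<le> \<bar>f y - avg f x r\<bar>"
  shows "\<mu> A \<le> 4 * osc f x r"
proof -
  have b: "\<bar>\<bar>f y - avg f x r\<bar>\<bar> \<le> 1 + \<bar>avg f x r\<bar>" for y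
    using f(2,3)[of y] by linarith
  have m: "(\<lambda>y. \<bar>f y - avg f x r\<bar>) \<in> borel_measurable Mc" using f(1) by measurable
  have finA: "emeasure Mc A < top"
    using A emeasure_mono[of A "ball x r" "Mc"] borel_sets[of "ball x r"]
    by (auto simp: emeasure_ball intro: le_less_trans)
  have "\<mu> A * (1 / 4) = (LINT y:A|Mc. (1 / 4))"
    using A finA by (subst set_integral_const) (auto simp: top.not_eq_extremum)
  also have "\<dots> \<le> (LINT y:A|Mc. \<bar>f y - avg f x r\<bar>)"
  proof (rule set_integral_mono)
    show "set_integrable Mc A (\<lambda>_. 1 / 4 :: real)"
      by (rule set_integrable_ball[OF _ _ A, where C = 1]) auto
    show "set_integrable Mc A (\<lambda>y. \<bar>f y - avg f x r\<bar>)"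
      by (rule set_integrable_ball[OF m b A])
  qed (rule c)
  also have "\<dots> \<le> osc f x r"
    unfolding osc_def by (rule set_integral_subset_le[OF m b _ A]) simp
  finally show ?thesis by simp
qed

lemma avg_diff_le:
  assumes f: "f \<in> borel_measurable Mc" "\<And>y. 0 \<le> f y" "\<And>y. f y \<le> (1::real)"
    and sub: "ball x' r' \<subseteq> ball x r" and r': "0 < r'" and C: "\<mu> (ball x r) \<le> C * \<mu> (ball x' r')"
    and a: "osc f x r \<le> a * \<mu> (ball x r)" and a0: "0 \<le> a"
  shows "\<bar>avg f x' r' - avg f x r\<bar> \<le> C * a"
proof -
  let ?m = "avg f x r" and ?B = "ball x' r'"
  have pos: "0 < \<mu> ?B" by (rule \<mu>_ball_pos[OF r'])
  have fin: "emeasure Mc ?B < top" by (simp add: emeasure_ball)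
  have m: "(\<lambda>y. f y - ?m) \<in> borel_measurable Mc"
    "(\<lambda>y. \<bar>f y - ?m\<bar>) \<in> borel_measurable Mc" using f(1) by measurable
  have b: "\<bar>f y - ?m\<bar> \<le> 1 + \<bar>?m\<bar>" "\<bar>f y\<bar> \<le> 1" "\<bar>\<bar>f y - ?m\<bar>\<bar> \<le> 1 + \<bar>?m\<bar>" for y
    using f(2,3)[of y] by auto
  have int: "set_integrable Mc ?B (\<lambda>y. f y - ?m)" "set_integrable Mc ?B f"
    "set_integrable Mc ?B (\<lambda>_. ?m)"
    by (rule set_integrable_ball[OF m(1) b(1) borel_sets, where x = x' and r = r'], simp, simp)
      (rule set_integrable_ball[OF f(1) b(2) borel_sets, where x = x' and r = r'], simp, simp,
       rule set_integrable_ball[OF _ order_refl borel_sets, where x = x' and r = r'], simp, simp, simp)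
  have "(LINT y:?B|Mc. f y - ?m) = (LINT y:?B|Mc. f y) - \<mu> ?B * ?m"
    using int fin borel_sets[of ?B]
    by (subst set_integral_diff) (auto simp: set_integral_const top.not_eq_extremum)
  then have "avg f x' r' - ?m = (1 / \<mu> ?B) * (LINT y:?B|Mc. f y - ?m)"
    using pos by (simp add: avg_def[of f x' r'] field_simps)
  then have "\<bar>avg f x' r' - ?m\<bar> = (1 / \<mu> ?B) * \<bar>LINT y:?B|Mc. f y - ?m\<bar>"
    using pos by (simp add: abs_mult)
  also have "\<dots> \<le> (1 / \<mu> ?B) * (LINT y:?B|Mc. \<bar>f y - ?m\<bar>)"
    using pos set_integral_norm_bound[OF int(1)] by (intro mult_left_mono) auto
  also have "\<dots> \<le> (1 / \<mu> ?B) * osc f x r"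
  proof (intro mult_left_mono)
    show "(LINT y:?B|Mc. \<bar>f y - ?m\<bar>) \<le> osc f x r"
      unfolding osc_def by (rule set_integral_subset_le[OF m(2) b(3) _ borel_sets sub]) auto
  qed (use pos in auto)
  also have "\<dots> \<le> (1 / \<mu> ?B) * (a * (C * \<mu> ?B))"
    using pos order_trans[OF a mult_left_mono[OF C a0]] by (intro mult_left_mono) auto
  also have "\<dots> = C * a" using pos by simp
  finally show ?thesis .
qed

end

context poincare_space
begin

text \<open>
  The situation in which the Poincare inequality is applied below: a function with values in \<open>[0,1]\<close>
  and an upper gradient of finite \<open>p\<close>-energy.
\<close>

definition admissible :: "('a \<Rightarrow> ennreal) \<Rightarrow> ('a \<Rightarrow> real) \<Rightarrow> bool"
  where "admissible g f \<longleftrightarrow> f \<in> borel_measurable Mc \<and> (\<forall>y. 0 \<le> f y \<and> f y \<le> 1) \<and>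
    upper_gradient g (\<lambda>y. ereal (f y)) \<and> p_energy M p g < top"

lemma admissibleD:
  assumes "admissible g f"
  shows "f \<in> borel_measurable Mc" "\<And>y. 0 \<le> f y" "\<And>y. f y \<le> 1"
    "upper_gradient g (\<lambda>y. ereal (f y))" "g \<in> borel_measurable borel"
    "p_energy M p g < top"
  using assms unfolding admissible_def upper_gradient_def by auto

lemma osc_le:
  assumes f: "admissible g f" and r: "0 < r"
  shows "osc f x r \<le> P * r * \<mu> (ball x r) *
    (energy p g (ball x (L * r)) / \<mu> (ball x (L * r))) powr (1 / p)"
proof -
  note D = admissibleD[OF f]
  let ?B = "ball x r" and ?LB = "ball x (L * r)"
  have pos: "0 < \<mu> ?B" "0 < \<mu> ?LB" using r L_ge_1 by (auto intro!: \<mu>_ball_pos)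
  have "measure M ?B = \<mu> ?B" unfolding measure_def using emeasure_ball[of x r] by simp
  then have mean: "mean_value M ?B (\<lambda>y. ereal (f y)) = avg f x r"
    unfolding mean_value_def avg_def by simp
  have b: "\<bar>\<bar>f y - avg f x r\<bar>\<bar> \<le> 1 + \<bar>avg f x r\<bar>" for y
    using D(2,3)[of y] by linarith
  have m: "(\<lambda>y. \<bar>f y - avg f x r\<bar>) \<in> borel_measurable Mc" using D(1) by measurable
  have int: "set_integrable Mc ?B (\<lambda>y. \<bar>f y - avg f x r\<bar>)"
    by (rule set_integrable_ball[OF m b borel_sets, where x = x and r = r]) auto
  have eq: "(\<integral>\<^sup>+ y \<in> ?B. e2ennreal \<bar>ereal (f y) - ereal (avg f x r)\<bar> \<partial>Mc) = ennreal (osc f x r)"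
  proof -
    have "(\<integral>\<^sup>+ y \<in> ?B. e2ennreal \<bar>ereal (f y) - ereal (avg f x r)\<bar> \<partial>Mc) =
        (\<integral>\<^sup>+ y. ennreal (indicator ?B y *\<^sub>R \<bar>f y - avg f x r\<bar>) \<partial>Mc)"
      by (intro nn_integral_cong) (auto simp: indicator_def)
    also have "\<dots> = ennreal (osc f x r)"
      unfolding osc_def set_lebesgue_integral_def using int unfolding set_integrable_def
      by (intro nn_integral_eq_integral) auto
    finally show ?thesis .
  qed
  have "(\<integral>\<^sup>+ y \<in> ?B. e2ennreal \<bar>ereal (f y)\<bar> \<partial>Mc) \<le> (\<integral>\<^sup>+ y. indicator ?B y \<partial>Mc)"
    using D(2,3) by (intro nn_integral_mono) (auto simp: indicator_def)
  also have "\<dots> < top" using borel_sets[of ?B] by (simp add: emeasure_ball)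
  finally have fin: "(\<integral>\<^sup>+ y \<in> ?B. e2ennreal \<bar>ereal (f y)\<bar> \<partial>Mc) < top" .
  have "(1 / ennreal (\<mu> ?B)) * ennreal (osc f x r) \<le> ennreal (P * r) *
      epow ((1 / ennreal (\<mu> ?LB)) * ennreal (energy p g ?LB)) (1 / p)"
    using poincare[OF r _ fin D(4)] D(1) energy_eq[OF D(5,6), of ?LB] unfolding mean eq emeasure_ball(2)
    by simp
  also have "(1 / ennreal (\<mu> ?LB)) * ennreal (energy p g ?LB) = ennreal (energy p g ?LB / \<mu> ?LB)"
    using pos energy_nonneg[of p g ?LB]
    by (simp add: ennreal_1[symmetric] divide_ennreal del: ennreal_1 flip: ennreal_mult)
  also have "(1 / ennreal (\<mu> ?B)) * ennreal (osc f x r) = ennreal (osc f x r / \<mu> ?B)"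
    using pos by (simp add: ennreal_1[symmetric] divide_ennreal del: ennreal_1 flip: ennreal_mult')
  finally have "ennreal (osc f x r / \<mu> ?B) \<le> ennreal (P * r * (energy p g ?LB / \<mu> ?LB) powr (1 / p))"
    using P_pos r pos energy_nonneg[of p g ?LB] by (simp add: epow_ennreal flip: ennreal_mult)
  then have "osc f x r / \<mu> ?B \<le> P * r * (energy p g ?LB / \<mu> ?LB) powr (1 / p)"
    using P_pos r by (subst (asm) ennreal_le_iff) auto
  then show ?thesis using pos by (simp add: field_simps)
qed

lemma osc_le_small:
  assumes f: "admissible g f" and r: "0 < r" and q: "0 < q"
    and small: "q powr p * energy p g (ball x (L * r)) \<le> \<mu> (ball x (L * r))"
  shows "osc f x r \<le> P * r / q * \<mu> (ball x r)"
proof -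
  let ?LB = "ball x (L * r)"
  have pos: "0 < \<mu> ?LB" using r L_ge_1 by (auto intro!: \<mu>_ball_pos)
  have "energy p g ?LB / \<mu> ?LB \<le> (1 / q) powr p"
    using small pos q by (simp add: powr_divide field_simps)
  then have "(energy p g ?LB / \<mu> ?LB) powr (1 / p) \<le> ((1 / q) powr p) powr (1 / p)"
    using p_gt_1 energy_nonneg[of p g ?LB] pos by (intro powr_mono2) auto
  also have "\<dots> = 1 / q" using p_gt_1 q by (simp add: powr_powr)
  finally have "P * r * \<mu> (ball x r) * (energy p g ?LB / \<mu> ?LB) powr (1 / p) \<le> P * r * \<mu> (ball x r) * (1 / q)"
    using P_pos r by (intro mult_left_mono) auto
  with osc_le[OF f r, of x] show ?thesis by simp
qed

lemma osc_le_sum: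
  assumes f: "admissible g f" and r: "0 < r"
  shows "osc f x r \<le> P * r * (\<mu> (ball x r) + energy p g (ball x (L * r)))"
proof -
  let ?B = "ball x r" and ?LB = "ball x (L * r)"
  define t where "t = energy p g ?LB / \<mu> ?LB"
  have pos: "0 < \<mu> ?B" "0 < \<mu> ?LB" using r L_ge_1 by (auto intro!: \<mu>_ball_pos)
  have t0: "0 \<le> t" using energy_nonneg[of p g ?LB] by (simp add: t_def)
  have "t powr (1 / p) \<le> 1 + t"
  proof (cases "t \<le> 1")
    case True
    then have "t powr (1 / p) \<le> 1 powr (1 / p)" using t0 p_gt_1 by (intro powr_mono2) auto
    then show ?thesis using t0 by simp
  next
    case False
    then have "t powr (1 / p) \<le> t powr 1" using p_gt_1 by (intro powr_mono) auto
    then show ?thesis using False by simp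
  qed
  then have "\<mu> ?B * t powr (1 / p) \<le> \<mu> ?B * (1 + t)" using pos by (intro mult_left_mono) auto
  also have "\<dots> \<le> \<mu> ?B + \<mu> ?LB * t"
  proof -
    have "\<mu> ?B \<le> \<mu> ?LB" using r L_ge_1 by (intro \<mu>_mono borel_sets subset_ball) auto
    then show ?thesis using t0 by (simp add: distrib_left mult_right_mono)
  qed
  also have "\<mu> ?LB * t = energy p g ?LB" using pos by (simp add: t_def)
  finally have "P * r * (\<mu> ?B * t powr (1 / p)) \<le> P * r * (\<mu> ?B + energy p g ?LB)"
    using P_pos r by (intro mult_left_mono) auto
  with osc_le[OF f r, of x] show ?thesis by (simp add: t_def mult.assoc)
qed

end

section \<open>Capacity and measure inside a ball\<close>

context poincare_space
begin

lemma le_L_mult: "0 \<le> b \<Longrightarrow> b \<le> L * b"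
  using mult_right_mono[OF L_ge_1, of b] by simp

text \<open>
  If the Poincare inequality bounded the oscillation on all the balls with centre \<open>s\<close> between the
  scales \<open>\<rho>\<close> and \<open>r\<close> by a small multiple of (radius divided by \<open>r\<close>), the mean values could not
  differ by \<open>1/8\<close>: the differences along dyadic radii would add up to a geometric series. So on one
  of these balls the energy is large compared with the measure.
\<close>

lemma ex_ball_of_large_energy:
  assumes f: "admissible g f" and r: "0 < r" and \<rho>: "\<rho> = r / 2 ^ K"
    and avg: "3 / 4 \<le> avg f s \<rho>" "avg f s r \<le> 5 / 8"
  shows "\<exists>R\<ge>\<rho>. \<mu> (ball s R) \<le> (32 * P * D^2 * r) powr p * energy p g (ball s R)"
proof (rule ccontr)
  \<comment> \<open>With this factor the geometric series is at most \<open>1/16\<close>.\<close>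
  define q where "q = 32 * P * D^2 * r"
  assume "\<not> ?thesis"
  then have large: "\<And>R. \<rho> \<le> R \<Longrightarrow> q powr p * energy p g (ball s R) \<le> \<mu> (ball s R)"
    unfolding q_def by force
  have q: "0 < q" using P_pos D_ge_1 r by (simp add: q_def)
  have \<rho>0: "0 < \<rho>" using r by (simp add: \<rho>)
  note fD = admissibleD[OF f]
  define c where "c = 2 * D * P * \<rho> / q"
  have tele: "\<bar>avg f s (2 ^ k * \<rho>) - avg f s \<rho>\<bar> \<le> c * (2 ^ k - 1)" for k
  proof (induction k)
    case (Suc k)
    have pos: "0 < 2 ^ k * \<rho>" using \<rho>0 by simp
    have "\<rho> \<le> 2 ^ Suc k * \<rho>" using \<rho>0 mult_right_mono[of 1 "2 ^ Suc k" \<rho>] one_le_power[of "2::real" "Suc k"] by simp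
    also have "\<dots> \<le> L * (2 ^ Suc k * \<rho>)"
      using \<rho>0 by (intro le_L_mult) simp
    finally have "\<rho> \<le> L * (2 ^ Suc k * \<rho>)" .
    then have osc: "osc f s (2 ^ Suc k * \<rho>) \<le> P * (2 ^ Suc k * \<rho>) / q * \<mu> (ball s (2 ^ Suc k * \<rho>))"
      using \<rho>0 by (intro osc_le_small[OF f _ q] large) auto
    have "\<bar>avg f s (2 ^ k * \<rho>) - avg f s (2 ^ Suc k * \<rho>)\<bar> \<le> D * (P * (2 ^ Suc k * \<rho>) / q)"
    proof (rule avg_diff_le[OF fD(1-3) _ pos _ osc])
      show "ball s (2 ^ k * \<rho>) \<subseteq> ball s (2 ^ Suc k * \<rho>)" using \<rho>0 by (intro subset_ball) auto
      show "\<mu> (ball s (2 ^ Suc k * \<rho>)) \<le> D * \<mu> (ball s (2 ^ k * \<rho>))"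
        using \<mu>_doubling[OF pos, of s 1] by (simp add: mult.assoc)
    qed (use P_pos q \<rho>0 in auto)
    also have "D * (P * (2 ^ Suc k * \<rho>) / q) = c * 2 ^ k" by (simp add: c_def)
    finally have "\<bar>avg f s (2 ^ k * \<rho>) - avg f s (2 ^ Suc k * \<rho>)\<bar> \<le> c * 2 ^ k" .
    moreover have "c * (2 ^ Suc k - 1) = c * 2 ^ k + c * (2 ^ k - 1)" by (simp add: algebra_simps)
    ultimately show ?case using Suc.IH by linarith
  qed simp
  have "c * (2 ^ K - 1) \<le> c * 2 ^ K"
    using D_ge_1 P_pos \<rho>0 q by (intro mult_left_mono) (auto simp: c_def)
  also have "\<dots> = 2 * D * P * r / q" by (simp add: c_def \<rho>)
  also have "\<dots> = 1 / (16 * D)" using D_ge_1 P_pos r by (simp add: q_def power2_eq_square field_simps)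
  also have "\<dots> \<le> 1 / 16" using D_ge_1 by (simp add: field_simps)
  finally have "\<bar>avg f s r - avg f s \<rho>\<bar> \<le> 1 / 16" using tele[of K] by (simp add: \<rho>)
  then show False using avg by linarith
qed

lemma net_balls_overlap:
  fixes S :: "'a set"
  assumes S: "finite S" "\<And>s t. s \<in> S \<Longrightarrow> t \<in> S \<Longrightarrow> s \<noteq> t \<Longrightarrow> \<rho> \<le> dist s t" and \<rho>: "0 < \<rho>"
    and m: "4 * L + 2 \<le> 2 ^ m"
  shows "(\<Sum>s\<in>S. indicator (ball s (L * \<rho>)) y) \<le> D ^ m"
proof -
  let ?F = "{s \<in> S. y \<in> ball s (L * \<rho>)}"
  have "real (card ?F) \<le> 1 * D ^ m"
  proof (rule card_comparable_balls_le[where x = "\<lambda>s. s" and r = "\<lambda>_. \<rho> / 2" and y = y and R = "(L + 1) * \<rho>"])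
    fix z show "(\<Sum>s\<in>?F. indicator (ball s (\<rho> / 2)) z) \<le> (1::real)"
      by (rule separated_balls_overlap) (use S in auto)
  next
    fix s assume s: "s \<in> ?F"
    show "ball s (\<rho> / 2) \<subseteq> ball y ((L + 1) * \<rho>)"
    proof
      fix z assume "z \<in> ball s (\<rho> / 2)"
      then show "z \<in> ball y ((L + 1) * \<rho>)"
        using s \<rho> dist_triangle[of y z s] dist_commute[of y s] by (auto simp: algebra_simps)
    qed
    have "(4 * L + 2) * (\<rho> / 2) \<le> 2 ^ m * (\<rho> / 2)" using m \<rho> by (intro mult_right_mono) auto
    then have "2 * (L * \<rho>) + \<rho> \<le> 2 ^ m * (\<rho> / 2)" by (simp add: algebra_simps)
    then have le: "L * \<rho> + (L + 1) * \<rho> \<le> 2 ^ m * (\<rho> / 2)" by (simp add: algebra_simps)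
    show "ball y ((L + 1) * \<rho>) \<subseteq> ball s (2 ^ m * (\<rho> / 2))"
    proof
      fix z assume "z \<in> ball y ((L + 1) * \<rho>)"
      then have "dist y z < (L + 1) * \<rho>" "dist s y < L * \<rho>" using s by auto
      then show "z \<in> ball s (2 ^ m * (\<rho> / 2))"
        using le dist_triangle[of s z y] unfolding mem_ball by linarith
    qed
  qed (use S \<rho> in auto)
  moreover have "(\<Sum>s\<in>S. indicator (ball s (L * \<rho>)) y) = real (card ?F)"
      by (rule sum_indicator_eq_card[OF S(1)])
  ultimately show ?thesis by simp
qed

text \<open>
  A weak type form of the Sobolev-Poincare inequality with the sharp power of \<open>r\<close>, at resolution
  \<open>\<rho>\<close>. In the balls of a \<open>\<rho>\<close>-net on which the mean value of \<open>f\<close> is large, \<open>E\<close> is covered by means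
  of the previous lemma and Vitali's covering argument; in the others, \<open>E\<close> is a small part of the
  ball by Chebyshev's inequality. The contribution of the latter tends to \<open>0\<close> with \<open>\<rho>\<close>.
\<close>

lemma measure_level_set_le_resolution:
  assumes f: "admissible g f" and r: "0 < r"
    and E: "E \<in> sets Mc" "E \<subseteq> ball x r" "\<And>y. y \<in> E \<Longrightarrow> f y = 1"
    and avg: "\<And>s. s \<in> ball x r \<Longrightarrow> avg f s r \<le> 5 / 8"
    and m: "4 * L + 2 \<le> 2 ^ m"
  shows "\<mu> E \<le> D^2 * (32 * P * D^2 * r) powr p * energy p g UNIV +
    4 * P * (D * \<mu> (ball x (2 * r)) + D ^ m * energy p g UNIV) * (r / 2 ^ K)"
proof -
  define \<rho> where "\<rho> = r / 2 ^ K"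
  have \<rho>0: "0 < \<rho>" "\<rho> \<le> r" using r by (auto simp: \<rho>_def field_simps)
  define \<kappa> where "\<kappa> = (32 * P * D^2 * r) powr p"
  let ?\<nu> = "energy p g"
  note fD = admissibleD[OF f]
  obtain S where S: "finite S" "S \<subseteq> ball x r"
    "\<And>s t. s \<in> S \<Longrightarrow> t \<in> S \<Longrightarrow> s \<noteq> t \<Longrightarrow> \<rho> \<le> dist s t" "ball x r \<subseteq> (\<Union>s\<in>S. ball s \<rho>)"
    using finite_net[OF r \<rho>_def] by metis
  define good where "good = {s \<in> S. 3 / 4 \<le> avg f s \<rho>}"
  define U where "U = (\<Union>s\<in>good. ball s \<rho>)"
  have fin: "finite good" using S by (simp add: good_def)
  have "\<forall>s\<in>good. \<exists>R\<ge>\<rho>. \<mu> (ball s R) \<le> \<kappa> * ?\<nu> (ball s R)"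
    unfolding \<kappa>_def using S(2) avg by (intro ballI ex_ball_of_large_energy[OF f r \<rho>_def]) (auto simp: good_def)
  then obtain R where R: "\<And>s. s \<in> good \<Longrightarrow> \<rho> \<le> R s"
    "\<And>s. s \<in> good \<Longrightarrow> \<mu> (ball s (R s)) \<le> \<kappa> * ?\<nu> (ball s (R s))"
    by metis
  obtain G where G: "G \<subseteq> good" "pairwise (\<lambda>i j. disjnt (ball i (R i)) (ball j (R j))) G"
    "\<forall>i\<in>good. \<exists>j\<in>G. ball i (R i) \<subseteq> ball j (3 * R j)"
    using vitali_finite[OF fin, of "\<lambda>s. s" R] by auto
  have finG: "finite G" using G(1) fin by (rule finite_subset)
  have U_borel: "U \<in> sets Mc" unfolding U_def by (intro borel_sets borel_open open_UN) auto
  have cover: "E \<inter> U = (\<Union>s\<in>G. E \<inter> U \<inter> ball s (3 * R s))"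
  proof -
    have "U \<subseteq> (\<Union>s\<in>G. ball s (3 * R s))"
    proof
      fix y assume "y \<in> U"
      then obtain s where s: "s \<in> good" "y \<in> ball s \<rho>" by (auto simp: U_def)
      then have "y \<in> ball s (R s)" using R(1)[of s] by auto
      then show "y \<in> (\<Union>s\<in>G. ball s (3 * R s))" using G(3) s(1) by blast
    qed
    then show ?thesis by blast
  qed
  have "\<mu> (E \<inter> U) \<le> (\<Sum>s\<in>G. \<mu> (E \<inter> U \<inter> ball s (3 * R s)))"
    by (subst cover, rule measure_UNION_le[OF finG]) (use E U_borel borel_sets in auto)
  also have "\<dots> \<le> (\<Sum>s\<in>G. D^2 * \<kappa> * ?\<nu> (ball s (R s)))"
  proof (rule sum_mono)
    fix s assume "s \<in> G"
    then have s: "s \<in> good" using G(1) by auto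
    have Rs: "0 < R s" using R(1)[OF s] \<rho>0 by linarith
    have "\<mu> (E \<inter> U \<inter> ball s (3 * R s)) \<le> \<mu> (ball s (3 * R s))"
      by (intro \<mu>_mono) (use E U_borel borel_sets in auto)
    also have "\<dots> \<le> D^2 * \<mu> (ball s (R s))" by (rule \<mu>_ball_le[OF Rs]) (use Rs in auto)
    also have "\<dots> \<le> D^2 * (\<kappa> * ?\<nu> (ball s (R s)))" using R(2)[OF s] by (intro mult_left_mono) auto
    finally show "\<mu> (E \<inter> U \<inter> ball s (3 * R s)) \<le> D^2 * \<kappa> * ?\<nu> (ball s (R s))" by (simp add: mult.assoc)
  qed
  also have "\<dots> = D^2 * \<kappa> * (\<Sum>s\<in>G. ?\<nu> (ball s (R s)))" by (simp add: sum_distrib_left)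
  also have "\<dots> \<le> D^2 * \<kappa> * (1 * ?\<nu> UNIV)"
  proof (intro mult_left_mono sum_energy_le_overlap[OF fD(5,6) finG])
    fix y
    have "card {s \<in> G. y \<in> ball s (R s)} \<le> 1"
      using G(2) finG by (auto simp: card_le_Suc0_iff_eq pairwise_def disjnt_iff)
    moreover have "(\<Sum>s\<in>G. indicator (ball s (R s)) y) = real (card {s \<in> G. y \<in> ball s (R s)})"
      by (rule sum_indicator_eq_card[OF finG])
    ultimately show "(\<Sum>s\<in>G. indicator (ball s (R s)) y) \<le> (1::real)" by simp
  qed (auto simp: \<kappa>_def)
  finally have good: "\<mu> (E \<inter> U) \<le> D^2 * \<kappa> * ?\<nu> UNIV" by simp
  have "E - U = (\<Union>s\<in>S - good. (E - U) \<inter> ball s \<rho>)"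
    using E(2) S(4) unfolding U_def by blast
  then have "\<mu> (E - U) = \<mu> (\<Union>s\<in>S - good. (E - U) \<inter> ball s \<rho>)" by simp
  also have "\<dots> \<le> (\<Sum>s\<in>S - good. \<mu> ((E - U) \<inter> ball s \<rho>))"
    by (rule measure_UNION_le) (use S(1) E U_borel borel_sets in auto)
  also have "\<dots> \<le> (\<Sum>s\<in>S - good. 4 * P * \<rho> * (\<mu> (ball s \<rho>) + ?\<nu> (ball s (L * \<rho>))))"
  proof (rule sum_mono)
    fix s assume s: "s \<in> S - good"
    have "\<mu> ((E - U) \<inter> ball s \<rho>) \<le> 4 * osc f s \<rho>"
    proof (rule measure_le_osc[OF fD(1-3)])
      fix y assume "y \<in> (E - U) \<inter> ball s \<rho>"
      then show "1 / 4 \<le> \<bar>f y - avg f s \<rho>\<bar>" using E(3)[of y] s by (auto simp: good_def)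
    qed (use E U_borel borel_sets in auto)
    then show "\<mu> ((E - U) \<inter> ball s \<rho>) \<le> 4 * P * \<rho> * (\<mu> (ball s \<rho>) + ?\<nu> (ball s (L * \<rho>)))"
      using osc_le_sum[OF f \<rho>0(1), of s] by simp
  qed
  also have "\<dots> \<le> (\<Sum>s\<in>S. 4 * P * \<rho> * (\<mu> (ball s \<rho>) + ?\<nu> (ball s (L * \<rho>))))"
    using S(1) P_pos \<rho>0 energy_nonneg by (intro sum_mono2) auto
  also have "\<dots> = 4 * P * \<rho> * ((\<Sum>s\<in>S. \<mu> (ball s \<rho>)) + (\<Sum>s\<in>S. ?\<nu> (ball s (L * \<rho>))))"
    unfolding sum_distrib_left[symmetric] sum.distrib ..
  also have "\<dots> \<le> 4 * P * \<rho> * (D * \<mu> (ball x (2 * r)) + D ^ m * ?\<nu> UNIV)"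
  proof (intro mult_left_mono add_mono)
    have "(\<Sum>s\<in>S. \<mu> (ball s \<rho>)) \<le> (\<Sum>s\<in>S. D * \<mu> (ball s (\<rho> / 2)))"
      using \<mu>_doubling[of "\<rho> / 2" _ 1] \<rho>0 by (intro sum_mono) auto
    also have "\<dots> = D * (\<Sum>s\<in>S. \<mu> (ball s (\<rho> / 2)))" by (simp add: sum_distrib_left)
    also have "\<dots> \<le> D * (1 * \<mu> (ball x (2 * r)))"
    proof (intro mult_left_mono sum_measure_le_overlap[OF S(1)])
      fix s assume "s \<in> S"
      then have s: "dist x s < r" using S by auto
      show "ball s (\<rho> / 2) \<subseteq> ball x (2 * r)"
      proof
        fix y assume "y \<in> ball s (\<rho> / 2)"
        then show "y \<in> ball x (2 * r)" using s \<rho>0 dist_triangle[of x y s] by auto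
      qed
    next
      show "(\<Sum>s\<in>S. indicator (ball s (\<rho> / 2)) y) \<le> (1::real)" for y
        by (rule separated_balls_overlap[OF S(1,3)])
    qed (use D_ge_1 borel_sets in \<open>auto simp: emeasure_ball\<close>)
    finally show "(\<Sum>s\<in>S. \<mu> (ball s \<rho>)) \<le> D * \<mu> (ball x (2 * r))" by simp
    show "(\<Sum>s\<in>S. ?\<nu> (ball s (L * \<rho>))) \<le> D ^ m * ?\<nu> UNIV"
      by (intro sum_energy_le_overlap[OF fD(5,6) S(1)] net_balls_overlap[OF S(1,3) \<rho>0(1) m]) auto
  qed (use P_pos \<rho>0 in auto)
  finally have bad: "\<mu> (E - U) \<le> 4 * P * \<rho> * (D * \<mu> (ball x (2 * r)) + D ^ m * ?\<nu> UNIV)" .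
  have "\<mu> E = \<mu> ((E \<inter> U) \<union> (E - U))" by (simp add: Int_Diff_Un)
  also have "\<dots> \<le> \<mu> (E \<inter> U) + \<mu> (E - U)" by (rule measure_Un_le) (use E U_borel in auto)
  finally show ?thesis using good bad by (simp add: \<kappa>_def \<rho>_def mult.assoc mult.left_commute mult.commute)
qed

lemma measure_level_set_le:
  assumes f: "admissible g f" and r: "0 < r"
    and E: "E \<in> sets Mc" "E \<subseteq> ball x r" "\<And>y. y \<in> E \<Longrightarrow> f y = 1"
    and avg: "avg f x (2 * r) \<le> 1 / 2"
  shows "\<mu> E \<le> D^2 * (32 * P * D^2 * r) powr p * energy p g UNIV"
proof -
  define q where "q = 32 * P * D^2 * r"
  have q: "0 < q" using P_pos D_ge_1 r by (simp add: q_def)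
  let ?\<nu> = "energy p g" and ?C = "D^2 * q powr p"
  note fD = admissibleD[OF f]
  \<comment> \<open>Unless the energy is so large that there is nothing to show, the mean values on the balls of
    radius \<open>r\<close> are close to that on the doubled ball.\<close>
  have "\<mu> E \<le> ?C * ?\<nu> UNIV"
  proof (cases "q powr p * ?\<nu> (ball x (L * (2 * r))) \<le> \<mu> (ball x (L * (2 * r)))")
    case False
    have "E \<subseteq> ball x (L * (2 * r))"
    proof -
      have "r \<le> L * (2 * r)" using r le_L_mult[of "2 * r"] by linarith
      then show ?thesis using E(2) subset_ball by blast
    qed
    then have "\<mu> E \<le> \<mu> (ball x (L * (2 * r)))" by (intro \<mu>_mono E)
    also have "\<dots> \<le> q powr p * ?\<nu> UNIV" 
      using False mult_left_mono[OF energy_mono[OF fD(5,6), of "ball x (L * (2 * r))"], of "q powr p"] by simp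
    also have "\<dots> \<le> D^2 * (q powr p * ?\<nu> UNIV)"
      using D_ge_1 energy_nonneg mult_right_mono[of 1 "D^2" "q powr p * ?\<nu> UNIV"] by simp
    finally show ?thesis by (simp add: mult.assoc)
  next
    case True
    have osc: "osc f x (2 * r) \<le> P * (2 * r) / q * \<mu> (ball x (2 * r))"
      using r by (intro osc_le_small[OF f _ q True]) auto
    have avg': "avg f s r \<le> 5 / 8" if s: "s \<in> ball x r" for s
    proof -
      have "\<bar>avg f s r - avg f x (2 * r)\<bar> \<le> D^2 * (P * (2 * r) / q)"
      proof (rule avg_diff_le[OF fD(1-3) _ r _ osc])
        show "ball s r \<subseteq> ball x (2 * r)"
        proof
          fix y assume "y \<in> ball s r"
          then show "y \<in> ball x (2 * r)" using s dist_triangle[of x y s] by auto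
        qed
        have "ball x (2 * r) \<subseteq> ball s (2 ^ 2 * r)"
        proof
          fix y assume "y \<in> ball x (2 * r)"
          then show "y \<in> ball s (2 ^ 2 * r)"
            using s r dist_triangle[of s y x] dist_commute[of s x] by auto
        qed
        then have "\<mu> (ball x (2 * r)) \<le> \<mu> (ball s (2 ^ 2 * r))" by (intro \<mu>_mono borel_sets) auto
        also have "\<dots> \<le> D^2 * \<mu> (ball s r)" by (rule \<mu>_doubling[OF r])
        finally show "\<mu> (ball x (2 * r)) \<le> D^2 * \<mu> (ball s r)" .
      qed (use P_pos q r in auto)
      also have "\<dots> = 1 / 16" using P_pos D_ge_1 r by (simp add: q_def)
      finally show ?thesis using avg by linarith
    qed
    obtain m where m: "4 * L + 2 \<le> 2 ^ m"
      using real_arch_pow[of 2 "4 * L + 2"] by (auto intro: less_imp_le)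
    let ?c = "4 * P * (D * \<mu> (ball x (2 * r)) + D ^ m * ?\<nu> UNIV)"
    have le: "\<mu> E \<le> ?C * ?\<nu> UNIV + ?c * (r / 2 ^ K)" for K
      using measure_level_set_le_resolution[OF f r E avg' m] unfolding q_def by blast
    have "(\<lambda>K. ?C * ?\<nu> UNIV + ?c * (r / 2 ^ K)) \<longlonglongrightarrow> ?C * ?\<nu> UNIV + ?c * 0"
      by (intro tendsto_intros LIMSEQ_divide_realpow_zero) auto
    then have "\<mu> E \<le> ?C * ?\<nu> UNIV + ?c * 0"
      using le by (intro LIMSEQ_le_const) auto
    then show ?thesis by simp
  qed
  then show ?thesis by (simp add: q_def)
qed

end

context doubling_space
begin

lemma sublevel_set:
  fixes f :: "'a \<Rightarrow> real"
  assumes "f \<in> borel_measurable Mc"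
  shows "{y \<in> ball x r. f y \<le> c} \<in> sets Mc"
proof -
  have "{y \<in> space Mc. f y \<le> c} \<in> sets Mc"
    using assms by (intro borel_measurable_le) auto
  then have "{y \<in> space Mc. f y \<le> c} \<inter> ball x r \<in> sets Mc"
    by (rule sets.Int) (auto intro: borel_sets)
  also have "{y \<in> space Mc. f y \<le> c} \<inter> ball x r = {y \<in> ball x r. f y \<le> c}"
    unfolding space_M by auto
  finally show ?thesis .
qed

text \<open>
  The level sets below are measurable for the completed measure only, whereas upper gradients are
  Borel functions; hence the sets to which they are restricted are enlarged by a null set.
\<close>

lemma borel_superset:
  assumes A: "A \<in> sets Mc" and B: "A \<subseteq> B" "B \<in> sets borel"
  obtains A' where "A' \<in> sets borel" "A \<subseteq> A'" "A' \<subseteq> B" "AE y in Mc. y \<in> A' \<longrightarrow> y \<in> A"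
proof -
  obtain S N N' where SN: "A = S \<union> N" "N \<subseteq> N'" "N' \<in> null_sets M" "S \<in> sets M"
    using A by (rule sets_completionE)
  have N': "N' \<in> sets borel" using SN(3) sets_M by auto
  have "AE y in Mc. y \<notin> N'"
    using SN(3) by (intro AE_not_in null_sets_completionI)
  then have "AE y in Mc. y \<in> (S \<union> N') \<inter> B \<longrightarrow> y \<in> A"
    by eventually_elim (use SN(1) in auto)
  moreover have "(S \<union> N') \<inter> B \<in> sets borel" using SN(4) sets_M N' B by auto
  ultimately show ?thesis using SN(1,2) B by (intro that[of "(S \<union> N') \<inter> B"]) auto
qed

end

definition cutoff :: "'a::metric_space \<Rightarrow> real \<Rightarrow> 'a \<Rightarrow> real"
  where "cutoff x r y = max 0 (min 1 (2 - dist y x / r))"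

lemma cutoff_bounds: "0 \<le> cutoff x r y" "cutoff x r y \<le> 1"
  by (auto simp: cutoff_def)

lemma cutoff_eq_1: "0 < r \<Longrightarrow> y \<in> ball x r \<Longrightarrow> cutoff x r y = 1"
  by (auto simp: cutoff_def dist_commute field_simps)

lemma cutoff_eq_0: "0 < r \<Longrightarrow> y \<notin> ball x (2 * r) \<Longrightarrow> cutoff x r y = 0"
  by (auto simp: cutoff_def dist_commute field_simps)

lemma cutoff_lipschitz:
  assumes "0 < r"
  shows "\<bar>cutoff x r y - cutoff x r z\<bar> \<le> 1 / r * dist y z"
proof -
  have "\<bar>cutoff x r y - cutoff x r z\<bar> \<le> \<bar>dist y x / r - dist z x / r\<bar>"
    unfolding cutoff_def by linarith
  also have "\<dots> = \<bar>dist y x - dist z x\<bar> / r"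
    using assms by (simp add: diff_divide_distrib[symmetric])
  also have "\<dots> \<le> dist y z / r"
    using assms abs_dist_diff_le[of y x z] by (intro divide_right_mono) (auto simp: dist_commute)
  finally show ?thesis by simp
qed

lemma ug_modulo_cutoff: "0 < r \<Longrightarrow> ug_modulo k (\<lambda>_. ennreal (1 / r)) (cutoff x r)"
  using cutoff_lipschitz by (intro ug_modulo_lipschitz) auto

lemma cutoff_measurable: "cutoff x r \<in> borel_measurable borel"
proof -
  have [measurable]: "(\<lambda>y. dist y x) \<in> borel_measurable borel"
    by (intro borel_measurable_continuous_onI continuous_intros)
  show ?thesis unfolding cutoff_def[abs_def] by measurable
qed

lemma ug_modulo_real_of_ereal:
  assumes "upper_gradient k u" "upper_gradient g u"
  shows "ug_modulo k g (\<lambda>x. real_of_ereal (u x))"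
proof (rule ug_modulo_upper_gradient[OF assms])
  fix a b :: ereal assume "\<bar>a\<bar> \<noteq> \<infinity>" "\<bar>b\<bar> \<noteq> \<infinity>"
  then show "ereal \<bar>real_of_ereal a - real_of_ereal b\<bar> \<le> \<bar>a - b\<bar>"
    by (cases a; cases b) auto
qed

context poincare_space
begin

text \<open>
  A function that is large in the mean on \<open>ball x (2 r)\<close> but has small energy is larger than \<open>1/4\<close>
  up to a small part of the ball, and raising it to \<open>1/4\<close> there, by means of a cutoff function, is
  cheap.
\<close>

lemma capacity_ball_le_energy:
  assumes r: "0 < r" and sub: "ball x (2 * r) \<subseteq> \<Omega>"
    and f: "admissible g f" and \<Omega>: "\<And>y. y \<notin> \<Omega> \<Longrightarrow> f y = 0"
    and fin: "(\<integral>\<^sup>+ y. ennreal (f y powr p) \<partial>Mc) < top"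
    and A: "A = {y \<in> ball x (2 * r). f y \<le> 1 / 4}"
  shows "capacity M p (ball x r) \<Omega> \<le>
    ennreal (32 powr p * energy p g UNIV + 4 powr p * r powr (- p) * \<mu> A)"
proof -
  note fD = admissibleD[OF f]
  note p = p_gt_1
  have meas[measurable]: "f \<in> borel_measurable Mc" "cutoff x r \<in> borel_measurable Mc"
    using fD(1) borel_measurable_completion[OF sets_M cutoff_measurable] by auto
  have [measurable]: "ball x (2 * r) \<in> sets Mc" by (rule borel_sets) simp
  have A_sets: "A \<in> sets Mc" unfolding A by (rule sublevel_set[OF fD(1)])
  obtain A' where A': "A' \<in> sets borel" "A \<subseteq> A'" "A' \<subseteq> ball x (2 * r)"
    "AE y in Mc. y \<in> A' \<longrightarrow> y \<in> A"
  proof (rule borel_superset[OF A_sets])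
    show "A \<subseteq> ball x (2 * r)" by (auto simp: A)
  qed auto
  have g_ug: "ug_modulo g g f" using ug_modulo_real_of_ereal[OF fD(4,4)] by simp
  define w where "w y = max 0 (cutoff x r y / 4 - f y)" for y
  have "ug_modulo g (\<lambda>y. ennreal (1 / 4) * ennreal (1 / r) + ennreal 1 * g y) w"
  proof (rule ug_modulo_combine[OF ug_modulo_cutoff[OF r, of _ x] g_ug])
    show "\<bar>w y - w z\<bar> \<le> 1 / 4 * \<bar>cutoff x r y - cutoff x r z\<bar> + 1 * \<bar>f y - f z\<bar>" for y z
    proof -
      have "\<bar>w y - w z\<bar> \<le> \<bar>(cutoff x r y / 4 - f y) - (cutoff x r z / 4 - f z)\<bar>"
        unfolding w_def by linarith
      also have "(cutoff x r y / 4 - f y) - (cutoff x r z / 4 - f z) =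
          (cutoff x r y - cutoff x r z) / 4 - (f y - f z)" by (simp add: field_simps)
      also have "\<bar>\<dots>\<bar> \<le> \<bar>(cutoff x r y - cutoff x r z) / 4\<bar> + \<bar>f y - f z\<bar>"
        by (rule abs_triangle_ineq4)
      also have "\<dots> = 1 / 4 * \<bar>cutoff x r y - cutoff x r z\<bar> + 1 * \<bar>f y - f z\<bar>" by simp
      finally show ?thesis .
    qed
  qed auto
  then have w_ug: "ug_modulo g (\<lambda>y. (ennreal (1 / 4) * ennreal (1 / r) + ennreal 1 * g y) * indicator A' y) w"
  proof (rule ug_modulo_restrict[OF _ A'(1)])
    fix y assume "y \<notin> A'"
    then have "y \<notin> A" using A' by auto
    then show "w y = 0"
      using cutoff_eq_0[OF r, of y x] cutoff_bounds[of x r y] fD(2)[of y] unfolding w_def A by force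
  qed
  define v where "v y = min 1 (4 * (f y + w y))" for y
  define h where "h y = ennreal 4 * g y +
    ennreal 4 * ((ennreal (1 / 4) * ennreal (1 / r) + ennreal 1 * g y) * indicator A' y)" for y
  have h_ug: "ug_modulo g h v"
    unfolding h_def
  proof (rule ug_modulo_combine[OF g_ug w_ug])
    show "\<bar>v y - v z\<bar> \<le> 4 * \<bar>f y - f z\<bar> + 4 * \<bar>w y - w z\<bar>" for y z
    proof -
      have "\<bar>v y - v z\<bar> \<le> \<bar>4 * (f y + w y) - 4 * (f z + w z)\<bar>"
        unfolding v_def by linarith
      also have "4 * (f y + w y) - 4 * (f z + w z) = 4 * ((f y - f z) + (w y - w z))" by simp
      also have "\<bar>\<dots>\<bar> = 4 * \<bar>(f y - f z) + (w y - w z)\<bar>" by (simp only: abs_mult abs_numeral)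
      also have "\<dots> \<le> 4 * (\<bar>f y - f z\<bar> + \<bar>w y - w z\<bar>)" by (intro mult_left_mono abs_triangle_ineq) auto
      finally show ?thesis by simp
    qed
  qed auto
  have h_le: "epow (h y) p \<le> ennreal (16 powr p) * epow (g y) p + ennreal (2 powr p * r powr (- p)) * indicator A' y" for y
  proof -
    have "h y \<le> ennreal 8 * g y + ennreal (1 / r) * indicator A' y"
    proof (cases "y \<in> A'")
      case True
      have "h y = (ennreal 4 * g y + ennreal 4 * g y) + ennreal 4 * (ennreal (1 / 4) * ennreal (1 / r))"
        using True by (simp add: h_def distrib_left algebra_simps)
      also have "ennreal 4 * (ennreal (1 / 4) * ennreal (1 / r)) = ennreal (1 / r)"
        using r by (simp del: ennreal_numeral flip: ennreal_mult)
      also have "ennreal 4 * g y + ennreal 4 * g y = ennreal 8 * g y"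
        by (simp flip: distrib_right)
      finally show ?thesis using True by simp
    next
      case False
      have "ennreal 4 * g y \<le> ennreal 8 * g y" by (intro mult_right_mono) auto
      then show ?thesis using False by (simp add: h_def)
    qed
    then have "epow (h y) p \<le> epow (ennreal 8 * g y + ennreal (1 / r) * indicator A' y) p"
      using p by (intro epow_mono) auto
    also have "\<dots> \<le> ennreal (2 powr p) * (epow (ennreal 8 * g y) p + epow (ennreal (1 / r) * indicator A' y) p)"
      using p by (intro epow_add_le) auto
    also have "\<dots> = ennreal (2 powr p) * (ennreal (8 powr p) * epow (g y) p + ennreal (r powr (- p)) * indicator A' y)"
      using p r by (subst epow_mult) (auto simp: epow_indicator epow_ennreal powr_divide powr_minus_divide)
    also have "\<dots> = ennreal (2 powr p * 8 powr p) * epow (g y) p + ennreal (2 powr p * r powr (- p)) * indicator A' y"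
      by (simp add: distrib_left ennreal_mult mult.assoc)
    also have "2 powr p * 8 powr p = (16::real) powr p" by (simp flip: powr_mult)
    finally show ?thesis .
  qed
  have "capacity M p (ball x r) \<Omega> \<le> ennreal (2 powr p) * p_energy M p h"
  proof (rule capacity_le[OF sets_M _ _ _ _ _ _ _ h_ug fD(5,6)])
    show "v \<in> borel_measurable Mc"
      unfolding v_def[abs_def] w_def[abs_def] by measurable
    show "0 \<le> v y" "v y \<le> 1" for y
      using fD(2)[of y] by (auto simp: v_def w_def)
    show "v y = 0" if "y \<notin> \<Omega>" for y
    proof -
      have "y \<notin> ball x (2 * r)" using that sub by auto
      then show ?thesis using \<Omega>[OF that] cutoff_eq_0[OF r, of y x] by (simp add: v_def w_def)
    qed
    show "v y = 1" if "y \<in> ball x r" for y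
      using cutoff_eq_1[OF r that] by (auto simp: v_def w_def max_def)
    have "(\<integral>\<^sup>+ y. ennreal (v y powr p) \<partial>Mc) \<le>
        (\<integral>\<^sup>+ y. ennreal (4 powr p) * ennreal (f y powr p) + indicator (ball x (2 * r)) y \<partial>Mc)"
    proof (rule nn_integral_mono)
      fix y
      show "ennreal (v y powr p) \<le> ennreal (4 powr p) * ennreal (f y powr p) + indicator (ball x (2 * r)) y"
      proof (cases "y \<in> ball x (2 * r)")
        case True
        have "v y powr p \<le> 1" using p fD(2)[of y] by (intro powr_le1) (auto simp: v_def w_def)
        then have "ennreal (v y powr p) \<le> indicator (ball x (2 * r)) y" using True by simp
        then show ?thesis by (simp add: add_increasing)
      next
        case False
        then have "v y \<le> 4 * f y" using cutoff_eq_0[OF r False] fD(2)[of y] by (simp add: v_def w_def)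
        then have "v y powr p \<le> (4 * f y) powr p"
          using p fD(2)[of y] by (intro powr_mono2) (auto simp: v_def w_def)
        also have "\<dots> = 4 powr p * f y powr p" using fD(2)[of y] by (simp add: powr_mult)
        finally have "ennreal (v y powr p) \<le> ennreal (4 powr p * f y powr p)" by (rule ennreal_leI)
        then show ?thesis using False by (simp add: ennreal_mult)
      qed
    qed
    also have "\<dots> = ennreal (4 powr p) * (\<integral>\<^sup>+ y. ennreal (f y powr p) \<partial>Mc) + ennreal (\<mu> (ball x (2 * r)))"
      by (subst nn_integral_add) (auto simp: nn_integral_cmult emeasure_ball)
    also have "\<dots> < top" using fin by (simp add: ennreal_mult_less_top)
    finally show "(\<integral>\<^sup>+ y. ennreal (v y powr p) \<partial>Mc) < top" .
  qed (use p in auto)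
  also have "\<dots> \<le> ennreal (2 powr p) * (\<integral>\<^sup>+ y. ennreal (16 powr p) * epow (g y) p +
      ennreal (2 powr p * r powr (- p)) * indicator A y \<partial>Mc)"
  proof (intro mult_left_mono nn_integral_mono_AE)
    show "AE y in Mc. epow (h y) p \<le> ennreal (16 powr p) * epow (g y) p +
        ennreal (2 powr p * r powr (- p)) * indicator A y"
      using A'(4)
    proof eventually_elim
      case (elim y)
      then show ?case using h_le[of y] A'(2) by (auto simp: indicator_def split: if_splits)
    qed
  qed simp
  also have "(\<integral>\<^sup>+ y. ennreal (16 powr p) * epow (g y) p +
      ennreal (2 powr p * r powr (- p)) * indicator A y \<partial>Mc) =
      ennreal (16 powr p * energy p g UNIV + 2 powr p * r powr (- p) * \<mu> A)"
  proof -
    have [measurable]: "g \<in> borel_measurable Mc" by (rule borel_measurable_completion[OF sets_M fD(5)])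
    have "emeasure Mc A \<le> emeasure Mc (ball x (2 * r))"
      using A by (intro emeasure_mono) auto
    then have "emeasure Mc A = ennreal (\<mu> A)"
      by (intro emeasure_eq_ennreal_measure) (auto simp: emeasure_ball top_unique)
    moreover have "p_energy M p g = ennreal (energy p g UNIV)"
      using energy_eq[OF fD(5,6), of UNIV] by simp
    ultimately show ?thesis
      using A_sets energy_nonneg[of p g UNIV]
      by (subst nn_integral_add) (auto simp: nn_integral_cmult nn_integral_cmult_indicator ennreal_mult)
  qed
  also have "ennreal (2 powr p) * ennreal (16 powr p * energy p g UNIV + 2 powr p * r powr (- p) * \<mu> A) =
      ennreal ((2 powr p * 16 powr p) * energy p g UNIV + (2 powr p * 2 powr p) * r powr (- p) * \<mu> A)"
    using energy_nonneg[of p g UNIV] by (simp add: distrib_left mult.assoc flip: ennreal_mult)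
  also have "2 powr p * 16 powr p = (32::real) powr p" by (simp flip: powr_mult)
  also have "2 powr p * 2 powr p = (4::real) powr p" by (simp flip: powr_mult)
  finally show ?thesis .
qed

lemma le_capacityI:
  assumes C: "0 < C"
    and le: "\<And>f g. admissible g f \<Longrightarrow> (\<And>y. y \<notin> \<Omega> \<Longrightarrow> f y = 0) \<Longrightarrow> (\<And>y. y \<in> E \<Longrightarrow> f y = 1) \<Longrightarrow>
      (\<integral>\<^sup>+ y. ennreal (f y powr p) \<partial>Mc) < top \<Longrightarrow>
      b \<le> ennreal C * p_energy M p g"
  shows "b \<le> ennreal C * capacity M p E \<Omega>"
proof -
  have inv: "ennreal C * (ennreal (1 / C) * z) = z" "ennreal (1 / C) * (ennreal C * z) = z" for z
    using C by (simp_all add: mult.assoc[symmetric] flip: ennreal_mult)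
  have *: "ennreal (1 / C) * b \<le> p_energy M p g"
    if u: "u \<in> newtonian M p" "\<forall>y. y \<notin> \<Omega> \<longrightarrow> u y = 0" "\<forall>y\<in>E. u y = 1" "\<forall>y. 0 \<le> u y \<and> u y \<le> 1"
      and g: "upper_gradient g u" for u g
  proof (cases "p_energy M p g < top")
    case True
    define f where "f y = real_of_ereal (u y)" for y
    have uf: "u y = ereal (f y)" for y
      using u(4)[rule_format, of y] by (cases "u y") (auto simp: f_def)
    then have ueq: "u = (\<lambda>y. ereal (f y))" by auto
    have k: "u \<in> borel_measurable Mc"
      "(\<integral>\<^sup>+ y. epow (e2ennreal \<bar>u y\<bar>) p \<partial>Mc) < top"
      using newtonianD[OF u(1)] by blast+
    have f01: "0 \<le> f y \<and> f y \<le> 1" for y using u(4)[rule_format, of y] by (simp add: uf)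
    have adm: "admissible g f"
      unfolding admissible_def using k(1) f01 g True unfolding ueq by auto
    have "(\<integral>\<^sup>+ y. ennreal (f y powr p) \<partial>Mc) < top"
      using k(2) f01 by (simp add: uf epow_ennreal)
    then have "b \<le> ennreal C * p_energy M p g"
      using u(2,3) by (intro le[OF adm]) (auto simp: uf zero_ereal_def one_ereal_def)
    then have "ennreal (1 / C) * b \<le> ennreal (1 / C) * (ennreal C * p_energy M p g)"
      by (rule mult_left_mono) simp
    then show ?thesis unfolding inv .
  qed (metis not_less order_trans top_greatest)
  have "ennreal (1 / C) * b \<le> capacity M p E \<Omega>"
    unfolding capacity_def using * by (intro INF_greatest) auto
  then have "ennreal C * (ennreal (1 / C) * b) \<le> ennreal C * capacity M p E \<Omega>"
    by (rule mult_left_mono) simp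
  then show ?thesis unfolding inv .
qed

text \<open>
  The dichotomy behind the proof that quasiadditivity implies the Hardy inequality. A capacitary
  test function \<open>u\<close> of \<open>E\<close> either is small in the mean on \<open>ball x (2 r)\<close>, and then its oscillation
  costs energy; or it is large in the mean, and then it almost is a test function of the whole ball,
  which costs energy as well.
\<close>

lemma measure_le_capacity:
  assumes c1: "0 < c1"
  obtains C where "0 < C" and "\<And>\<Omega> x r E. 0 < r \<Longrightarrow> ball x (2 * r) \<subseteq> \<Omega> \<Longrightarrow>
    ennreal (c1 * r powr (- p)) * emeasure M (ball x r) \<le> capacity M p (ball x r) \<Omega> \<Longrightarrow>
    E \<in> sets Mc \<Longrightarrow> E \<subseteq> ball x r \<Longrightarrow>
    ennreal (r powr (- p)) * emeasure Mc E \<le> ennreal C * capacity M p E \<Omega>"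
proof
  note p = p_gt_1
  \<comment> \<open>The term \<open>\<mu> A\<close> in \<open>capacity_ball_le_energy\<close> then amounts to at most half of the assumed lower
    bound for the capacity of the ball, and can be absorbed.\<close>
  define a where "a = 4 powr p * 16 * P * D / c1"
  define C where "C = D^2 * (32 * P * D^2) powr p + a powr p + 2 * 32 powr p / c1"
  have a: "0 < a" using P_pos D_ge_1 c1 by (simp add: a_def)
  show C: "0 < C" using c1 D_ge_1 P_pos by (simp add: C_def add_nonneg_pos)
  fix \<Omega> x r E
  assume r: "0 < r" and sub: "ball x (2 * r) \<subseteq> \<Omega>"
    and cap: "ennreal (c1 * r powr (- p)) * emeasure M (ball x r) \<le> capacity M p (ball x r) \<Omega>"
    and E: "E \<in> sets Mc" "E \<subseteq> ball x r"
  have finE: "emeasure Mc E = ennreal (\<mu> E)"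
    using emeasure_mono[OF E(2), of "Mc"] borel_sets[of "ball x r"]
    by (intro emeasure_eq_ennreal_measure) (auto simp: emeasure_ball top_unique)
  have pw: "(b * r) powr p = b powr p * r powr p" if "0 \<le> b" for b
    using r that by (simp add: powr_mult)
  have main: "\<mu> E \<le> C * r powr p * energy p g UNIV"
    if f: "admissible g f" and f0: "\<And>y. y \<notin> \<Omega> \<Longrightarrow> f y = 0" and f1: "\<And>y. y \<in> E \<Longrightarrow> f y = 1"
      and fin: "(\<integral>\<^sup>+ y. ennreal (f y powr p) \<partial>Mc) < top" for f g
  proof -
    let ?\<nu> = "energy p g UNIV"
    note fD = admissibleD[OF f]
    have \<nu>: "0 \<le> ?\<nu>" by (rule energy_nonneg)
    have weaken: "b * r powr p * ?\<nu> \<le> C * r powr p * ?\<nu>" if "b \<le> C" for b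
      using that \<nu> by (intro mult_right_mono) auto
    have C_ge: "D^2 * (32 * P * D^2) powr p \<le> C" "a powr p \<le> C" "2 * 32 powr p / c1 \<le> C"
      using c1 D_ge_1 by (auto simp: C_def)
    consider "avg f x (2 * r) \<le> 1 / 2"
      | "1 / 2 < avg f x (2 * r)" "\<mu> (ball x (L * (2 * r))) < (a * r) powr p * energy p g (ball x (L * (2 * r)))"
      | "1 / 2 < avg f x (2 * r)" "(a * r) powr p * energy p g (ball x (L * (2 * r))) \<le> \<mu> (ball x (L * (2 * r)))"
      by linarith
    then show ?thesis
    proof cases
      case 1
      have "\<mu> E \<le> D^2 * (32 * P * D^2 * r) powr p * ?\<nu>"
        by (rule measure_level_set_le[OF f r E f1 1])
      also have "\<dots> = D^2 * (32 * P * D^2) powr p * r powr p * ?\<nu>"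
        using P_pos pw[of "32 * P * D^2"] by simp
      also have "\<dots> \<le> C * r powr p * ?\<nu>" by (rule weaken[OF C_ge(1)])
      finally show ?thesis .
    next
      case 2
      have "r \<le> L * (2 * r)" using r le_L_mult[of "2 * r"] by linarith
      then have "E \<subseteq> ball x (L * (2 * r))" using E(2) subset_ball by blast
      then have "\<mu> E \<le> \<mu> (ball x (L * (2 * r)))" by (intro \<mu>_mono E)
      also have "\<dots> \<le> (a * r) powr p * energy p g (ball x (L * (2 * r)))" using 2 by simp
      also have "\<dots> \<le> (a * r) powr p * ?\<nu>" by (intro mult_left_mono energy_mono fD) auto
      also have "\<dots> = a powr p * r powr p * ?\<nu>" using pw[of a] a by simp
      also have "\<dots> \<le> C * r powr p * ?\<nu>" by (rule weaken[OF C_ge(2)])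
      finally show ?thesis .
    next
      case 3
      define A where "A = {y \<in> ball x (2 * r). f y \<le> 1 / 4}"
      have A_sets: "A \<in> sets Mc" unfolding A_def by (rule sublevel_set[OF fD(1)])
      have "\<mu> A \<le> 4 * osc f x (2 * r)"
        by (rule measure_le_osc[OF fD(1-3) A_sets]) (use 3 in \<open>auto simp: A_def\<close>)
      also have "\<dots> \<le> 4 * (P * (2 * r) / (a * r) * \<mu> (ball x (2 * r)))"
        using r a by (intro mult_left_mono osc_le_small[OF f _ _ 3(2)]) auto
      also have "\<dots> = 8 * P / a * \<mu> (ball x (2 * r))" using r by simp
      also have "\<dots> \<le> 8 * P / a * (D * \<mu> (ball x r))"
        using \<mu>_doubling[OF r, of x 1] P_pos a by (intro mult_left_mono) auto
      also have "\<dots> = c1 / (2 * 4 powr p) * \<mu> (ball x r)"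
        using P_pos D_ge_1 c1 by (simp add: a_def field_simps)
      finally have \<mu>A: "4 powr p * r powr (- p) * \<mu> A \<le> 4 powr p * r powr (- p) * (c1 / (2 * 4 powr p) * \<mu> (ball x r))"
        by (intro mult_left_mono) auto
      have "ennreal (c1 * r powr (- p) * \<mu> (ball x r)) \<le>
          ennreal (32 powr p * ?\<nu> + 4 powr p * r powr (- p) * \<mu> A)"
        using order_trans[OF cap capacity_ball_le_energy[OF r sub f f0 fin A_def]] c1
        by (simp add: emeasure_ball(2) flip: ennreal_mult)
      then have "c1 * r powr (- p) * \<mu> (ball x r) \<le> 32 powr p * ?\<nu> + 4 powr p * r powr (- p) * \<mu> A"
        using \<nu> by (subst (asm) ennreal_le_iff) auto
      also have "\<dots> \<le> 32 powr p * ?\<nu> + c1 * r powr (- p) * \<mu> (ball x r) / 2"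
        using \<mu>A by (simp add: mult.left_commute mult.assoc)
      finally have "c1 * r powr (- p) * \<mu> (ball x r) \<le> 2 * (32 powr p * ?\<nu>)" by linarith
      then have "\<mu> (ball x r) \<le> 2 * 32 powr p / c1 * r powr p * ?\<nu>"
        using c1 r by (simp add: powr_minus field_simps)
      also have "\<dots> \<le> C * r powr p * ?\<nu>" by (rule weaken[OF C_ge(3)])
      finally show ?thesis using \<mu>_mono[OF E] by linarith
    qed
  qed
  have "ennreal (r powr (- p) * \<mu> E) \<le> ennreal C * capacity M p E \<Omega>"
  proof (rule le_capacityI[OF C])
    fix f g
    assume f: "admissible g f" "\<And>y. y \<notin> \<Omega> \<Longrightarrow> f y = 0" "\<And>y. y \<in> E \<Longrightarrow> f y = 1"
      "(\<integral>\<^sup>+ y. ennreal (f y powr p) \<partial>Mc) < top"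
    have "r powr (- p) * \<mu> E \<le> C * energy p g UNIV"
      using main[OF f] r by (simp add: powr_minus field_simps)
    then show "ennreal (r powr (- p) * \<mu> E) \<le> ennreal C * p_energy M p g"
      using energy_eq[OF admissibleD(5,6)[OF f(1)], of UNIV] C energy_nonneg[of p g UNIV]
      by (simp add: ennreal_leI flip: ennreal_mult)
  qed
  then show "ennreal (r powr (- p)) * emeasure Mc E \<le> ennreal C * capacity M p E \<Omega>"
    by (simp add: finE flip: ennreal_mult)
qed

end

section \<open>Whitney covers\<close>

lemma suminf_indicator_le:
  assumes "\<And>F. finite F \<Longrightarrow> (\<Sum>i\<in>F. indicator (A i) y) \<le> (N::real)"
  shows "(\<Sum>i. indicator (A i) y :: ennreal) \<le> ennreal N"
  unfolding suminf_eq_SUP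
proof (rule SUP_least)
  fix n
  have "(\<Sum>i<n. indicator (A i) y :: ennreal) = ennreal (\<Sum>i<n. indicator (A i) y)"
    by (simp add: ennreal_indicator flip: sum_ennreal)
  also have "\<dots> \<le> ennreal N" by (intro ennreal_leI assms) simp
  finally show "(\<Sum>i<n. indicator (A i) y :: ennreal) \<le> ennreal N" .
qed

locale whitney_space = poincare_space M D p P L
  for M :: "'a::metric_space measure" and D p P L :: real +
  fixes \<Omega> :: "'a set" and I :: "nat set" and z :: "nat \<Rightarrow> 'a" and c :: real
  assumes open_\<Omega>: "open \<Omega>" and \<Omega>_ne: "\<Omega> \<noteq> UNIV" and cover: "whitney_cover c \<Omega> I z" and c_le: "c \<le> 1 / 4"
begin

abbreviation d :: "'a \<Rightarrow> real" where "d \<equiv> dist_compl \<Omega>"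
abbreviation rad :: "nat \<Rightarrow> real" where "rad \<equiv> whitney_rad c \<Omega> z"
abbreviation Q :: "nat \<Rightarrow> 'a set" where "Q \<equiv> whitney_ball c \<Omega> I z"

definition double_ball :: "nat \<Rightarrow> 'a set"
  where "double_ball i = (if i \<in> I then ball (z i) (2 * rad i) else {})"

lemma c_pos: "0 < c" using cover by (simp add: whitney_cover_def)

lemma d_pos_iff: "0 < d y \<longleftrightarrow> y \<in> \<Omega>"
  using in_closed_iff_infdist_zero[of "- \<Omega>" y] open_\<Omega> \<Omega>_ne infdist_nonneg[of y "- \<Omega>"]
  unfolding dist_compl_def by (auto simp: closed_Compl less_le)

lemma d_lipschitz: "d y \<le> d y' + dist y y'"
  unfolding dist_compl_def using infdist_triangle[of y "- \<Omega>" y'] by simp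

lemma rad_pos: "i \<in> I \<Longrightarrow> 0 < rad i"
  using cover c_pos d_pos_iff[of "z i"] unfolding whitney_cover_def whitney_rad_def by auto

text \<open>In the doubled balls, \<open>d\<close> and the radius remain comparable because \<open>c \<le> 1/4\<close>.\<close>

lemma rad_comparable:
  assumes i: "i \<in> I" and y: "y \<in> ball (z i) (2 * rad i)"
  shows "2 * c / 3 * d y \<le> rad i" "rad i \<le> 2 * c * d y" "y \<in> \<Omega>"
proof -
  have r: "rad i = c * d (z i)" by (simp add: whitney_rad_def)
  have dpos: "0 < d (z i)" using rad_pos[OF i] c_pos by (simp add: r zero_less_mult_iff)
  have "c * d (z i) \<le> 1 / 4 * d (z i)"
    using c_le dpos by (intro mult_right_mono) auto
  then have "dist y (z i) < d (z i) / 2" using y by (simp add: r dist_commute)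
  then have le: "d y \<le> 3 / 2 * d (z i)" "d (z i) / 2 \<le> d y" "0 < d y"
    using d_lipschitz[of y "z i"] d_lipschitz[of "z i" y] dpos by (auto simp: dist_commute)
  show "y \<in> \<Omega>" using le(3) d_pos_iff by simp
  show "2 * c / 3 * d y \<le> rad i"
    using mult_left_mono[OF le(1), of "2 * c / 3"] c_pos by (simp add: r)
  show "rad i \<le> 2 * c * d y"
    using mult_left_mono[OF le(2), of "2 * c"] c_pos by (simp add: r)
qed

lemma double_ball_subset: "double_ball i \<subseteq> \<Omega>"
  using rad_comparable(3) unfolding double_ball_def by auto

lemma Q_subset_double_ball: "Q i \<subseteq> double_ball i"
  unfolding whitney_ball_def double_ball_def using rad_pos[of i] subset_ball[of "rad i" "2 * rad i"] by auto

lemma double_ball_open: "open (double_ball i)" "open (Q i)"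
  unfolding double_ball_def whitney_ball_def by auto

text \<open>
  The Whitney balls whose doubles contain \<open>y\<close> have radii comparable to \<open>c * d y\<close>, so
  \<open>card_comparable_balls_le\<close> applies to them.
\<close>

lemma overlap_double_balls:
  obtains N where "0 \<le> N" "\<And>y. (\<Sum>i. indicator (double_ball i) y :: ennreal) \<le> ennreal N * indicator \<Omega> y"
proof -
  obtain C :: real where C: "\<And>y. (\<Sum>i. indicator (Q i) y :: ennreal) \<le> ennreal C"
    using cover unfolding whitney_cover_def by blast
  have fin: "(\<Sum>i\<in>F. indicator (Q i) y) \<le> max 0 C" if "finite F" for F y
  proof -
    have "ennreal (\<Sum>i\<in>F. indicator (Q i) y) = (\<Sum>i\<in>F. indicator (Q i) y)"
      by (simp add: ennreal_indicator flip: sum_ennreal)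
    also have "\<dots> \<le> (\<Sum>i. indicator (Q i) y)" by (rule sum_le_suminf) (use that in auto)
    also have "\<dots> \<le> ennreal (max 0 C)" by (rule order_trans[OF C ennreal_leI]) simp
    finally show ?thesis by (subst (asm) ennreal_le_iff) auto
  qed
  let ?N = "max 0 C * D ^ 4"
  have *: "(\<Sum>i\<in>F. indicator (double_ball i) y) \<le> ?N" if F: "finite F" for F y
  proof -
    let ?F = "{i \<in> F. y \<in> double_ball i}"
    have I: "i \<in> I" if "i \<in> ?F" for i using that by (auto simp: double_ball_def split: if_splits)
    have y: "y \<in> ball (z i) (2 * rad i)" if "i \<in> ?F" for i
      using that by (auto simp: double_ball_def split: if_splits)
    have "real (card ?F) \<le> max 0 C * D ^ 4"
    proof (rule card_comparable_balls_le[where x = z and r = rad and y = y and R = "6 * c * d y"])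
      fix w
      have "(\<Sum>i\<in>?F. indicator (ball (z i) (rad i)) w) = (\<Sum>i\<in>?F. indicator (Q i) w :: real)"
        using I by (intro sum.cong) (auto simp: whitney_ball_def)
      also have "\<dots> \<le> max 0 C" by (rule fin) (use F in auto)
      finally show "(\<Sum>i\<in>?F. indicator (ball (z i) (rad i)) w) \<le> max 0 C" .
    next
      fix i assume i: "i \<in> ?F"
      note rc = rad_comparable[OF I[OF i] y[OF i]] and pos = rad_pos[OF I[OF i]]
      have dy: "dist (z i) y < 2 * rad i" using y[OF i] by simp
      show "ball (z i) (rad i) \<subseteq> ball y (6 * c * d y)"
      proof
        fix w assume "w \<in> ball (z i) (rad i)"
        then show "w \<in> ball y (6 * c * d y)"
          using dy rc(2) dist_triangle[of y w "z i"] dist_commute[of y "z i"] by simp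
      qed
      show "ball y (6 * c * d y) \<subseteq> ball (z i) (2 ^ 4 * rad i)"
      proof
        fix w assume "w \<in> ball y (6 * c * d y)"
        then show "w \<in> ball (z i) (2 ^ 4 * rad i)"
          using dy rc(1) pos dist_triangle[of "z i" w y] by simp
      qed
    qed (use I rad_pos F in auto)
    moreover have "(\<Sum>i\<in>F. indicator (double_ball i) y) = real (card ?F)"
      by (rule sum_indicator_eq_card[OF F])
    ultimately show ?thesis by simp
  qed
  have "(\<Sum>i. indicator (double_ball i) y :: ennreal) \<le> ennreal ?N * indicator \<Omega> y" for y
  proof (cases "y \<in> \<Omega>")
    case True
    then show ?thesis using suminf_indicator_le[OF *, of y] by simp
  next
    case False
    then have "y \<notin> double_ball i" for i using double_ball_subset by blast
    then show ?thesis by simp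
  qed
  then show ?thesis using that[of ?N] D_ge_1 by simp
qed

section \<open>The Hardy inequality implies quasiadditivity\<close>

lemma d_measurable [measurable]: "d \<in> borel_measurable Mc"
proof -
  have "d \<in> borel_measurable borel"
    unfolding dist_compl_def by (intro borel_measurable_continuous_onI continuous_intros)
  then show ?thesis by (rule borel_measurable_completion[OF sets_M])
qed

lemma \<Omega>_sets [measurable]: "\<Omega> \<in> sets Mc"
  using open_\<Omega> by (intro borel_sets) auto

lemma newtonian_admissible:
  assumes f: "admissible g f" "(\<integral>\<^sup>+ y. ennreal (f y powr p) \<partial>Mc) < top"
  shows "(\<lambda>y. ereal (f y)) \<in> newtonian M p"
  by (rule newtonianI[OF _ _ admissibleD(4,6)[OF f(1)]])
    (use f(2) admissibleD(1,2)[OF f(1)] in \<open>auto simp: epow_ennreal\<close>)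

definition hardy_with :: "real \<Rightarrow> bool"
  where "hardy_with C \<longleftrightarrow> (\<forall>u \<in> newtonian M p. \<forall>g. (\<forall>x. x \<notin> \<Omega> \<longrightarrow> u x = 0) \<longrightarrow> upper_gradient g u \<longrightarrow>
      (\<integral>\<^sup>+ x \<in> \<Omega>. epow (e2ennreal \<bar>u x\<bar>) p * ennreal (d x powr (- p)) \<partial>Mc)
      \<le> ennreal C * (\<integral>\<^sup>+ x \<in> \<Omega>. epow (g x) p \<partial>Mc))"

lemma hardy_admissible:
  assumes hardy: "hardy_with C"
    and f: "admissible g f" "(\<integral>\<^sup>+ y. ennreal (f y powr p) \<partial>Mc) < top" "\<And>y. y \<notin> \<Omega> \<Longrightarrow> f y = 0"
  shows "(\<integral>\<^sup>+ x \<in> \<Omega>. ennreal (f x powr p * d x powr (- p)) \<partial>Mc)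
      \<le> ennreal C * p_energy M p g"
proof -
  have "(\<integral>\<^sup>+ x \<in> \<Omega>. ennreal (f x powr p * d x powr (- p)) \<partial>Mc) =
      (\<integral>\<^sup>+ x \<in> \<Omega>. epow (e2ennreal \<bar>ereal (f x)\<bar>) p * ennreal (d x powr (- p)) \<partial>Mc)"
    using admissibleD(2)[OF f(1)] by (simp add: epow_ennreal ennreal_mult)
  also have "\<dots> \<le> ennreal C * (\<integral>\<^sup>+ x \<in> \<Omega>. epow (g x) p \<partial>Mc)"
  proof -
    have "\<forall>x. x \<notin> \<Omega> \<longrightarrow> ereal (f x) = 0" using f(3) by simp
    with hardy[unfolded hardy_with_def, rule_format, OF newtonian_admissible[OF f(1,2)] _ admissibleD(4)[OF f(1)]]
    show ?thesis by blast
  qed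
  also have "\<dots> \<le> ennreal C * p_energy M p g"
    by (intro mult_left_mono nn_integral_mono) (auto simp: indicator_def)
  finally show ?thesis .
qed

text \<open>
  The Hardy inequality for a test function of \<open>Q i\<close> gives this, as such a function equals \<open>1\<close> where
  \<open>d\<close> is at most a multiple of the radius.
\<close>

lemma capacity_whitney_ge:
  assumes C: "0 < C" and hardy: "hardy_with C"
    and i: "i \<in> I"
  shows "ennreal ((3 / (2 * c)) powr (- p) / C * rad i powr (- p)) * emeasure M (Q i) \<le> capacity M p (Q i) \<Omega>"
proof -
  let ?b = "(3 / (2 * c)) powr (- p) * rad i powr (- p)"
  have Q: "Q i = ball (z i) (rad i)" using i by (simp add: whitney_ball_def)
  have sets_Q: "Q i \<in> sets Mc" using double_ball_open(2) by (intro borel_sets) auto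
  have "ennreal ?b * emeasure M (Q i) \<le> ennreal C * capacity M p (Q i) \<Omega>"
  proof (rule le_capacityI[OF C])
    fix f g
    assume f: "admissible g f" "\<And>y. y \<notin> \<Omega> \<Longrightarrow> f y = 0" "\<And>y. y \<in> Q i \<Longrightarrow> f y = 1"
      "(\<integral>\<^sup>+ y. ennreal (f y powr p) \<partial>Mc) < top"
    have "ennreal ?b * emeasure M (Q i) = (\<integral>\<^sup>+ y. ennreal ?b * indicator (Q i) y \<partial>Mc)"
      using sets_Q by (subst nn_integral_cmult_indicator) (auto simp: Q emeasure_ball)
    also have "\<dots> \<le> (\<integral>\<^sup>+ x \<in> \<Omega>. ennreal (f x powr p * d x powr (- p)) \<partial>Mc)"
    proof (rule nn_integral_mono)
      fix y
      show "ennreal ?b * indicator (Q i) y \<le> ennreal (f y powr p * d y powr (- p)) * indicator \<Omega> y"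
      proof (cases "y \<in> Q i")
        case True
        then have y: "y \<in> ball (z i) (2 * rad i)" using Q_subset_double_ball[of i] i by (auto simp: double_ball_def)
        note rc = rad_comparable[OF i y]
        have "d y \<le> 3 / (2 * c) * rad i" using rc(1) c_pos by (simp add: field_simps)
        then have "(3 / (2 * c) * rad i) powr (- p) \<le> d y powr (- p)"
          using rc(3) d_pos_iff[of y] p_gt_1 by (intro powr_mono2') auto
        moreover have "(3 / (2 * c) * rad i) powr (- p) = ?b"
          by (rule powr_mult)
        ultimately have "?b \<le> d y powr (- p)" by simp
        then show ?thesis using True rc(3) f(3)[OF True] by (simp add: ennreal_leI)
      qed simp
    qed
    also have "\<dots> \<le> ennreal C * p_energy M p g"
      by (rule hardy_admissible[OF hardy f(1,4,2)])
    finally show "ennreal ?b * emeasure M (Q i) \<le> ennreal C * p_energy M p g" .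
  qed
  then have "ennreal (1 / C) * (ennreal ?b * emeasure M (Q i)) \<le> ennreal (1 / C) * (ennreal C * capacity M p (Q i) \<Omega>)"
    by (intro mult_left_mono) auto
  also have "\<dots> = capacity M p (Q i) \<Omega>" using C by (simp add: mult.assoc[symmetric] flip: ennreal_mult)
  also have "ennreal (1 / C) * (ennreal ?b * emeasure M (Q i)) = ennreal (1 / C * ?b) * emeasure M (Q i)"
    using C by (simp add: mult.assoc[symmetric] flip: ennreal_mult)
  finally show ?thesis by (simp add: mult.commute)
qed

lemma nn_integral_powr_le_ball:
  assumes "\<And>y. y \<notin> ball x r \<Longrightarrow> f y = 0" "\<And>y. 0 \<le> f y" "\<And>y. f y \<le> (1::real)"
  shows "(\<integral>\<^sup>+ y. ennreal (f y powr p) \<partial>Mc) < top"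
proof -
  have "(\<integral>\<^sup>+ y. ennreal (f y powr p) \<partial>Mc) \<le> (\<integral>\<^sup>+ y. indicator (ball x r) y \<partial>Mc)"
  proof (rule nn_integral_mono)
    fix y show "ennreal (f y powr p) \<le> indicator (ball x r) y"
      using assms(1)[of y] powr_le1[of p "f y"] assms(2,3)[of y] p_gt_1 by (cases "y \<in> ball x r") auto
  qed
  also have "\<dots> < top" using borel_sets[of "ball x r"] by (simp add: emeasure_ball)
  finally show ?thesis .
qed

lemma capacity_whitney_le:
  assumes i: "i \<in> I"
  shows "capacity M p (Q i) \<Omega> \<le> ennreal (2 powr p * D * rad i powr (- p)) * emeasure M (Q i)"
proof -
  let ?r = "rad i" and ?B = "ball (z i) (2 * rad i)"
  note r = rad_pos[OF i]
  have Q: "Q i = ball (z i) ?r" using i by (simp add: whitney_ball_def)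
  have "capacity M p (Q i) \<Omega> \<le>
      ennreal (2 powr p) * (\<integral>\<^sup>+ y. epow (ennreal (1 / ?r) * indicator ?B y) p \<partial>Mc)"
  proof (rule capacity_le[OF sets_M, where f = "cutoff (z i) ?r" and k = "\<lambda>_. 0"])
    show "ug_modulo (\<lambda>_. 0) (\<lambda>y. ennreal (1 / ?r) * indicator ?B y) (cutoff (z i) ?r)"
      by (rule ug_modulo_restrict[OF ug_modulo_cutoff[OF r]]) (use cutoff_eq_0[OF r] in auto)
    show "cutoff (z i) ?r \<in> borel_measurable Mc"
      by (rule borel_measurable_completion[OF sets_M cutoff_measurable])
    show "(\<integral>\<^sup>+ y. ennreal (cutoff (z i) ?r y powr p) \<partial>Mc) < top"
      by (rule nn_integral_powr_le_ball[of "z i" "2 * ?r"]) (use cutoff_eq_0[OF r] cutoff_bounds in auto)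
    show "cutoff (z i) ?r y = 0" if "y \<notin> \<Omega>" for y
      using that rad_comparable(3)[OF i, of y] by (intro cutoff_eq_0[OF r]) auto
  qed (use p_gt_1 cutoff_bounds cutoff_eq_1[OF r] in \<open>auto simp: Q\<close>)
  also have "(\<integral>\<^sup>+ y. epow (ennreal (1 / ?r) * indicator ?B y) p \<partial>Mc) = ennreal (?r powr (- p) * \<mu> ?B)"
    using r borel_sets[of ?B]
    by (simp add: epow_indicator epow_ennreal powr_divide powr_minus_divide nn_integral_cmult_indicator emeasure_ball
        flip: ennreal_mult)
  also have "ennreal (2 powr p) * \<dots> = ennreal (2 powr p * (?r powr (- p) * \<mu> ?B))"
    by (simp flip: ennreal_mult)
  also have "\<dots> \<le> ennreal (2 powr p * (?r powr (- p) * (D * \<mu> (ball (z i) ?r))))"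
    using \<mu>_doubling[OF r, of "z i" 1] by (intro ennreal_leI mult_left_mono) auto
  also have "\<dots> = ennreal (2 powr p * D * ?r powr (- p)) * emeasure M (Q i)"
    using D_ge_1 by (simp add: Q emeasure_ball mult_ac flip: ennreal_mult)
  finally show ?thesis .
qed

lemma capacity_empty: "capacity M p {} \<Omega> = 0"
proof -
  have "capacity M p {} \<Omega> \<le> ennreal (2 powr p) * (\<integral>\<^sup>+ y. epow (ennreal 0) p \<partial>Mc)"
  proof (rule capacity_le[OF sets_M, where f = "\<lambda>_. 0" and k = "\<lambda>_. 0"])
    show "ug_modulo (\<lambda>_. 0) (\<lambda>_. ennreal 0) (\<lambda>_. 0)" by (rule ug_modulo_lipschitz) auto
  qed (use p_gt_1 in auto)
  then show ?thesis by simp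
qed

text \<open>
  The gradient of the cutoff function must not enter where \<open>f\<close> is small, as it is to be controlled by
  \<open>f / d\<close>. Taking the minimum with \<open>2 f - 1\<close>, which is positive only where \<open>f > 1/2\<close>, achieves this.
\<close>

lemma capacity_piece_le:
  assumes f: "admissible g f" "\<And>y. y \<in> E \<Longrightarrow> f y = 1"
  shows "capacity M p (E \<inter> Q i) \<Omega> \<le> (\<integral>\<^sup>+ y. (ennreal (8 powr p) * epow (g y) p +
      ennreal (8 powr p * (2 * c / 3) powr (- p) * (f y powr p * d y powr (- p)))) * indicator (double_ball i) y
    \<partial>Mc)"
proof (cases "i \<in> I")
  case False
  then show ?thesis by (simp add: whitney_ball_def capacity_empty)
next
  case i: True
  note fD = admissibleD[OF f(1)] and r = rad_pos[OF i] and p = p_gt_1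
  let ?r = "rad i" and ?B = "double_ball i"
  have B: "?B = ball (z i) (2 * ?r)" and Q: "Q i = ball (z i) ?r"
    using i by (auto simp: double_ball_def whitney_ball_def)
  have meas[measurable]: "f \<in> borel_measurable Mc" "cutoff (z i) ?r \<in> borel_measurable Mc"
    "g \<in> borel_measurable Mc"
    using fD(1) borel_measurable_completion[OF sets_M] cutoff_measurable fD(5) by auto
  have [measurable]: "?B \<in> sets Mc" using double_ball_open(1) by (intro borel_sets) auto
  define A where "A = {y \<in> ?B. 1 / 2 < f y}"
  have "A = ?B - {y \<in> ball (z i) (2 * ?r). f y \<le> 1 / 2}" by (auto simp: A_def B)
  moreover have "\<dots> \<in> sets Mc"
    by (rule sets.Diff[OF _ sublevel_set[OF fD(1)]]) measurable
  ultimately have A_sets: "A \<in> sets Mc" by simp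
  obtain A' where A': "A' \<in> sets borel" "A \<subseteq> A'" "A' \<subseteq> ?B" "AE y in Mc. y \<in> A' \<longrightarrow> y \<in> A"
  proof (rule borel_superset[OF A_sets])
    show "A \<subseteq> ?B" by (auto simp: A_def)
  qed (use double_ball_open in auto)
  have g_ug: "ug_modulo g g f" using ug_modulo_real_of_ereal[OF fD(4,4)] by simp
  define w where "w y = min (max 0 (2 * f y - 1)) (cutoff (z i) ?r y)" for y
  define h where "h y = (ennreal 2 * g y + ennreal 1 * ennreal (1 / ?r)) * indicator A' y" for y
  have "ug_modulo g (\<lambda>y. ennreal 2 * g y + ennreal 1 * ennreal (1 / ?r)) w"
  proof (rule ug_modulo_combine[OF g_ug ug_modulo_cutoff[OF r, of _ "z i"]])
    show "\<bar>w x - w y\<bar> \<le> 2 * \<bar>f x - f y\<bar> + 1 * \<bar>cutoff (z i) ?r x - cutoff (z i) ?r y\<bar>" for x y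
    proof -
      have *: "\<bar>min a b - min a' b'\<bar> \<le> \<bar>a - a'\<bar> + \<bar>b - b'\<bar>" for a b a' b' :: real by linarith
      have "\<bar>max 0 (2 * f x - 1) - max 0 (2 * f y - 1)\<bar> \<le> \<bar>(2 * f x - 1) - (2 * f y - 1)\<bar>" by linarith
      also have "(2 * f x - 1) - (2 * f y - 1) = 2 * (f x - f y)" by simp
      also have "\<bar>\<dots>\<bar> = 2 * \<bar>f x - f y\<bar>" by (simp only: abs_mult abs_numeral)
      finally show ?thesis
        using *[of "max 0 (2 * f x - 1)" "cutoff (z i) ?r x" "max 0 (2 * f y - 1)" "cutoff (z i) ?r y"]
        unfolding w_def by linarith
    qed
  qed auto
  then have h_ug: "ug_modulo g h w"
    unfolding h_def
  proof (rule ug_modulo_restrict[OF _ A'(1)])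
    fix y assume "y \<notin> A'"
    then have "y \<notin> A" using A'(2) by auto
    then consider "y \<notin> ball (z i) (2 * ?r)" | "f y \<le> 1 / 2" unfolding A_def B by fastforce
    then show "w y = 0"
    proof cases
      case 1
      then show ?thesis using cutoff_eq_0[OF r 1] by (simp add: w_def)
    next
      case 2
      then show ?thesis using cutoff_bounds[of "z i" ?r y] by (simp add: w_def)
    qed
  qed
  have wb: "0 \<le> w y" "w y \<le> 1" "y \<notin> ball (z i) (2 * ?r) \<Longrightarrow> w y = 0" for y
    using cutoff_bounds[of "z i" ?r y] cutoff_eq_0[OF r, of y "z i"] by (auto simp: w_def)
  have "capacity M p (E \<inter> Q i) \<Omega> \<le> ennreal (2 powr p) * p_energy M p h"
  proof (rule capacity_le[OF sets_M _ _ _ _ _ _ _ h_ug fD(5,6)])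
    show "w \<in> borel_measurable Mc" unfolding w_def[abs_def] by measurable
    show "w y = 1" if "y \<in> E \<inter> Q i" for y
      using that f(2)[of y] cutoff_eq_1[OF r, of y "z i"] by (simp add: w_def Q)
    show "w y = 0" if "y \<notin> \<Omega>" for y
      using that wb(3)[of y] rad_comparable(3)[OF i, of y] by auto
    show "(\<integral>\<^sup>+ y. ennreal (w y powr p) \<partial>Mc) < top"
      by (rule nn_integral_powr_le_ball[of "z i" "2 * ?r"]) (use wb in auto)
  qed (use wb p in auto)
  also have "\<dots> = (\<integral>\<^sup>+ y. ennreal (2 powr p) * epow (h y) p \<partial>Mc)"
    using borel_measurable_completion[OF sets_M ug_moduloD(1)[OF h_ug]] by (subst nn_integral_cmult) auto
  also have "\<dots> \<le> (\<integral>\<^sup>+ y. (ennreal (8 powr p) * epow (g y) p +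
      ennreal (8 powr p * (2 * c / 3) powr (- p) * (f y powr p * d y powr (- p)))) * indicator ?B y \<partial>Mc)"
  proof (rule nn_integral_mono_AE)
    show "AE y in Mc. ennreal (2 powr p) * epow (h y) p \<le> (ennreal (8 powr p) * epow (g y) p +
      ennreal (8 powr p * (2 * c / 3) powr (- p) * (f y powr p * d y powr (- p)))) * indicator ?B y"
      using A'(4)
    proof eventually_elim
      case (elim y)
      show ?case
      proof (cases "y \<in> A'")
        case True
        then have yA: "y \<in> ball (z i) (2 * ?r)" "1 / 2 < f y" using elim by (auto simp: A_def B)
        note rc = rad_comparable[OF i yA(1)]
        have dp: "0 < d y" using rc(3) d_pos_iff by simp
        have "?r powr (- p) \<le> (2 * c / 3 * d y) powr (- p)"
          using rc(1) dp c_pos p by (intro powr_mono2') auto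
        also have "\<dots> = (2 * c / 3) powr (- p) * d y powr (- p)"
          by (rule powr_mult)
        also have "\<dots> \<le> (2 * f y) powr p * ((2 * c / 3) powr (- p) * d y powr (- p))"
        proof -
          have "1 \<le> (2 * f y) powr p" using yA(2) p by (intro ge_one_powr_ge_zero) auto
          then show ?thesis using mult_right_mono[of 1 "(2 * f y) powr p"] by simp
        qed
        also have "(2 * f y) powr p = 2 powr p * f y powr p" using fD(2) by (simp add: powr_mult)
        finally have rle: "?r powr (- p) \<le> 2 powr p * f y powr p * ((2 * c / 3) powr (- p) * d y powr (- p))" .
        have "epow (h y) p \<le> ennreal (2 powr p) * (epow (ennreal 2 * g y) p + epow (ennreal (1 / ?r)) p)"
          using True p epow_add_le[of p "ennreal 2 * g y" "ennreal (1 / ?r)"] by (simp add: h_def)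
        also have "\<dots> = ennreal (2 powr p) * (ennreal (2 powr p) * epow (g y) p + ennreal (?r powr (- p)))"
          using p r by (subst epow_mult) (auto simp: epow_ennreal powr_divide powr_minus_divide)
        also have "\<dots> \<le> ennreal (2 powr p) * (ennreal (2 powr p) * epow (g y) p +
            ennreal (2 powr p * f y powr p * ((2 * c / 3) powr (- p) * d y powr (- p))))"
          using rle by (intro mult_left_mono add_left_mono ennreal_leI) auto
        finally have "ennreal (2 powr p) * epow (h y) p \<le> ennreal (2 powr p) * (ennreal (2 powr p) * (ennreal (2 powr p) * epow (g y) p +
            ennreal (2 powr p * f y powr p * ((2 * c / 3) powr (- p) * d y powr (- p)))))"
          by (rule mult_left_mono) simp
        also have "\<dots> = ennreal (2 powr p * 2 powr p * 2 powr p) * epow (g y) p +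
            ennreal ((2 powr p * 2 powr p * 2 powr p) * ((2 * c / 3) powr (- p) * (f y powr p * d y powr (- p))))"
          by (simp add: distrib_left ennreal_mult mult_ac)
        also have "2 powr p * 2 powr p * 2 powr p = (8::real) powr p" by (simp flip: powr_mult)
        finally show ?thesis using yA by (simp add: B mult.assoc)
      next
        case False
        then show ?thesis by (simp add: h_def)
      qed
    qed
  qed
  finally show ?thesis .
qed

lemma hardy_imp_quasiadditive:
  assumes C: "0 < C" and hardy: "hardy_with C"
  shows "quasiadditive M p \<Omega> Q"
proof -
  obtain N where N: "0 \<le> N" "\<And>y. (\<Sum>i. indicator (double_ball i) y :: ennreal) \<le> ennreal N * indicator \<Omega> y"
    by (rule overlap_double_balls) blast
  define K where "K = 8 powr p * (2 * c / 3) powr (- p)"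
  define A where "A = (N + 1) * (8 powr p + K * C)"
  have K: "0 \<le> K" by (simp add: K_def)
  have "0 < 8 powr p + K * C" using K C by (simp add: add_pos_nonneg)
  then have A: "0 < A" using N by (simp add: A_def)
  have "(\<Sum>i. capacity M p (E \<inter> Q i) \<Omega>) \<le> ennreal A * capacity M p E \<Omega>" for E
  proof (rule le_capacityI[OF A])
    fix f g
    assume f: "admissible g f" "\<And>y. y \<notin> \<Omega> \<Longrightarrow> f y = 0" "\<And>y. y \<in> E \<Longrightarrow> f y = 1"
      "(\<integral>\<^sup>+ y. ennreal (f y powr p) \<partial>Mc) < top"
    note fD = admissibleD[OF f(1)]
    have [measurable]: "g \<in> borel_measurable Mc" "f \<in> borel_measurable Mc"
      using borel_measurable_completion[OF sets_M fD(5)] fD(1) by auto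
    have [measurable]: "double_ball i \<in> sets Mc" for i
      using double_ball_open(1) by (intro borel_sets) auto
    let ?H = "\<lambda>y. ennreal (f y powr p * d y powr (- p))"
    define G where "G y = ennreal (8 powr p) * epow (g y) p + ennreal K * ?H y" for y
    have [measurable]: "G \<in> borel_measurable Mc" unfolding G_def[abs_def] by measurable
    let ?I = "p_energy M p g"
    have "(\<Sum>i. capacity M p (E \<inter> Q i) \<Omega>) \<le> (\<Sum>i. \<integral>\<^sup>+ y. G y * indicator (double_ball i) y \<partial>Mc)"
      using capacity_piece_le[OF f(1,3)] by (intro suminf_le) (auto simp: G_def K_def ennreal_mult)
    also have "\<dots> = (\<integral>\<^sup>+ y. (\<Sum>i. G y * indicator (double_ball i) y) \<partial>Mc)"
      by (rule nn_integral_suminf[symmetric]) measurable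
    also have "\<dots> \<le> (\<integral>\<^sup>+ y. ennreal (N + 1) * (G y * indicator \<Omega> y) \<partial>Mc)"
    proof (rule nn_integral_mono)
      fix y
      have "(\<Sum>i. G y * indicator (double_ball i) y) = G y * (\<Sum>i. indicator (double_ball i) y)" by simp
      also have "\<dots> \<le> G y * (ennreal N * indicator \<Omega> y)" by (intro mult_left_mono N(2)) simp
      also have "\<dots> \<le> G y * (ennreal (N + 1) * indicator \<Omega> y)"
        by (intro mult_left_mono mult_right_mono ennreal_leI) auto
      finally show "(\<Sum>i. G y * indicator (double_ball i) y) \<le> ennreal (N + 1) * (G y * indicator \<Omega> y)"
        by (simp add: mult_ac)
    qed
    also have "\<dots> = ennreal (N + 1) * (\<integral>\<^sup>+ y. G y * indicator \<Omega> y \<partial>Mc)"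
      by (rule nn_integral_cmult) measurable
    also have "(\<integral>\<^sup>+ y. G y * indicator \<Omega> y \<partial>Mc) \<le>
        (\<integral>\<^sup>+ y. ennreal (8 powr p) * epow (g y) p + ennreal K * (?H y * indicator \<Omega> y) \<partial>Mc)"
      by (intro nn_integral_mono) (auto simp: G_def indicator_def)
    also have "\<dots> = ennreal (8 powr p) * ?I + ennreal K * (\<integral>\<^sup>+ y \<in> \<Omega>. ?H y \<partial>Mc)"
      by (subst nn_integral_add, measurable, subst nn_integral_cmult, measurable, subst nn_integral_cmult, measurable)
    also have "\<dots> \<le> ennreal (8 powr p) * ?I + ennreal K * (ennreal C * ?I)"
      by (intro add_left_mono mult_left_mono hardy_admissible[OF hardy f(1,4,2)]) auto
    also have "\<dots> = ennreal (8 powr p + K * C) * ?I"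
      using K C by (simp add: ennreal_mult distrib_right mult.assoc)
    finally have "(\<Sum>i. capacity M p (E \<inter> Q i) \<Omega>) \<le> ennreal (N + 1) * (ennreal (8 powr p + K * C) * ?I)"
      by (simp add: mult_left_mono)
    also have "\<dots> = ennreal A * ?I"
      using N(1) K C by (simp add: A_def ennreal_mult mult.assoc)
    finally show "(\<Sum>i. capacity M p (E \<inter> Q i) \<Omega>) \<le> ennreal A * ?I" .
  qed
  then show ?thesis unfolding quasiadditive_def using A by blast
qed

end

section \<open>Quasiadditivity implies the Hardy inequality\<close>

text \<open>At infinity, where \<open>real_of_ereal\<close> is \<open>0\<close>, the value has to be \<open>b\<close>.\<close>

definition truncate :: "real \<Rightarrow> ereal \<Rightarrow> real"
  where "truncate b a = (if \<bar>a\<bar> = \<infinity> then b else min b \<bar>real_of_ereal a\<bar>)"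

lemma truncate_lipschitz:
  assumes "\<bar>a\<bar> \<noteq> \<infinity>" "\<bar>b\<bar> \<noteq> \<infinity>"
  shows "ereal \<bar>truncate s a - truncate s b\<bar> \<le> \<bar>a - b\<bar>"
proof -
  obtain x y where xy: "a = ereal x" "b = ereal y" using assms by (cases a; cases b) auto
  have "\<bar>(min s \<bar>x\<bar>) - (min s \<bar>y\<bar>)\<bar> \<le> \<bar>x - y\<bar>" by linarith
  then show ?thesis by (simp add: truncate_def xy)
qed

lemma truncate_measurable [measurable]: "truncate b \<in> borel_measurable borel"
  unfolding truncate_def[abs_def] by measurable

definition modulus_at_least :: "('a \<Rightarrow> ereal) \<Rightarrow> int \<Rightarrow> 'a set"
  where "modulus_at_least u j = {y. ereal (2 powr j) \<le> \<bar>u y\<bar>}"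

definition modulus_between :: "('a \<Rightarrow> ereal) \<Rightarrow> int \<Rightarrow> 'a set"
  where "modulus_between u j = {y. ereal (2 powr (j - 1)) < \<bar>u y\<bar> \<and> \<bar>u y\<bar> < ereal (2 powr j)}"

lemma disjoint_modulus_between: "j \<noteq> l \<Longrightarrow> modulus_between u j \<inter> modulus_between u l = {}"
proof (induction j l rule: linorder_wlog)
  case (le j l)
  have "2 powr real_of_int j \<le> 2 powr (real_of_int l - 1)" using le by (intro powr_mono) auto
  then have "ereal (2 powr real_of_int j) \<le> ereal (2 powr (real_of_int l - 1))" by simp
  then show ?case unfolding modulus_between_def
    by (auto dest: less_le_trans less_trans)
next
  case (sym j l)
  then show ?case by (simp add: Int_commute)
qed

context whitney_space
begin

lemma modulus_sets:
  assumes "u \<in> borel_measurable Mc"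
  shows "modulus_at_least u j \<in> sets Mc" "modulus_between u j \<in> sets Mc"
proof -
  have m: "(\<lambda>y. \<bar>u y\<bar>) \<in> borel_measurable Mc" using assms by measurable
  have le: "{y. a \<le> \<bar>u y\<bar>} \<in> sets Mc"
    and less: "{y. a < \<bar>u y\<bar>} \<in> sets Mc" "{y. \<bar>u y\<bar> < a} \<in> sets Mc" for a
    using borel_measurable_le[OF borel_measurable_const m, of a] borel_measurable_less[OF borel_measurable_const m, of a]
      borel_measurable_less[OF m borel_measurable_const, of a]
    by (simp_all add: space_M)
  show "modulus_at_least u j \<in> sets Mc" unfolding modulus_at_least_def by (rule le)
  show "modulus_between u j \<in> sets Mc"
    unfolding modulus_between_def Collect_conj_eq by (rule sets.Int[OF less(1,2)])
qed

text \<open>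
  Maz'ya's truncation: the function that interpolates linearly between \<open>2^(j-1)\<close> and \<open>2^j\<close>
  tests the capacity of the superlevel set, and it costs only the energy of \<open>u\<close> between these two
  levels: the gradient may be cut off both where this function and where its difference from \<open>1\<close>
  vanishes.
\<close>

lemma capacity_superlevel_le:
  assumes u: "u \<in> newtonian M p" "\<And>y. y \<notin> \<Omega> \<Longrightarrow> u y = 0" and g: "upper_gradient g u"
  shows "capacity M p (modulus_at_least u j) \<Omega> \<le> ennreal (4 powr p * 2 powr (- real_of_int j * p)) *
    (\<integral>\<^sup>+ y. epow (g y) p * indicator (\<Omega> \<inter> modulus_between u j) y \<partial>Mc)"
proof -
  note p = p_gt_1
  obtain k where k: "upper_gradient k u" "p_energy M p k < top"
    and um[measurable]: "u \<in> borel_measurable Mc"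
    and uint: "(\<integral>\<^sup>+ y. epow (e2ennreal \<bar>u y\<bar>) p \<partial>Mc) < top"
    using newtonianD[OF u(1)] .
  have k_meas: "k \<in> borel_measurable borel" and g_meas: "g \<in> borel_measurable borel"
    using k(1) g by (auto simp: upper_gradient_def)
  define b where "b = (2::real) powr j"
  have b: "0 < b" by (simp add: b_def)
  define v where "v y = truncate b (u y)" for y
  define f where "f y = max 0 (2 / b * v y - 1)" for y
  have v_ug: "ug_modulo k g v"
    unfolding v_def by (rule ug_modulo_upper_gradient[OF k(1) g truncate_lipschitz])
  have v_meas[measurable]: "v \<in> borel_measurable Mc" unfolding v_def[abs_def] by measurable
  have v_le: "v y \<le> b" "0 \<le> v y" for y using b by (auto simp: v_def truncate_def)
  have f01: "0 \<le> f y" "f y \<le> 1" for y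
    using v_le[of y] b by (auto simp: f_def field_simps)
  have low: "v y \<le> b / 2" if "\<not> ereal (b / 2) < \<bar>u y\<bar>" for y
    using that by (cases "u y") (auto simp: v_def truncate_def)
  have high: "v y = b" if "\<not> \<bar>u y\<bar> < ereal b" for y
    using that by (cases "u y") (auto simp: v_def truncate_def)
  have f_0: "f y = 0" if "\<not> ereal (b / 2) < \<bar>u y\<bar>" for y
    using low[OF that] b by (simp add: f_def field_simps)
  have f_1: "f y = 1" if "\<not> \<bar>u y\<bar> < ereal b" for y
    using high[OF that] b by (simp add: f_def)
  define A1 where "A1 = {y \<in> \<Omega>. ereal (b / 2) < \<bar>u y\<bar>}"
  define A2 where "A2 = {y. \<bar>u y\<bar> < ereal b}"
  have um': "(\<lambda>y. \<bar>u y\<bar>) \<in> borel_measurable Mc" by measurable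
  have A_sets: "A1 \<in> sets Mc" "A2 \<in> sets Mc"
    using sets.Int[OF \<Omega>_sets borel_measurable_less[OF borel_measurable_const um', of "ereal (b / 2)"]]
      borel_measurable_less[OF um' borel_measurable_const, of "ereal b"]
    by (simp_all add: space_M A1_def A2_def Int_def)
  obtain B1 where B1: "B1 \<in> sets borel" "A1 \<subseteq> B1" "B1 \<subseteq> \<Omega>" "AE y in Mc. y \<in> B1 \<longrightarrow> y \<in> A1"
  proof (rule borel_superset[OF A_sets(1)])
    show "A1 \<subseteq> \<Omega>" by (auto simp: A1_def)
  qed (use open_\<Omega> in auto)
  obtain B2 where B2: "B2 \<in> sets borel" "A2 \<subseteq> B2" "AE y in Mc. y \<in> B2 \<longrightarrow> y \<in> A2"
    by (rule borel_superset[OF A_sets(2), of UNIV]) auto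
  define h where "h y = ennreal (2 / b) * g y * indicator B1 y * indicator B2 y" for y
  have "ug_modulo k (\<lambda>y. ennreal (2 / b) * g y + ennreal 0 * g y) f"
  proof (rule ug_modulo_combine[OF v_ug v_ug])
    show "\<bar>f x - f y\<bar> \<le> 2 / b * \<bar>v x - v y\<bar> + 0 * \<bar>v x - v y\<bar>" for x y
    proof -
      have "\<bar>f x - f y\<bar> \<le> \<bar>2 / b * v x - 2 / b * v y\<bar>" unfolding f_def by linarith
      also have "2 / b * v x - 2 / b * v y = 2 / b * (v x - v y)" by (simp add: right_diff_distrib)
      also have "\<bar>\<dots>\<bar> = \<bar>2 / b\<bar> * \<bar>v x - v y\<bar>" by (rule abs_mult)
      also have "\<bar>2 / b\<bar> = 2 / b" using b by simp
      finally show ?thesis by simp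
    qed
  qed (use b in auto)
  then have "ug_modulo k (\<lambda>y. ennreal (2 / b) * g y) f" by simp
  then have f_ug: "ug_modulo k (\<lambda>y. ennreal (2 / b) * g y * indicator B1 y) f"
  proof (rule ug_modulo_restrict[OF _ B1(1)])
    fix y assume "y \<notin> B1"
    then have "y \<notin> \<Omega> \<or> \<not> ereal (b / 2) < \<bar>u y\<bar>" using B1(2) by (auto simp: A1_def)
    moreover have "\<not> ereal (b / 2) < \<bar>u y\<bar>" if "y \<notin> \<Omega>" using u(2)[OF that] b by simp
    ultimately show "f y = 0" using f_0 by blast
  qed
  have "ug_modulo k (\<lambda>y. ennreal 1 * (ennreal (2 / b) * g y * indicator B1 y) +
      ennreal 0 * (ennreal (2 / b) * g y * indicator B1 y)) (\<lambda>y. 1 - f y)"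
    by (rule ug_modulo_combine[OF f_ug f_ug]) auto
  then have "ug_modulo k (\<lambda>y. ennreal (2 / b) * g y * indicator B1 y) (\<lambda>y. 1 - f y)" by simp
  then have f'_ug: "ug_modulo k h (\<lambda>y. 1 - f y)"
    unfolding h_def
  proof (rule ug_modulo_restrict[OF _ B2(1)])
    fix y assume "y \<notin> B2"
    then have "y \<notin> A2" using B2(2) by auto
    then show "1 - f y = 0" using f_1[of y] by (simp add: A2_def)
  qed
  have "ug_modulo k (\<lambda>y. ennreal 1 * h y + ennreal 0 * h y) f"
    by (rule ug_modulo_combine[OF f'_ug f'_ug]) auto
  then have h_ug: "ug_modulo k h f" by simp
  have "capacity M p (modulus_at_least u j) \<Omega> \<le> ennreal (2 powr p) * p_energy M p h"
  proof (rule capacity_le[OF sets_M _ _ _ _ _ _ _ h_ug k_meas k(2)])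
    show "f \<in> borel_measurable Mc" unfolding f_def[abs_def] by measurable
    show "f y = 0" if "y \<notin> \<Omega>" for y
      using u(2)[OF that] b by (intro f_0) simp
    show "f y = 1" if "y \<in> modulus_at_least u j" for y
      using that by (intro f_1) (auto simp: modulus_at_least_def b_def)
    have "(\<integral>\<^sup>+ y. ennreal (f y powr p) \<partial>Mc) \<le>
        (\<integral>\<^sup>+ y. ennreal ((2 / b) powr p) * epow (e2ennreal \<bar>u y\<bar>) p \<partial>Mc)"
    proof (rule nn_integral_mono)
      fix y
      have "ennreal (f y) \<le> ennreal (2 / b * v y)"
        using v_le[of y] b by (intro ennreal_leI) (auto simp: f_def)
      also have "\<dots> = ennreal (2 / b) * ennreal (v y)" using b v_le by (intro ennreal_mult) auto
      also have "\<dots> \<le> ennreal (2 / b) * e2ennreal \<bar>u y\<bar>"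
        by (intro mult_left_mono, cases "u y") (auto simp: v_def truncate_def intro!: ennreal_leI)
      finally have "epow (ennreal (f y)) p \<le> epow (ennreal (2 / b) * e2ennreal \<bar>u y\<bar>) p"
        using p by (intro epow_mono) auto
      then show "ennreal (f y powr p) \<le> ennreal ((2 / b) powr p) * epow (e2ennreal \<bar>u y\<bar>) p"
        using f01 p b by (simp add: epow_ennreal epow_mult)
    qed
    also have "\<dots> = ennreal ((2 / b) powr p) * (\<integral>\<^sup>+ y. epow (e2ennreal \<bar>u y\<bar>) p \<partial>Mc)"
      by (rule nn_integral_cmult) measurable
    also have "\<dots> < top" using uint by (simp add: ennreal_mult_less_top)
    finally show "(\<integral>\<^sup>+ y. ennreal (f y powr p) \<partial>Mc) < top" .
  qed (use p f01 in auto)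
  also have "p_energy M p h = (\<integral>\<^sup>+ y. ennreal ((2 / b) powr p) *
      (epow (g y) p * indicator (\<Omega> \<inter> modulus_between u j) y) \<partial>Mc)"
  proof (rule nn_integral_cong_AE)
    show "AE y in Mc. epow (h y) p = ennreal ((2 / b) powr p) *
        (epow (g y) p * indicator (\<Omega> \<inter> modulus_between u j) y)"
      using B1(4) B2(3)
    proof eventually_elim
      case (elim y)
      have "y \<in> \<Omega> \<inter> modulus_between u j \<longleftrightarrow> y \<in> A1 \<and> y \<in> A2"
        by (simp add: A1_def A2_def modulus_between_def b_def powr_diff)
      then have "y \<in> \<Omega> \<inter> modulus_between u j \<longleftrightarrow> y \<in> B1 \<and> y \<in> B2" using elim B1(2) B2(2) by blast
      then show ?case
        using b p by (auto simp: h_def indicator_def epow_mult)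
    qed
  qed
  also have "\<dots> = ennreal ((2 / b) powr p) *
      (\<integral>\<^sup>+ y. epow (g y) p * indicator (\<Omega> \<inter> modulus_between u j) y \<partial>Mc)"
  proof (rule nn_integral_cmult)
    have [measurable]: "g \<in> borel_measurable Mc"
      by (rule borel_measurable_completion[OF sets_M g_meas])
    note [measurable] = modulus_sets(2)[OF um]
    show "(\<lambda>y. epow (g y) p * indicator (\<Omega> \<inter> modulus_between u j) y) \<in> borel_measurable Mc"
      by measurable
  qed
  also have "ennreal (2 powr p) * (ennreal ((2 / b) powr p) * x) = ennreal (4 powr p * 2 powr (- real_of_int j * p)) * x" for x
  proof -
    have "2 powr p * (2 / b) powr p = (2 * 2 / b) powr p" using b by (simp flip: powr_mult)
    also have "\<dots> = 4 powr p * b powr (- p)" using b by (simp add: powr_divide powr_minus_divide)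
    also have "b powr (- p) = 2 powr (- real_of_int j * p)" by (simp add: b_def powr_powr)
    finally show ?thesis by (simp add: mult.assoc[symmetric] flip: ennreal_mult)
  qed
  finally show ?thesis .
qed

text \<open>
  Maz'ya's capacitary condition for the Hardy inequality: \<open>measure_le_capacity\<close> on the pieces
  \<open>E \<inter> Q i\<close>, summed by quasiadditivity.
\<close>

lemma weighted_measure_le_capacity:
  assumes quasi: "quasiadditive M p \<Omega> Q"
    and c1: "0 < c1" "\<And>i. i \<in> I \<Longrightarrow>
      ennreal (c1 * rad i powr (- p)) * emeasure M (Q i) \<le> capacity M p (Q i) \<Omega>"
  obtains K where "0 < K" "\<And>E. E \<in> sets Mc \<Longrightarrow> E \<subseteq> \<Omega> \<Longrightarrow>
    (\<integral>\<^sup>+ y. ennreal (d y powr (- p)) * indicator E y \<partial>Mc) \<le> ennreal K * capacity M p E \<Omega>"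
proof -
  obtain C where C: "0 < C" "\<And>\<Omega> x r E. 0 < r \<Longrightarrow> ball x (2 * r) \<subseteq> \<Omega> \<Longrightarrow>
    ennreal (c1 * r powr (- p)) * emeasure M (ball x r) \<le> capacity M p (ball x r) \<Omega> \<Longrightarrow>
    E \<in> sets Mc \<Longrightarrow> E \<subseteq> ball x r \<Longrightarrow>
    ennreal (r powr (- p)) * emeasure Mc E \<le> ennreal C * capacity M p E \<Omega>"
    using measure_le_capacity[OF c1(1)] by blast
  obtain A where A: "0 < A" "\<And>E. E \<in> sets Mc \<Longrightarrow> E \<subseteq> \<Omega> \<Longrightarrow>
      (\<Sum>i. capacity M p (E \<inter> Q i) \<Omega>) \<le> ennreal A * capacity M p E \<Omega>"
    using quasi unfolding quasiadditive_def by blast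
  define b where "b = (2 * c) powr p"
  have b: "0 < b" using c_pos by (simp add: b_def)
  have Qs[measurable]: "Q i \<in> sets Mc" for i using double_ball_open(2) by (intro borel_sets) auto
  show ?thesis
  proof (rule that[of "b * C * A"])
    show "0 < b * C * A" using b C A by simp
    fix E assume E[measurable]: "E \<in> sets Mc" and sub: "E \<subseteq> \<Omega>"
    let ?w = "\<lambda>y. ennreal (d y powr (- p))"
    have piece: "(\<integral>\<^sup>+ y. ?w y * indicator (E \<inter> Q i) y \<partial>Mc) \<le>
        ennreal (b * C) * capacity M p (E \<inter> Q i) \<Omega>" for i
    proof (cases "i \<in> I")
      case True
      note r = rad_pos[OF True]
      have Q: "Q i = ball (z i) (rad i)" using True by (simp add: whitney_ball_def)
      have "(\<integral>\<^sup>+ y. ?w y * indicator (E \<inter> Q i) y \<partial>Mc) \<le>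
          (\<integral>\<^sup>+ y. ennreal (b * rad i powr (- p)) * indicator (E \<inter> Q i) y \<partial>Mc)"
      proof (rule nn_integral_mono)
        fix y
        show "?w y * indicator (E \<inter> Q i) y \<le> ennreal (b * rad i powr (- p)) * indicator (E \<inter> Q i) y"
        proof (cases "y \<in> E \<inter> Q i")
          case yin: True
          then have "y \<in> ball (z i) (2 * rad i)" using r by (auto simp: Q)
          note rc = rad_comparable[OF True this]
          have "b * (2 * c) powr (- p) = 1" using c_pos by (simp add: b_def powr_minus)
          then have "d y powr (- p) = b * ((2 * c) powr (- p) * d y powr (- p))"
            by (simp add: mult.assoc[symmetric])
          also have "(2 * c) powr (- p) * d y powr (- p) = (2 * c * d y) powr (- p)"
            by (rule powr_mult[symmetric])
          also have "b * (2 * c * d y) powr (- p) \<le> b * rad i powr (- p)"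
            using rc(2) r p_gt_1 b by (intro mult_left_mono powr_mono2') auto
          finally show ?thesis using yin by (simp add: ennreal_leI)
        qed simp
      qed
      also have "\<dots> = ennreal b * (ennreal (rad i powr (- p)) * emeasure Mc (E \<inter> Q i))"
        using b E Qs by (subst nn_integral_cmult_indicator) (simp_all add: ennreal_mult mult.assoc)
      also have "\<dots> \<le> ennreal b * (ennreal C * capacity M p (E \<inter> Q i) \<Omega>)"
        using rad_comparable(3)[OF True] c1(2)[OF True] r
        by (intro mult_left_mono C(2)[of "rad i" "z i"]) (auto simp: Q)
      finally show ?thesis using b C by (simp add: ennreal_mult mult.assoc)
    next
      case False
      then show ?thesis by (simp add: whitney_ball_def)
    qed
    have "(\<integral>\<^sup>+ y. ?w y * indicator E y \<partial>Mc) \<le>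
        (\<integral>\<^sup>+ y. (\<Sum>i. ?w y * indicator (E \<inter> Q i) y) \<partial>Mc)"
    proof (rule nn_integral_mono)
      fix y
      show "?w y * indicator E y \<le> (\<Sum>i. ?w y * indicator (E \<inter> Q i) y)"
      proof (cases "y \<in> E")
        case True
        then obtain i where i: "y \<in> Q i" using sub cover unfolding whitney_cover_def by blast
        have "?w y * indicator E y = (\<Sum>i\<in>{i}. ?w y * indicator (E \<inter> Q i) y)" using True i by simp
        also have "\<dots> \<le> (\<Sum>i. ?w y * indicator (E \<inter> Q i) y)" by (rule sum_le_suminf) auto
        finally show ?thesis .
      qed simp
    qed
    also have "\<dots> = (\<Sum>i. \<integral>\<^sup>+ y. ?w y * indicator (E \<inter> Q i) y \<partial>Mc)"
      by (rule nn_integral_suminf) measurable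
    also have "\<dots> \<le> (\<Sum>i. ennreal (b * C) * capacity M p (E \<inter> Q i) \<Omega>)"
      by (intro suminf_le piece) auto
    also have "\<dots> = ennreal (b * C) * (\<Sum>i. capacity M p (E \<inter> Q i) \<Omega>)" by simp
    also have "\<dots> \<le> ennreal (b * C) * (ennreal A * capacity M p E \<Omega>)"
      by (intro mult_left_mono A(2) E sub) auto
    finally show "(\<integral>\<^sup>+ y. ?w y * indicator E y \<partial>Mc) \<le> ennreal (b * C * A) * capacity M p E \<Omega>"
      using b C A by (simp add: ennreal_mult mult.assoc)
  qed
qed

lemma epow_le_dyadic_sum:
  assumes "0 < x" "\<bar>a\<bar> = ereal x"
  obtains j :: int where "ereal (2 powr j) \<le> \<bar>a\<bar>" "x powr p \<le> 2 powr p * 2 powr (j * p)"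
proof -
  define j where "j = \<lfloor>log 2 x\<rfloor>"
  have "2 powr j \<le> 2 powr (log 2 x)" unfolding j_def by (intro powr_mono) auto
  then have 1: "2 powr j \<le> x" using assms by simp
  have "2 powr (log 2 x) \<le> 2 powr (j + 1)" unfolding j_def by (intro powr_mono) linarith+
  then have "x \<le> 2 powr (j + 1)" using assms by simp
  then have "x powr p \<le> (2 powr (j + 1)) powr p" using assms p_gt_1 by (intro powr_mono2) auto
  also have "\<dots> = 2 powr p * 2 powr (j * p)" by (simp add: powr_powr powr_add[symmetric] algebra_simps)
  finally show ?thesis using that[of j] 1 assms by simp
qed

text \<open>
  The weight \<open>2^(j p)\<close> of the superlevel set for \<open>2^j\<close> cancels the factor \<open>2^(- j p)\<close> in its capacity
  estimate, and the sets between consecutive levels are disjoint, so the energies add up to at most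
  that of \<open>u\<close>.
\<close>

lemma quasiadditive_imp_hardy:
  assumes quasi: "quasiadditive M p \<Omega> Q"
    and c1: "0 < c1" "\<And>i. i \<in> I \<Longrightarrow>
      ennreal (c1 * rad i powr (- p)) * emeasure M (Q i) \<le> capacity M p (Q i) \<Omega>"
  shows "hardy_inequality M p \<Omega>"
proof -
  obtain K where K: "0 < K" "\<And>E. E \<in> sets Mc \<Longrightarrow> E \<subseteq> \<Omega> \<Longrightarrow>
    (\<integral>\<^sup>+ y. ennreal (d y powr (- p)) * indicator E y \<partial>Mc) \<le> ennreal K * capacity M p E \<Omega>"
    using weighted_measure_le_capacity[OF assms] by blast
  let ?C = "8 powr p * K"
  have "(\<integral>\<^sup>+ y \<in> \<Omega>. epow (e2ennreal \<bar>u y\<bar>) p * ennreal (d y powr (- p)) \<partial>Mc)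
      \<le> ennreal ?C * (\<integral>\<^sup>+ y \<in> \<Omega>. epow (g y) p \<partial>Mc)"
    if u: "u \<in> newtonian M p" "\<And>y. y \<notin> \<Omega> \<Longrightarrow> u y = 0" and g: "upper_gradient g u" for u g
  proof -
    obtain k where "upper_gradient k u" "p_energy M p k < top"
      and um[measurable]: "u \<in> borel_measurable Mc"
      and uint: "(\<integral>\<^sup>+ y. epow (e2ennreal \<bar>u y\<bar>) p \<partial>Mc) < top"
      using newtonianD[OF u(1)] .
    have "g \<in> borel_measurable borel" using g by (simp add: upper_gradient_def)
    then have [measurable]: "g \<in> borel_measurable Mc"
      by (rule borel_measurable_completion[OF sets_M])
    note [measurable] = modulus_sets[OF um]
    \<comment> \<open>The levels are enumerated by the natural numbers to sum over all the integers.\<close>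
    let ?j = "\<lambda>n. int_decode n" and ?w = "\<lambda>y. ennreal (d y powr (- p))"
    let ?E = "\<lambda>n. modulus_at_least u (?j n)" and ?A = "\<lambda>n. modulus_between u (?j n)"
    let ?a = "\<lambda>n. ennreal (2 powr p * 2 powr (real_of_int (?j n) * p))"
    have E_sub: "?E n \<subseteq> \<Omega>" for n
    proof
      fix y assume y: "y \<in> ?E n"
      show "y \<in> \<Omega>"
      proof (rule ccontr)
        assume "y \<notin> \<Omega>"
        then have "u y = 0" by (rule u(2))
        with y show False by (simp add: modulus_at_least_def)
      qed
    qed
    have "AE y in Mc. epow (e2ennreal \<bar>u y\<bar>) p \<noteq> \<infinity>"
      using uint by (intro nn_integral_PInf_AE) auto
    then have fin: "AE y in Mc. \<bar>u y\<bar> \<noteq> \<infinity>"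
      by eventually_elim (auto simp: epow_def)
    have "(\<integral>\<^sup>+ y \<in> \<Omega>. epow (e2ennreal \<bar>u y\<bar>) p * ?w y \<partial>Mc) \<le>
        (\<integral>\<^sup>+ y. (\<Sum>n. ?a n * (?w y * indicator (?E n) y)) \<partial>Mc)"
    proof (rule nn_integral_mono_AE)
      show "AE y in Mc. epow (e2ennreal \<bar>u y\<bar>) p * ?w y * indicator \<Omega> y \<le>
          (\<Sum>n. ?a n * (?w y * indicator (?E n) y))"
        using fin
      proof eventually_elim
        case (elim y)
        then obtain x where x: "\<bar>u y\<bar> = ereal x" "0 \<le> x" by (cases "u y") auto
        have ux: "e2ennreal \<bar>u y\<bar> = ennreal x" using x by simp
        show ?case
        proof (cases "x = 0")
          case True
          then show ?thesis unfolding ux by simp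
        next
          case False
          then obtain j :: int where j: "ereal (2 powr j) \<le> \<bar>u y\<bar>" "x powr p \<le> 2 powr p * 2 powr (j * p)"
            using epow_le_dyadic_sum[of x "u y"] x by auto
          define n where "n = int_encode j"
          have "epow (e2ennreal \<bar>u y\<bar>) p * ?w y * indicator \<Omega> y \<le> ennreal (x powr p) * ?w y"
            unfolding ux using x(2) by (auto simp: epow_ennreal indicator_def)
          also have "\<dots> \<le> ?a n * ?w y"
            using j(2) by (intro mult_right_mono ennreal_leI) (auto simp: n_def)
          also have "\<dots> = (\<Sum>n\<in>{n}. ?a n * (?w y * indicator (?E n) y))"
            using j(1) by (simp add: n_def modulus_at_least_def)
          also have "\<dots> \<le> (\<Sum>n. ?a n * (?w y * indicator (?E n) y))"
            by (rule sum_le_suminf) auto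
          finally show ?thesis .
        qed
      qed
    qed
    also have "\<dots> = (\<Sum>n. \<integral>\<^sup>+ y. ?a n * (?w y * indicator (?E n) y) \<partial>Mc)"
      by (rule nn_integral_suminf) measurable
    also have "\<dots> \<le> (\<Sum>n. ennreal ?C * (\<integral>\<^sup>+ y. epow (g y) p * indicator (\<Omega> \<inter> ?A n) y \<partial>Mc))"
    proof (intro suminf_le)
      fix n
      let ?I = "\<integral>\<^sup>+ y. epow (g y) p * indicator (\<Omega> \<inter> ?A n) y \<partial>Mc"
      have "(\<integral>\<^sup>+ y. ?a n * (?w y * indicator (?E n) y) \<partial>Mc) =
          ?a n * (\<integral>\<^sup>+ y. ?w y * indicator (?E n) y \<partial>Mc)"
        by (rule nn_integral_cmult) measurable
      also have "\<dots> \<le> ?a n * (ennreal K * (ennreal (4 powr p * 2 powr (- real_of_int (?j n) * p)) * ?I))"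
      proof (intro mult_left_mono order_trans[OF K(2)])
        show "capacity M p (?E n) \<Omega> \<le> ennreal (4 powr p * 2 powr (- real_of_int (?j n) * p)) * ?I"
          by (rule capacity_superlevel_le[OF u g])
      qed (use E_sub in auto)
      also have "\<dots> = ennreal (2 powr p * 2 powr (real_of_int (?j n) * p) * (K * (4 powr p * 2 powr (- real_of_int (?j n) * p)))) * ?I"
        using K by (simp add: ennreal_mult mult.assoc)
      also have "2 powr p * 2 powr (real_of_int (?j n) * p) * (K * (4 powr p * 2 powr (- real_of_int (?j n) * p))) =
          (2 powr p * 4 powr p) * K * (2 powr (real_of_int (?j n) * p) * 2 powr (- real_of_int (?j n) * p))" by simp
      also have "2 powr (real_of_int (?j n) * p) * 2 powr (- real_of_int (?j n) * p) = (1::real)" by (simp add: powr_minus field_simps)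
      also have "2 powr p * 4 powr p = (8::real) powr p" by (simp flip: powr_mult)
      finally show "(\<integral>\<^sup>+ y. ?a n * (?w y * indicator (?E n) y) \<partial>Mc) \<le> ennreal ?C * ?I" by simp
    qed auto
    also have "\<dots> = ennreal ?C * (\<Sum>n. \<integral>\<^sup>+ y. epow (g y) p * indicator (\<Omega> \<inter> ?A n) y \<partial>Mc)"
      by simp
    also have "(\<Sum>n. \<integral>\<^sup>+ y. epow (g y) p * indicator (\<Omega> \<inter> ?A n) y \<partial>Mc) =
        (\<integral>\<^sup>+ y. (\<Sum>n. epow (g y) p * indicator (\<Omega> \<inter> ?A n) y) \<partial>Mc)"
      by (rule nn_integral_suminf[symmetric]) measurable
    also have "\<dots> \<le> (\<integral>\<^sup>+ y \<in> \<Omega>. epow (g y) p \<partial>Mc)"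
    proof (rule nn_integral_mono)
      fix y
      have "disjoint_family (\<lambda>n. \<Omega> \<inter> ?A n)"
        unfolding disjoint_family_on_def
      proof (intro ballI impI)
        fix m n :: nat assume "m \<noteq> n"
        then have "?j m \<noteq> ?j n" using inj_int_decode[of UNIV] by (auto dest: injD)
        then show "(\<Omega> \<inter> ?A m) \<inter> (\<Omega> \<inter> ?A n) = {}" using disjoint_modulus_between[of "?j m" "?j n" u] by auto
      qed
      then have "(\<Sum>n. indicator (\<Omega> \<inter> ?A n) y :: ennreal) = indicator (\<Union>n. \<Omega> \<inter> ?A n) y"
        by (rule suminf_indicator)
      also have "\<dots> \<le> indicator \<Omega> y" by (auto simp: indicator_def)
      finally show "(\<Sum>n. epow (g y) p * indicator (\<Omega> \<inter> ?A n) y) \<le> epow (g y) p * indicator \<Omega> y"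
        by (simp add: mult_left_mono)
    qed
    finally show ?thesis by (simp add: mult_left_mono)
  qed
  then show ?thesis unfolding hardy_inequality_def using K(1) by (intro exI[of _ ?C]) auto
qed

lemma hardy_iff_quasiadditive:
  "hardy_inequality M p \<Omega> \<longleftrightarrow> quasiadditive M p \<Omega> Q \<and>
    (\<exists>c\<^sub>1>0. \<exists>c\<^sub>2>0. \<forall>i\<in>I.
      ennreal (c\<^sub>1 * rad i powr (- p)) * emeasure M (Q i) \<le> capacity M p (Q i) \<Omega> \<and>
      capacity M p (Q i) \<Omega> \<le> ennreal (c\<^sub>2 * rad i powr (- p)) * emeasure M (Q i))"
proof (intro iffI conjI)
  assume "hardy_inequality M p \<Omega>"
  then obtain C where C: "0 < C" "hardy_with C"
    unfolding hardy_inequality_def hardy_with_def by blast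
  show "quasiadditive M p \<Omega> Q" by (rule hardy_imp_quasiadditive[OF C])
  show "\<exists>c\<^sub>1>0. \<exists>c\<^sub>2>0. \<forall>i\<in>I.
      ennreal (c\<^sub>1 * rad i powr (- p)) * emeasure M (Q i) \<le> capacity M p (Q i) \<Omega> \<and>
      capacity M p (Q i) \<Omega> \<le> ennreal (c\<^sub>2 * rad i powr (- p)) * emeasure M (Q i)"
  proof (intro exI conjI ballI)
    show "0 < (3 / (2 * c)) powr (- p) / C" using C(1) c_pos by simp
    show "0 < 2 powr p * D" using D_ge_1 by simp
  next
    fix i assume i: "i \<in> I"
    show "ennreal ((3 / (2 * c)) powr (- p) / C * rad i powr (- p)) * emeasure M (Q i) \<le> capacity M p (Q i) \<Omega>"
      by (rule capacity_whitney_ge[OF C i])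
    show "capacity M p (Q i) \<Omega> \<le> ennreal (2 powr p * D * rad i powr (- p)) * emeasure M (Q i)"
      by (rule capacity_whitney_le[OF i])
  qed
next
  assume "quasiadditive M p \<Omega> Q \<and>
    (\<exists>c\<^sub>1>0. \<exists>c\<^sub>2>0. \<forall>i\<in>I.
      ennreal (c\<^sub>1 * rad i powr (- p)) * emeasure M (Q i) \<le> capacity M p (Q i) \<Omega> \<and>
      capacity M p (Q i) \<Omega> \<le> ennreal (c\<^sub>2 * rad i powr (- p)) * emeasure M (Q i))"
  then obtain c\<^sub>1 where "quasiadditive M p \<Omega> Q" "0 < c\<^sub>1"
    "\<And>i. i \<in> I \<Longrightarrow> ennreal (c\<^sub>1 * rad i powr (- p)) * emeasure M (Q i) \<le> capacity M p (Q i) \<Omega>"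
    by blast
  then show "hardy_inequality M p \<Omega>" by (rule quasiadditive_imp_hardy)
qed

end

theorem corollary3p5:
  fixes M :: "'a::complete_space measure" and p :: real
  assumes borel: "sets M = sets borel"
    and balls: "\<And>(x::'a) r. 0 < r \<Longrightarrow> 0 < emeasure M (ball x r) \<and> emeasure M (ball x r) < top"
    and doubling: "doubling_measure M"
    and poincare: "poincare_inequality M p"
    and p: "1 < p"
  shows "\<exists>c\<^sub>0. 0 < c\<^sub>0 \<and> c\<^sub>0 \<le> 1 / 2 \<and>
    (\<forall>\<Omega> I x c. open \<Omega> \<longrightarrow> \<Omega> \<noteq> UNIV \<longrightarrow> whitney_cover c \<Omega> I x \<longrightarrow> c \<le> c\<^sub>0 \<longrightarrow>
      (hardy_inequality M p \<Omega> \<longleftrightarrow>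
        quasiadditive M p \<Omega> (whitney_ball c \<Omega> I x) \<and>
        (\<exists>c\<^sub>1>0. \<exists>c\<^sub>2>0. \<forall>i\<in>I.
          ennreal (c\<^sub>1 * whitney_rad c \<Omega> x i powr (- p)) * emeasure M (whitney_ball c \<Omega> I x i)
            \<le> capacity M p (whitney_ball c \<Omega> I x i) \<Omega> \<and>
          capacity M p (whitney_ball c \<Omega> I x i) \<Omega>
            \<le> ennreal (c\<^sub>2 * whitney_rad c \<Omega> x i powr (- p)) * emeasure M (whitney_ball c \<Omega> I x i))))"
proof -
  obtain D where D: "0 < D"
    "\<And>x r. 0 < r \<Longrightarrow> emeasure M (ball x (2 * r)) \<le> ennreal D * emeasure M (ball x r)"
    using doubling unfolding doubling_measure_def by blast
  have doubling': "emeasure M (ball x (2 * r)) \<le> ennreal (max 1 D) * emeasure M (ball x r)"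
    if "0 < r" for x r
    by (rule order_trans[OF D(2)[OF that] mult_right_mono[OF ennreal_leI]]) auto
  have finite: "emeasure M (ball x r) < top" for x r
    using balls[of r x] by (cases "0 < r") (auto simp: ball_empty)
  obtain P L where PL: "0 < P" "1 \<le> L" and ineq: "\<And>x r f g. 0 < r \<Longrightarrow> f \<in> borel_measurable (completion M) \<Longrightarrow>
      (\<integral>\<^sup>+ y \<in> ball x r. e2ennreal \<bar>f y\<bar> \<partial>completion M) < top \<Longrightarrow>
      upper_gradient g f \<Longrightarrow>
        (1 / emeasure M (ball x r)) *
          (\<integral>\<^sup>+ y \<in> ball x r. e2ennreal \<bar>f y - ereal (mean_value M (ball x r) f)\<bar> \<partial>completion M)
        \<le> ennreal (P * r) *
          epow ((1 / emeasure M (ball x (L * r))) *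
            (\<integral>\<^sup>+ y \<in> ball x (L * r). epow (g y) p \<partial>completion M)) (1 / p)"
    using poincare unfolding poincare_inequality_def by blast
  interpret poincare_space M "max 1 D" p P L
    by unfold_locales (use borel balls doubling' finite PL ineq p in auto)
  \<comment> \<open>With \<open>1 / 2\<close> the doubled Whitney balls could reach up to the boundary of \<open>\<Omega>\<close>.\<close>
  show ?thesis
  proof (intro exI[of _ "1 / 4"] conjI allI impI)
    fix \<Omega> :: "'a set" and I x c
    assume "open \<Omega>" "\<Omega> \<noteq> UNIV" "whitney_cover c \<Omega> I x" "c \<le> 1 / 4"
    then interpret whitney_space M "max 1 D" p P L \<Omega> I x c by unfold_locales
    show "hardy_inequality M p \<Omega> \<longleftrightarrow>
        quasiadditive M p \<Omega> (whitney_ball c \<Omega> I x) \<and>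
        (\<exists>c\<^sub>1>0. \<exists>c\<^sub>2>0. \<forall>i\<in>I.
          ennreal (c\<^sub>1 * whitney_rad c \<Omega> x i powr (- p)) * emeasure M (whitney_ball c \<Omega> I x i)
            \<le> capacity M p (whitney_ball c \<Omega> I x i) \<Omega> \<and>
          capacity M p (whitney_ball c \<Omega> I x i) \<Omega>
            \<le> ennreal (c\<^sub>2 * whitney_rad c \<Omega> x i powr (- p)) * emeasure M (whitney_ball c \<Omega> I x i))"
      by (rule hardy_iff_quasiadditive)
  qed auto
qed

end
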